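(* Assume that $0<\alpha<n$, $1<q_1\le p_1<\infty$, $1<q_2\le p_2<\infty$, $0<t\le s<1$, $\frac{n}{n-\alpha}<r\le\infty$ and $1<a<\min(q_1,q_2)$, where $\frac1p=\frac1{p_1}+\frac1{p_2}$ and $\frac1q=\frac1{q_1}+\frac1{q_2}$. Suppose that $$\frac1s=\frac1p+\frac1r-\frac{n-\alpha}n,\qquad \frac1t=\frac1q+\frac1r-\frac{n-\alpha}n,$$ and that $\alpha,\beta,\gamma_1,\gamma_2$ satisfy $$\beta<n\Big(\frac1s-1\Big),\quad \gamma_1<\frac n{q_1'},\quad \gamma_2<\frac n{q_2'},\quad \alpha+\beta+\gamma_1+\gamma_2=n+\frac nt-\frac n{q_1}-\frac n{q_2},\quad \beta+\gamma_1+\gamma_2\ge0.$$ Then there is a constant $C$ such that for all $f,g\ge0$, $$\sup_{Q\in\mathscr{D}}|Q|^{\frac1s}\left(\fint_Q\Big(\frac{BT_\alpha(f,g)(x)}{|x|^\beta}\Big)^t dx\right)^{\frac1t}\le C\sup_{Q\in\mathscr{D}}|Q|^{\frac1{p_1}}\left(\fint_Q\big(f(x)|x|^{\gamma_1}\big)^{q_1}dx\right)^{\frac1{q_1}}\sup_{Q\in\mathscr{D}}|Q|^{\frac1{p_2}}\left(\fint_Q\big(g(x)|x|^{\gamma_2}\big)^{q_2}dx\right)^{\frac1{q_2}}.$$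
   Context: For $0<\alpha<n$, $BT_\alpha(f,g)(x)=\int_{\mathbb{R}^n}\frac{f(x-y)g(x+y)}{|y|^{\alpha}}\,dy$. $\mathscr{D}$ is the set of dyadic cubes $2^k(m+[0,1)^n)$, $k\in\mathbb{Z}$, $m\in\mathbb{Z}^n$; $\fint_Q h=\frac1{|Q|}\int_Q h$. For $b>1$, $b'=b/(b-1)$. *)

theory Defs
  imports "HOL-Analysis.Analysis"
begin

definition dyadic_cubes :: "'a::euclidean_space set set" where
  "dyadic_cubes = {Q. \<exists>(k::int) (m::'a \<Rightarrow> int).
      Q = {x. \<forall>i\<in>Basis. 2 powr k * real_of_int (m i) \<le> x \<bullet> i
                          \<and> x \<bullet> i < 2 powr k * (real_of_int (m i) + 1)}}"

definition epow :: "ennreal \<Rightarrow> real \<Rightarrow> ennreal" where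
  "epow x a = (if x = \<infinity> then \<infinity> else ennreal (enn2real x powr a))"

definition BT :: "real \<Rightarrow> ('a::euclidean_space \<Rightarrow> real) \<Rightarrow> ('a \<Rightarrow> real) \<Rightarrow> 'a \<Rightarrow> ennreal" where
  "BT \<alpha> f g x = (\<integral>\<^sup>+ y. ennreal (f (x - y) * g (x + y) / norm y powr \<alpha>) \<partial>lebesgue)"

definition morrey :: "real \<Rightarrow> real \<Rightarrow> ('a::euclidean_space \<Rightarrow> ennreal) \<Rightarrow> ennreal" where
  "morrey p q h = (SUP Q\<in>dyadic_cubes.
      ennreal (measure lebesgue Q powr (1 / p)) *
      epow (ennreal (1 / measure lebesgue Q) * (\<integral>\<^sup>+ x\<in>Q. epow (h x) q \<partial>lebesgue)) (1 / q))"

end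

theory Submission
  imports Defs
begin

text \<open>
  Write \<open>n\<close> for the dimension, \<open>F = f |x|^\<gamma>1\<close>, \<open>G = g |x|^\<gamma>2\<close>, \<open>1/p = 1/p1 + 1/p2\<close>,
  \<open>1/q = 1/q1 + 1/q2\<close>, \<open>\<delta> = \<beta> + \<gamma>1 + \<gamma>2\<close> and \<open>\<epsilon> = n - \<alpha> - \<delta>\<close>. The homogeneity condition forces
  \<open>\<delta> = n/r\<close>, so that \<open>\<epsilon> > 0\<close>, \<open>1/s = 1/p - \<epsilon>/n\<close> and \<open>1/t = 1/q - \<epsilon>/n\<close>.

  Lebesgue case: split the kernel into dyadic shells \<open>|y| ~ 2^j\<close>; since \<open>t < 1\<close> the \<open>t\<close>-th power is
  subadditive over \<open>j\<close>. On a ball \<open>B(z, 2^j)\<close> the shear \<open>(x, y) \<mapsto> (x - y, x + y)\<close> bounds the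
  integral of the \<open>j\<close>-th piece by the product of the integrals of \<open>f\<close> and \<open>g\<close> over the double ball,
  and Hoelder's inequality trades the weights for the factor \<open>max(|z|, 2^j)^(-\<delta>) \<le> 2^(-j\<delta>)\<close> and
  averages of \<open>F\<close> and \<open>G\<close> of orders \<open>a1 < q1\<close>, \<open>a2 < q2\<close>. Hedberg's splitting sums over \<open>j\<close> and the
  Hardy--Littlewood maximal theorem concludes.

  Morrey case on a cube \<open>Q\<close> of side \<open>l\<close>: the part \<open>|y| < l\<close> is the Lebesgue case for \<open>f\<close> and \<open>g\<close>
  restricted to a dilate of \<open>Q\<close>. On \<open>|y| ~ 2^j l\<close> the kernel is comparable to
  \<open>(2^j l)^(\<alpha>' - \<alpha>) |y|^(-\<alpha>')\<close>; applying the Lebesgue case to a smaller \<open>\<alpha>'\<close>, whose target exponent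
  \<open>\<tau> > t\<close> is still admissible, gains the factor \<open>2^(j (\<alpha>' - \<alpha> + n/q - n/p))\<close>, which is summable for
  some such \<open>\<alpha>'\<close> exactly because \<open>s < 1\<close> and \<open>\<beta> < n (1/s - 1)\<close>.
\<close>

section \<open>Powers of extended nonnegative reals and Hoelder's inequality\<close>

text \<open>Since t < 1, neither duality nor the triangle inequality in L^t is available, so
  everything goes back to local L^1 bounds: on a ball the t-th power is split by Hoelder with
  exponents t and 1 - t, and the second factor carries the weight |x|^(-\<beta> t / (1 - t)), which
  is locally integrable exactly when \<beta> < n (1/t - 1). Averages of order below q1 and q2 are
  used because the maximal theorem fails on L^1; the strict bounds on \<gamma>1 and \<gamma>2 leave
  room for them.

  In the Morrey estimate the far shells cannot be treated with \<alpha> itself: Morrey norms only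
  bound the local norms of F and G over a ball of radius 2^j l by a growing factor 2^(j (n/q -
  n/p)), and nothing compensates for it. Lowering \<alpha> with the weights fixed raises the target
  exponent from t to \<tau>. The comparison of kernels then brings decay in j, and the power of l
  that it introduces is cancelled exactly by Hoelder on the cube from \<tau> down to t.

  All estimates live in \<open>ennreal\<close>, so finiteness of the integrals is never an
  assumption; the price is a separate look at the values 0 and \<open>top\<close>.\<close>

lemma ennreal_neq_topE:
  assumes "x \<noteq> top"
  obtains r where "r \<ge> 0" "x = ennreal r"
  using assms by (cases x) auto

lemma epow_ennreal: "x \<ge> 0 \<Longrightarrow> epow (ennreal x) a = ennreal (x powr a)"
  by (simp add: epow_def)

lemma epow_top [simp]: "epow top a = top"
  by (simp add: epow_def)

lemma epow_0 [simp]: "epow 0 a = 0"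
  by (simp add: epow_def)

lemma epow_1 [simp]: "epow 1 a = 1"
  by (simp add: epow_def)

lemma epow_1_right [simp]: "epow x 1 = x"
  by (cases x) (simp_all add: epow_ennreal)

lemma epow_eq_0_iff [simp]: "epow x a = 0 \<longleftrightarrow> x = 0"
  by (cases x) (simp_all add: epow_ennreal)

lemma epow_eq_top_iff [simp]: "epow x a = top \<longleftrightarrow> x = top"
  by (cases x) (simp_all add: epow_ennreal)

text \<open>The conventions \<open>epow 0 a = 0\<close> and \<open>epow top a = top\<close> hold for
  every real \<open>a\<close>, also for \<open>a \<le> 0\<close>. Together with
  \<open>0 * top = 0\<close> they make the power laws valid without side conditions.\<close>

lemma epow_mult: "epow (x * y) a = epow x a * epow y a"
proof (cases "x = top \<or> y = top")
  case True
  then show ?thesis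
    by (cases "x = 0"; cases "y = 0") (auto simp: ennreal_top_mult ennreal_mult_top)
next
  case False
  then obtain u v where "u \<ge> 0" "x = ennreal u" "v \<ge> 0" "y = ennreal v"
    by (metis ennreal_cases infinity_ennreal_def)
  then show ?thesis
    by (simp add: epow_ennreal powr_mult flip: ennreal_mult)
qed

lemma epow_epow [simp]: "epow (epow x a) b = epow x (a * b)"
  by (cases x) (simp_all add: epow_ennreal powr_powr)

lemma epow_add_right: "epow x (a + b) = epow x a * epow x b"
  by (cases x) (simp_all add: epow_ennreal powr_add ennreal_mult)

lemma epow_mono: "0 \<le> a \<Longrightarrow> x \<le> y \<Longrightarrow> epow x a \<le> epow y a"
  by (cases x; cases y) (auto simp: epow_ennreal powr_mono2 top_unique)

lemma measurable_epow [measurable]: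
  assumes [measurable]: "f \<in> borel_measurable M"
  shows "(\<lambda>x. epow (f x) a) \<in> borel_measurable M"
  unfolding epow_def by measurable

lemma epow_le_iff: "0 < a \<Longrightarrow> epow x a \<le> y \<longleftrightarrow> x \<le> epow y (1 / a)"
  using epow_mono[of a x "epow y (1 / a)"] epow_mono[of "1 / a" "epow x a" y] by auto

text \<open>After division by \<open>x + y\<close> both terms lie in [0, 1], where raising to a
  power \<open>t \<le> 1\<close> can only increase them.\<close>

lemma powr_add_le:
  fixes x y t :: real
  assumes "0 \<le> x" "0 \<le> y" "0 < t" "t \<le> 1"
  shows "(x + y) powr t \<le> x powr t + y powr t"
proof (cases "x + y = 0")
  case False
  define s where "s = x + y"
  have s: "s > 0" using False assms by (simp add: s_def)
  have le: "u / s \<le> (u / s) powr t" if "0 \<le> u" "u \<le> s" for u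
    using powr_mono'[of t 1 "u / s"] that assms s by simp
  have "1 = x / s + y / s" using s by (simp add: s_def flip: add_divide_distrib)
  also have "\<dots> \<le> (x / s) powr t + (y / s) powr t"
    by (intro add_mono le) (use assms in \<open>auto simp: s_def\<close>)
  also have "\<dots> = (x powr t + y powr t) / s powr t"
    using assms s by (simp add: powr_divide add_divide_distrib)
  finally show ?thesis using s by (simp add: s_def field_simps)
qed (use assms in auto)

lemma epow_add_le:
  assumes "0 < t" "t \<le> 1"
  shows "epow (x + y) t \<le> epow x t + epow y t"
proof (cases "x = top \<or> y = top")
  case False
  then obtain u v where "u \<ge> 0" "x = ennreal u" "v \<ge> 0" "y = ennreal v"
    by (metis ennreal_cases infinity_ennreal_def)
  then show ?thesis
    using powr_add_le[of u v t] assms by (simp add: epow_ennreal flip: ennreal_plus)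
qed auto

lemma epow_sum_le:
  assumes "0 < t" "t \<le> 1"
  shows "epow (\<Sum>i<n. x i) t \<le> (\<Sum>i<(n::nat). epow (x i) t)"
  by (induction n) (auto intro: order_trans[OF epow_add_le[OF assms]] add_mono)

text \<open>Moving the exponent to the other side turns the claim into a bound on partial sums, so
  no continuity of \<open>epow\<close> is needed.\<close>

lemma epow_suminf_le:
  assumes "0 < t" "t \<le> 1"
  shows "epow (\<Sum>i. x i) t \<le> (\<Sum>i. epow (x i) t)"
proof -
  have "(\<Sum>i. x i) \<le> epow (\<Sum>i. epow (x i) t) (1 / t)"
  proof (rule suminf_le_const)
    show "(\<Sum>i<n. x i) \<le> epow (\<Sum>i. epow (x i) t) (1 / t)" for n
      using assms epow_sum_le[OF assms, of x n] sum_le_suminf[of "\<lambda>i. epow (x i) t" "{..<n}"]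
      by (subst epow_le_iff[symmetric]) (auto intro: order_trans)
  qed auto
  then show ?thesis using assms by (simp add: epow_le_iff)
qed

lemma young_epow:
  assumes "0 < \<theta>" "\<theta> < 1"
  shows "epow x \<theta> * epow y (1 - \<theta>) \<le> ennreal \<theta> * x + ennreal (1 - \<theta>) * y"
proof (cases "x = top \<or> y = top")
  case True
  then show ?thesis using assms by (auto simp: ennreal_mult_top)
next
  case False
  then obtain u v where uv: "u \<ge> 0" "x = ennreal u" "v \<ge> 0" "y = ennreal v"
    by (metis ennreal_cases infinity_ennreal_def)
  have "u powr \<theta> * v powr (1 - \<theta>) \<le> \<theta> * u + (1 - \<theta>) * v"
  proof (cases "u = 0 \<or> v = 0")
    case False
    then show ?thesis using Youngs_inequality_0[of \<theta> "1 - \<theta>" u v] assms uv by auto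
  qed (use assms uv in auto)
  then show ?thesis using uv assms
    by (simp add: epow_ennreal flip: ennreal_mult ennreal_plus)
qed

text \<open>Both integrals are normalised to 1 and Young's inequality is integrated. The degenerate
  cases come first: if one integral vanishes, the left side must vanish even when the other integral
  is infinite. Exponents \<theta> and 1 - \<theta> on the functions themselves keep the form usable
  for t < 1, where no norm is present.\<close>

lemma nn_integral_holder:
  assumes [measurable]: "f \<in> borel_measurable M" "g \<in> borel_measurable M"
    and th: "0 < \<theta>" "\<theta> < 1"
  shows "(\<integral>\<^sup>+x. epow (f x) \<theta> * epow (g x) (1 - \<theta>) \<partial>M)
           \<le> epow (\<integral>\<^sup>+x. f x \<partial>M) \<theta> * epow (\<integral>\<^sup>+x. g x \<partial>M) (1 - \<theta>)"
proof -
  define A B where "A = (\<integral>\<^sup>+x. f x \<partial>M)" and "B = (\<integral>\<^sup>+x. g x \<partial>M)"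
  consider "A = 0" | "B = 0" | "A \<noteq> 0" "B \<noteq> 0" "A = top \<or> B = top"
    | "A \<noteq> 0" "B \<noteq> 0" "A \<noteq> top" "B \<noteq> top" by blast
  then have "(\<integral>\<^sup>+x. epow (f x) \<theta> * epow (g x) (1 - \<theta>) \<partial>M) \<le> epow A \<theta> * epow B (1 - \<theta>)"
  proof cases
    case 1
    then have "AE x in M. f x = 0" by (simp add: A_def nn_integral_0_iff_AE)
    then have "(\<integral>\<^sup>+x. epow (f x) \<theta> * epow (g x) (1 - \<theta>) \<partial>M) = (\<integral>\<^sup>+x. 0 \<partial>M)"
      by (intro nn_integral_cong_AE) auto
    then show ?thesis by simp
  next
    case 2
    then have "AE x in M. g x = 0" by (simp add: B_def nn_integral_0_iff_AE)
    then have "(\<integral>\<^sup>+x. epow (f x) \<theta> * epow (g x) (1 - \<theta>) \<partial>M) = (\<integral>\<^sup>+x. 0 \<partial>M)"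
      by (intro nn_integral_cong_AE) auto
    then show ?thesis by simp
  next
    case 3
    then have "epow A \<theta> * epow B (1 - \<theta>) = top" by (auto simp: ennreal_mult_eq_top_iff)
    then show ?thesis by simp
  next
    case 4
    obtain a b where ab: "A = ennreal a" "a > 0" "B = ennreal b" "b > 0"
      using 4 by (metis ennreal_cases ennreal_0 infinity_ennreal_def order_le_less)
    define f' where "f' x = ennreal (1 / a) * f x" for x
    define g' where "g' x = ennreal (1 / b) * g x" for x
    have [measurable]: "f' \<in> borel_measurable M" "g' \<in> borel_measurable M"
      unfolding f'_def[abs_def] g'_def[abs_def] by measurable
    have I: "(\<integral>\<^sup>+x. f' x \<partial>M) = 1" "(\<integral>\<^sup>+x. g' x \<partial>M) = 1"
      using ab by (auto simp: f'_def g'_def nn_integral_cmult A_def[symmetric] B_def[symmetric]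
          simp flip: ennreal_mult)
    have f: "f x = A * f' x" and g: "g x = B * g' x" for x
      using ab by (auto simp: f'_def g'_def mult.assoc[symmetric] simp flip: ennreal_mult)
    have "(\<integral>\<^sup>+x. epow (f x) \<theta> * epow (g x) (1 - \<theta>) \<partial>M)
        = (\<integral>\<^sup>+x. (epow A \<theta> * epow B (1 - \<theta>)) * (epow (f' x) \<theta> * epow (g' x) (1 - \<theta>)) \<partial>M)"
      unfolding f g epow_mult by (simp add: mult_ac)
    also have "\<dots> = (epow A \<theta> * epow B (1 - \<theta>)) * (\<integral>\<^sup>+x. epow (f' x) \<theta> * epow (g' x) (1 - \<theta>) \<partial>M)"
      by (rule nn_integral_cmult) measurable
    also have "\<dots> \<le> (epow A \<theta> * epow B (1 - \<theta>)) * (\<integral>\<^sup>+x. ennreal \<theta> * f' x + ennreal (1 - \<theta>) * g' x \<partial>M)"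
      by (intro mult_left_mono nn_integral_mono young_epow th) auto
    also have "(\<integral>\<^sup>+x. ennreal \<theta> * f' x + ennreal (1 - \<theta>) * g' x \<partial>M) = 1"
      using th by (simp add: nn_integral_add nn_integral_cmult I flip: ennreal_plus)
    finally show ?thesis by simp
  qed
  then show ?thesis by (simp add: A_def B_def)
qed

section \<open>Power weights on balls\<close>

text \<open>Comparability in both directions lets one constant serve exponents of either sign;
  weights of both signs occur below.\<close>

lemma powr_le_comparable:
  fixes a b c e :: real
  assumes "0 < a" "0 < b" "1 \<le> c" "a \<le> c * b" "b \<le> c * a"
  shows "a powr e \<le> c powr \<bar>e\<bar> * b powr e"
proof (cases "e \<ge> 0")
  case True
  have "a powr e \<le> (c * b) powr e" using assms True by (intro powr_mono2) auto
  then show ?thesis using assms True by (simp add: powr_mult)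
next
  case False
  have "(c * a) powr e \<le> b powr e" using assms False by (intro powr_mono2') auto
  then have "c powr (-e) * (c powr e * a powr e) \<le> c powr (-e) * b powr e"
    using assms by (intro mult_left_mono) (auto simp: powr_mult)
  then show ?thesis using assms False
    by (simp add: mult.assoc[symmetric] powr_add[symmetric])
qed

lemma dyadic_shell:
  fixes u R :: real
  assumes "0 < u" "u < R"
  obtains k :: nat where "R / 2 ^ Suc k \<le> u" "u < R / 2 ^ k"
proof -
  have ex: "\<exists>k. R / 2 ^ k \<le> u"
  proof -
    obtain k where "(1/2) ^ k < u / R" using real_arch_pow_inv[of "u / R" "1/2"] assms by auto
    then have "R / 2 ^ k \<le> u" using assms by (simp add: field_simps)
    then show ?thesis ..
  qed
  define m where "m = (LEAST k. R / 2 ^ k \<le> u)"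
  have m: "R / 2 ^ m \<le> u" unfolding m_def by (rule LeastI_ex[OF ex])
  have "m \<noteq> 0" using m assms by (intro notI) auto
  then obtain k where k: "m = Suc k" by (cases m) auto
  have "\<not> R / 2 ^ k \<le> u" using not_less_Least[of k "\<lambda>k. R / 2 ^ k \<le> u"] k m_def by auto
  then show ?thesis using that[of k] m k by auto
qed

lemma ennreal_le_suminf:
  fixes f :: "nat \<Rightarrow> ennreal"
  shows "f k \<le> (\<Sum>k. f k)"
  using sum_le_suminf[of f "{k}"] by simp

text \<open>For \<kappa> \<le> 0 the weight is at most its value on the boundary sphere. For
  \<kappa> > 0 the ball is cut into the shells R / 2^(k+1) \<le> |x| < R / 2^k, whose contributions
  form a geometric series of ratio 2^(\<kappa> - n) < 1.\<close>

lemma nn_integral_norm_powr_ball: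
  fixes \<kappa> :: real
  assumes kn: "\<kappa> < DIM('a::euclidean_space)"
  shows "\<exists>C\<ge>0. \<forall>R>0. (\<integral>\<^sup>+x\<in>ball (0::'a) R. ennreal (norm x powr (- \<kappa>)) \<partial>lborel)
           \<le> ennreal (C * R powr (DIM('a) - \<kappa>))"
proof (cases "\<kappa> \<le> 0")
  case True
  define v where "v = unit_ball_vol (real DIM('a))"
  have v: "v \<ge> 0" by (simp add: v_def unit_ball_vol_nonneg)
  show ?thesis
  proof (intro exI[of _ v] conjI allI impI v)
    fix R :: real assume R: "R > 0"
    have "(\<integral>\<^sup>+x\<in>ball (0::'a) R. ennreal (norm x powr (- \<kappa>)) \<partial>lborel)
        \<le> (\<integral>\<^sup>+x. ennreal (R powr (- \<kappa>)) * indicator (ball (0::'a) R) x \<partial>lborel)"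
      by (intro nn_integral_mono) (use True in \<open>auto simp: indicator_def intro!: ennreal_leI powr_mono2\<close>)
    also have "\<dots> = ennreal (R powr (- \<kappa>)) * ennreal (v * R ^ DIM('a))"
      using R by (simp add: nn_integral_cmult_indicator emeasure_ball v_def)
    also have "\<dots> = ennreal (v * R powr (DIM('a) - \<kappa>))"
      using R v by (simp add: powr_diff powr_minus powr_realpow field_simps flip: ennreal_mult)
    finally show "(\<integral>\<^sup>+x\<in>ball (0::'a) R. ennreal (norm x powr (- \<kappa>)) \<partial>lborel)
        \<le> ennreal (v * R powr (DIM('a) - \<kappa>))" .
  qed
next
  case False
  define n where "n = real DIM('a)"
  define v where "v = unit_ball_vol n"
  have v: "v \<ge> 0" by (simp add: v_def n_def unit_ball_vol_nonneg)
  define q where "q = 2 powr (\<kappa> - n)"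
  have q: "0 \<le> q" "q < 1" using kn by (auto simp: q_def n_def powr_less_one)
  define C where "C = v * 2 powr \<kappa> * (1 / (1 - q))"
  show ?thesis
  proof (intro exI[of _ C] conjI allI impI)
    show "C \<ge> 0" using v q by (auto simp: C_def)
    fix R :: real assume R: "R > 0"
    \<comment> \<open>The whole ball replaces the shell: this costs only a constant and makes the
      volume explicit. The origin lies in no shell, but the weight is 0 there because
      \<open>0 powr a = 0\<close>.\<close>
    define F where "F k x = ennreal ((R / 2 ^ Suc k) powr (- \<kappa>)) * indicator (ball (0::'a) (R / 2 ^ k)) x" for k x
    have [measurable]: "F k \<in> borel_measurable lborel" for k
      unfolding F_def[abs_def] by (intro borel_measurable_times_ennreal borel_measurable_indicator) auto
    have pt: "ennreal (norm x powr (- \<kappa>)) * indicator (ball 0 R) x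
        \<le> (\<Sum>k. F k x)" for x :: 'a
    proof (cases "x \<noteq> 0 \<and> norm x < R")
      case True
      then obtain k where k: "R / 2 ^ Suc k \<le> norm x" "norm x < R / 2 ^ k"
        using dyadic_shell[of "norm x" R] by auto
      have "ennreal (norm x powr (- \<kappa>)) * indicator (ball 0 R) x
        \<le> F k x"
        using k True False R by (auto simp: F_def indicator_def intro!: ennreal_leI powr_mono2')
      also have "\<dots> \<le> (\<Sum>k. F k x)"
        by (rule ennreal_le_suminf)
      finally show ?thesis .
    qed (auto simp: indicator_def)
    have shell: "(\<integral>\<^sup>+x. F k x \<partial>lborel)
        = ennreal (v * 2 powr \<kappa> * R powr (n - \<kappa>) * q ^ k)" for k
    proof -
      have e1: "(R / 2 ^ Suc k) powr (- \<kappa>) = R powr (-\<kappa>) * 2 powr \<kappa> * 2 powr (k * \<kappa>)"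
      proof -
        have "(2::real) ^ Suc k = 2 powr (1 + real k)"
          by (simp add: powr_add powr_realpow)
        then have "(R / 2 ^ Suc k) powr (- \<kappa>) = R powr (- \<kappa>) / (2 powr (1 + real k)) powr (- \<kappa>)"
          using R by (simp only: powr_divide)
        also have "\<dots> = R powr (- \<kappa>) * 2 powr (\<kappa> + k * \<kappa>)"
          by (simp add: powr_powr powr_minus_divide algebra_simps)
        finally show ?thesis by (simp add: powr_add)
      qed
      have e2: "q ^ k = 2 powr (k * \<kappa>) / (2 ^ k) ^ DIM('a)"
        unfolding q_def n_def
      proof -
        have "((2::real) ^ k) ^ DIM('a) = 2 powr (real k * DIM('a))"
          by (simp add: powr_realpow[symmetric] powr_powr)
        then show "(2 powr (\<kappa> - real DIM('a))) ^ k = 2 powr (k * \<kappa>) / (2 ^ k) ^ DIM('a)"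
          by (simp add: powr_realpow[symmetric] powr_powr powr_diff[symmetric] algebra_simps)
      qed
      have eq: "(R powr (- \<kappa>) * 2 powr \<kappa> * 2 powr (k * \<kappa>)) * (v * (R / 2 ^ k) ^ DIM('a))
          = v * 2 powr \<kappa> * R powr (n - \<kappa>) * q ^ k"
        using R unfolding e2 by (simp add: n_def powr_diff powr_minus powr_realpow power_divide field_simps)
      have "(\<integral>\<^sup>+x. ennreal ((R / 2 ^ Suc k) powr (- \<kappa>)) * indicator (ball (0::'a) (R / 2 ^ k)) x \<partial>lborel)
        = ennreal ((R powr (- \<kappa>) * 2 powr \<kappa> * 2 powr (k * \<kappa>)) * (v * (R / 2 ^ k) ^ DIM('a)))"
        using R v unfolding e1
        by (subst nn_integral_cmult_indicator) (simp_all add: emeasure_ball v_def n_def ennreal_mult[symmetric])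
      then show ?thesis by (simp only: eq F_def)
    qed
    have "(\<integral>\<^sup>+x\<in>ball (0::'a) R. ennreal (norm x powr (- \<kappa>)) \<partial>lborel)
        \<le> (\<integral>\<^sup>+x. (\<Sum>k. F k x) \<partial>lborel)"
      by (intro nn_integral_mono pt)
    also have "\<dots> = (\<Sum>k. \<integral>\<^sup>+x. F k x \<partial>lborel)"
      by (rule nn_integral_suminf) measurable
    also have "\<dots> = (\<Sum>k. ennreal (v * 2 powr \<kappa> * R powr (n - \<kappa>) * q ^ k))"
      by (simp only: shell)
    also have "\<dots> = ennreal (\<Sum>k. v * 2 powr \<kappa> * R powr (n - \<kappa>) * q ^ k)"
      using v q by (intro suminf_ennreal2 summable_mult summable_geometric) auto
    also have "(\<Sum>k. v * 2 powr \<kappa> * R powr (n - \<kappa>) * q ^ k) = C * R powr (n - \<kappa>)"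
      using q by (subst suminf_mult) (auto simp: summable_geometric suminf_geometric C_def)
    finally show "(\<integral>\<^sup>+x\<in>ball (0::'a) R. ennreal (norm x powr (- \<kappa>)) \<partial>lborel)
        \<le> ennreal (C * R powr (DIM('a) - \<kappa>))" by (simp add: n_def)
  qed
qed

text \<open>If |z| \<ge> 4 \<rho>, every point of the ball has norm within a factor 2 of |z|, so the
  weight is essentially constant. Otherwise the ball lies in the ball of radius 6 \<rho> about 0,
  and \<open>max (norm z) \<rho>\<close> is between \<rho> and 4 \<rho>.\<close>

lemma nn_integral_norm_powr_ball_center:
  fixes \<kappa> :: real
  assumes kn: "\<kappa> < DIM('a::euclidean_space)"
  shows "\<exists>C\<ge>0. \<forall>(z::'a) \<rho>. 0 < \<rho> \<longrightarrow>
     (\<integral>\<^sup>+x\<in>ball z (2 * \<rho>). ennreal (norm x powr (- \<kappa>)) \<partial>lborel)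
       \<le> ennreal (C * \<rho> ^ DIM('a) * max (norm z) \<rho> powr (- \<kappa>))"
proof -
  obtain C1 where C1: "C1 \<ge> 0" and I: "\<And>R. R > 0 \<Longrightarrow>
      (\<integral>\<^sup>+x\<in>ball (0::'a) R. ennreal (norm x powr (- \<kappa>)) \<partial>lborel) \<le> ennreal (C1 * R powr (DIM('a) - \<kappa>))"
    using nn_integral_norm_powr_ball[OF kn] by blast
  define v where "v = unit_ball_vol (real DIM('a))"
  have v: "v \<ge> 0" by (simp add: v_def unit_ball_vol_nonneg)
  define Ca Cb where "Ca = 2 powr \<bar>\<kappa>\<bar> * v * 2 ^ DIM('a)"
    and "Cb = C1 * 6 powr (DIM('a) - \<kappa>) * 4 powr \<bar>\<kappa>\<bar>"
  have nn: "Ca \<ge> 0" "Cb \<ge> 0" using v C1 by (auto simp: Ca_def Cb_def)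
  show ?thesis
  proof (intro exI[of _ "max Ca Cb"] conjI allI impI)
    show "0 \<le> max Ca Cb" using nn by simp
    fix z :: 'a and \<rho> :: real assume \<rho>: "0 < \<rho>"
    show "(\<integral>\<^sup>+x\<in>ball z (2 * \<rho>). ennreal (norm x powr (- \<kappa>)) \<partial>lborel)
       \<le> ennreal (max Ca Cb * \<rho> ^ DIM('a) * max (norm z) \<rho> powr (- \<kappa>))"
    proof (cases "norm z \<ge> 4 * \<rho>")
      case True
      have "norm x powr (- \<kappa>) \<le> 2 powr \<bar>\<kappa>\<bar> * norm z powr (- \<kappa>)" if "dist z x < 2 * \<rho>" for x
      proof -
        have "norm z \<le> 2 * norm x" "norm x \<le> 2 * norm z"
          using that True norm_triangle_ineq2[of z x] norm_triangle_ineq2[of x z]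
          by (auto simp: dist_norm norm_minus_commute)
        moreover have "0 < norm z" using True \<rho> by linarith
        moreover from calculation have "0 < norm x" by linarith
        ultimately show ?thesis
          using powr_le_comparable[of "norm x" "norm z" 2 "-\<kappa>"] by simp
      qed
      then have "(\<integral>\<^sup>+x\<in>ball z (2 * \<rho>). ennreal (norm x powr (- \<kappa>)) \<partial>lborel)
        \<le> (\<integral>\<^sup>+x. ennreal (2 powr \<bar>\<kappa>\<bar> * norm z powr (- \<kappa>)) * indicator (ball z (2 * \<rho>)) x \<partial>lborel)"
        by (intro nn_integral_mono) (auto simp: indicator_def intro!: ennreal_leI)
      also have "\<dots> = ennreal (Ca * \<rho> ^ DIM('a) * norm z powr (- \<kappa>))"
        using \<rho> v by (subst nn_integral_cmult_indicator)
          (simp_all add: emeasure_ball v_def Ca_def power_mult_distrib mult_ac flip: ennreal_mult)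
      also have "\<dots> \<le> ennreal (max Ca Cb * \<rho> ^ DIM('a) * max (norm z) \<rho> powr (- \<kappa>))"
        using True \<rho> by (intro ennreal_leI mult_mono) (auto simp: max_def nn)
      finally show ?thesis .
    next
      case False
      have sub: "ball z (2 * \<rho>) \<subseteq> ball 0 (6 * \<rho>)"
        using False by (auto simp: subset_iff dist_norm)
           (smt (verit) norm_triangle_ineq2 norm_minus_commute)
      have "(\<integral>\<^sup>+x\<in>ball z (2 * \<rho>). ennreal (norm x powr (- \<kappa>)) \<partial>lborel)
        \<le> (\<integral>\<^sup>+x\<in>ball (0::'a) (6 * \<rho>). ennreal (norm x powr (- \<kappa>)) \<partial>lborel)"
        by (intro nn_integral_mono) (use sub in \<open>auto simp: indicator_def\<close>)
      also have "\<dots> \<le> ennreal (C1 * (6 * \<rho>) powr (DIM('a) - \<kappa>))"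
        using \<rho> by (intro I) auto
      also have "\<dots> \<le> ennreal (max Ca Cb * \<rho> ^ DIM('a) * max (norm z) \<rho> powr (- \<kappa>))"
      proof (intro ennreal_leI)
        have "\<rho> powr (- \<kappa>) \<le> 4 powr \<bar>- \<kappa>\<bar> * max (norm z) \<rho> powr (- \<kappa>)"
          using False \<rho> by (intro powr_le_comparable) auto
        then have "C1 * (6 * \<rho>) powr (DIM('a) - \<kappa>)
            \<le> C1 * 6 powr (DIM('a) - \<kappa>) * \<rho> ^ DIM('a) * (4 powr \<bar>\<kappa>\<bar> * max (norm z) \<rho> powr (- \<kappa>))"
          using \<rho> C1 by (simp add: powr_mult powr_diff[of \<rho>] powr_realpow powr_minus_divide
              mult.assoc mult_left_mono divide_inverse)
        also have "\<dots> = Cb * (\<rho> ^ DIM('a) * max (norm z) \<rho> powr (- \<kappa>))"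
          by (simp add: Cb_def)
        also have "\<dots> \<le> max Ca Cb * (\<rho> ^ DIM('a) * max (norm z) \<rho> powr (- \<kappa>))"
          using \<rho> by (intro mult_right_mono) auto
        finally show "C1 * (6 * \<rho>) powr (DIM('a) - \<kappa>) \<le> max Ca Cb * \<rho> ^ DIM('a) * max (norm z) \<rho> powr (- \<kappa>)"
          by (simp add: mult_ac)
      qed
      finally show ?thesis .
    qed
  qed
qed

section \<open>The dyadic Hardy--Littlewood maximal function\<close>

lemma nn_integral_count_space_int:
  fixes f :: "int \<Rightarrow> ennreal"
  shows "(\<integral>\<^sup>+j. f j \<partial>count_space UNIV) = (\<Sum>n. f (int_decode n))"
  using nn_integral_bij_count_space[OF bij_int_decode, of f]
  by (simp add: nn_integral_count_space_nat)

lemma nn_integral_count_space_int_ge: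
  fixes f :: "int \<Rightarrow> ennreal"
  shows "f k \<le> (\<integral>\<^sup>+j. f j \<partial>count_space UNIV)"
  unfolding nn_integral_count_space_int
  using ennreal_le_suminf[of "\<lambda>n. f (int_decode n)" "int_encode k"] by simp

text \<open>Sums over all scales are written as integrals over \<open>count_space UNIV\<close>, so
  that exchanging them with \<open>lborel\<close> integrals is an instance of Fubini;
  \<open>int_decode\<close> carries the series facts over.\<close>

lemma epow_nn_integral_int_le:
  fixes f :: "int \<Rightarrow> ennreal"
  assumes "0 < t" "t \<le> 1"
  shows "epow (\<integral>\<^sup>+j. f j \<partial>count_space UNIV) t \<le> (\<integral>\<^sup>+j. epow (f j) t \<partial>count_space UNIV)"
  unfolding nn_integral_count_space_int by (rule epow_suminf_le[OF assms])

lemma two_powr_floor_log: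
  fixes l :: real
  assumes "0 < l"
  shows "2 powr \<lfloor>log 2 l\<rfloor> \<le> l" "l < 2 powr (\<lfloor>log 2 l\<rfloor> + 1)"
  using assms by (auto simp: le_log_iff[symmetric] log_less_iff[symmetric])

text \<open>The point is uniformity in \<open>l\<close>. With \<open>j0\<close> the integer part of
  log 2 l, the summand decays geometrically in |j - j0|, and translating the index removes
  \<open>j0\<close>. Since l may be almost 2^(j0 + 1), the right half loses a factor 2^c2.\<close>

lemma nn_integral_int_two_sided_geometric:
  fixes c1 c2 :: real
  assumes "0 < c1" "0 < c2"
  shows "\<exists>C\<ge>0. \<forall>l>0. (\<integral>\<^sup>+j. ennreal (min ((2 powr real_of_int j / l) powr c1)
            ((2 powr real_of_int j / l) powr (- c2))) \<partial>count_space UNIV) \<le> ennreal C"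
proof -
  define c where "c = min c1 c2"
  define q where "q = 2 powr (- c / 2)"
  have c: "c > 0" "c \<le> c1" "c \<le> c2" using assms by (auto simp: c_def)
  have q: "0 \<le> q" "q < 1" using c by (auto simp: q_def powr_less_one)
  define C where "C = 2 powr c2 * (1 / (1 - q))"
  show ?thesis
  proof (intro exI[of _ C] conjI allI impI)
    show "C \<ge> 0" using q by (auto simp: C_def)
    fix l :: real assume l: "l > 0"
    define j0 where "j0 = \<lfloor>log 2 l\<rfloor>"
    have j0: "2 powr j0 \<le> l" "l < 2 powr (j0 + 1)"
      using two_powr_floor_log[OF l] by (auto simp: j0_def)
    have pt: "min ((2 powr j / l) powr c1) ((2 powr j / l) powr (- c2))
        \<le> 2 powr c2 * 2 powr (- c * real_of_int \<bar>j - j0\<bar>)" for j :: int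
    proof (cases "j \<le> j0")
      case True
      have "2 powr j / l \<le> 2 powr (real_of_int j - j0)"
        using j0 l by (simp add: powr_diff frac_le)
      then have "(2 powr j / l) powr c1 \<le> (2 powr (real_of_int j - j0)) powr c1"
        using l c by (intro powr_mono2) auto
      also have "\<dots> = 2 powr (- c1 * real_of_int \<bar>j - j0\<bar>)"
        using True by (simp add: powr_powr algebra_simps)
      also have "\<dots> \<le> 1 * 2 powr (- c * real_of_int \<bar>j - j0\<bar>)"
        using c by (simp add: mult_right_mono)
      also have "\<dots> \<le> 2 powr c2 * 2 powr (- c * real_of_int \<bar>j - j0\<bar>)"
        using c by (intro mult_right_mono ge_one_powr_ge_zero) auto
      finally show ?thesis by linarith
    next
      case False
      have "2 powr (real_of_int j - j0 - 1) \<le> 2 powr j / l"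
        using j0 l by (simp add: powr_diff powr_add field_simps)
      then have "(2 powr j / l) powr (- c2) \<le> (2 powr (real_of_int j - j0 - 1)) powr (- c2)"
        using l c by (intro powr_mono2') auto
      also have "\<dots> = 2 powr (c2 + - c2 * real_of_int \<bar>j - j0\<bar>)"
        using False by (simp add: powr_powr algebra_simps)
      also have "\<dots> = 2 powr c2 * 2 powr (- c2 * real_of_int \<bar>j - j0\<bar>)"
        by (rule powr_add)
      also have "\<dots> \<le> 2 powr c2 * 2 powr (- c * real_of_int \<bar>j - j0\<bar>)"
        using c by (intro mult_left_mono) (auto simp: mult_right_mono)
      finally show ?thesis by linarith
    qed
    have bij: "bij_betw (\<lambda>j. j - j0) UNIV UNIV"
      by (rule bij_betwI[of _ _ _ "\<lambda>j. j + j0"]) auto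
    have dec: "2 powr (- c * real_of_int \<bar>int_decode n\<bar>) \<le> q ^ n" for n
    proof -
      \<comment> \<open>\<open>int_decode\<close> enumerates 0, -1, 1, -2, 2, and so on; this is why
        \<open>q\<close> has half of \<open>c\<close> in its exponent.\<close>
      have "real n / 2 \<le> real_of_int \<bar>int_decode n\<bar>"
        unfolding int_decode_def sum_decode_def by (auto elim!: evenE oddE)
      then have "2 powr (- c * real_of_int \<bar>int_decode n\<bar>) \<le> 2 powr (- c * (real n / 2))"
        using c by (intro powr_mono) auto
      also have "\<dots> = q ^ n"
        unfolding q_def by (simp add: powr_realpow[symmetric] powr_powr mult_ac)
      finally show ?thesis .
    qed
    have "(\<integral>\<^sup>+j. ennreal (min ((2 powr real_of_int j / l) powr c1)
            ((2 powr real_of_int j / l) powr (- c2))) \<partial>count_space UNIV)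
        \<le> (\<integral>\<^sup>+j. ennreal (2 powr c2 * 2 powr (- c * real_of_int \<bar>j - j0\<bar>)) \<partial>count_space UNIV)"
      by (intro nn_integral_mono ennreal_leI pt)
    also have "\<dots> = (\<integral>\<^sup>+j. ennreal (2 powr c2 * 2 powr (- c * real_of_int \<bar>j\<bar>)) \<partial>count_space UNIV)"
      using nn_integral_bij_count_space[OF bij, of "\<lambda>j. ennreal (2 powr c2 * 2 powr (- c * real_of_int \<bar>j\<bar>))"] by simp
    also have "\<dots> = (\<Sum>n. ennreal (2 powr c2 * 2 powr (- c * real_of_int \<bar>int_decode n\<bar>)))"
      by (rule nn_integral_count_space_int)
    also have "\<dots> \<le> (\<Sum>n. ennreal (2 powr c2 * q ^ n))"
      by (intro suminf_le ennreal_leI mult_left_mono dec) auto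
    also have "\<dots> = ennreal (\<Sum>n. 2 powr c2 * q ^ n)"
      using q by (intro suminf_ennreal2 summable_mult summable_geometric) auto
    also have "(\<Sum>n. 2 powr c2 * q ^ n) = C"
      using q by (subst suminf_mult) (auto simp: summable_geometric suminf_geometric C_def)
    finally show "(\<integral>\<^sup>+j. ennreal (min ((2 powr real_of_int j / l) powr c1)
            ((2 powr real_of_int j / l) powr (- c2))) \<partial>count_space UNIV) \<le> ennreal C" .
  qed
qed

section \<open>Ball averages and the maximal operator\<close>

definition ball_avg :: "real \<Rightarrow> ('a::euclidean_space \<Rightarrow> ennreal) \<Rightarrow> 'a \<Rightarrow> ennreal" where
  "ball_avg \<rho> h z = ennreal (\<rho> powr (- real DIM('a))) * (\<integral>\<^sup>+x\<in>ball z (2 * \<rho>). h x \<partial>lborel)"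

text \<open>The centred Hardy--Littlewood operator up to a constant: \<open>ball_avg\<close> divides
  by \<rho>^n and not by the volume of the ball. Its radius 2 \<rho> is the one that the shear
  produces from a ball of radius \<rho>. Radii 2^j suffice for the dyadic decomposition, and a
  countable supremum is measurable.\<close>

definition dyadic_maximal :: "('a::euclidean_space \<Rightarrow> ennreal) \<Rightarrow> 'a \<Rightarrow> ennreal" where
  "dyadic_maximal h z = (SUP j::int. ball_avg (2 powr j) h z)"

lemma measurable_indicator_ball [measurable]:
  "(\<lambda>(z, x). indicator (ball z r) x :: ennreal) \<in> borel_measurable (lborel \<Otimes>\<^sub>M (lborel :: 'a::euclidean_space measure))"
proof -
  have "(\<lambda>(z, x). indicator (ball z r) x :: ennreal) = indicator {p :: 'a \<times> 'a. dist (fst p) (snd p) < r}"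
    by (auto simp: indicator_def)
  moreover have "{p :: 'a \<times> 'a. dist (fst p) (snd p) < r} \<in> sets borel"
    by (intro borel_open open_Collect_less continuous_intros)
  ultimately show ?thesis by (simp add: lborel_prod)
qed

lemma measurable_ball_avg [measurable]:
  assumes [measurable]: "h \<in> borel_measurable borel"
  shows "ball_avg \<rho> h \<in> borel_measurable borel"
  unfolding ball_avg_def[abs_def]
proof (intro borel_measurable_times_ennreal borel_measurable_const)
  have [measurable]: "h \<in> borel_measurable lborel" by simp
  have "(\<lambda>(z, x). h x * indicator (ball z (2 * \<rho>)) x) \<in> borel_measurable (lborel \<Otimes>\<^sub>M lborel)"
    using measurable_indicator_ball[of "2 * \<rho>"]
    by (simp add: case_prod_beta' del: measurable_indicator_ball)
  then have "(\<lambda>z. \<integral>\<^sup>+x\<in>ball z (2 * \<rho>). h x \<partial>lborel) \<in> borel_measurable lborel"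
    by (intro sigma_finite_measure.borel_measurable_nn_integral sigma_finite_lborel)
       (simp add: case_prod_beta')
  then show "(\<lambda>z. \<integral>\<^sup>+x\<in>ball z (2 * \<rho>). h x \<partial>lborel) \<in> borel_measurable borel" by simp
qed

lemma measurable_dyadic_maximal [measurable]:
  assumes [measurable]: "h \<in> borel_measurable borel"
  shows "dyadic_maximal h \<in> borel_measurable borel"
  unfolding dyadic_maximal_def[abs_def] by measurable

lemma dyadic_maximal_ge: "ball_avg (2 powr real_of_int j) h z \<le> dyadic_maximal h z"
  unfolding dyadic_maximal_def by (rule SUP_upper) simp

text \<open>Vitali covering: each point of the level set has a ball of radius 2 \<rho> with large
  average; a disjoint subfamily, enlarged five times to radius 10 \<rho>, still covers. Hence the
  constant 10^n times the volume of the unit ball.\<close>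

lemma dyadic_maximal_weak_type:
  fixes h :: "'a::euclidean_space \<Rightarrow> ennreal"
  assumes [measurable]: "h \<in> borel_measurable borel" and l: "0 < l"
  shows "ennreal l * emeasure lborel {z. ennreal l < dyadic_maximal h z}
       \<le> ennreal (unit_ball_vol (DIM('a)) * 10 ^ DIM('a)) * (\<integral>\<^sup>+x. h x \<partial>lborel)"
proof (cases "(\<integral>\<^sup>+x. h x \<partial>lborel) = top")
  case True
  have "ennreal (unit_ball_vol (DIM('a)) * 10 ^ DIM('a)) \<noteq> 0"
    using unit_ball_vol_pos[of "real DIM('a)"] by (simp add: less_imp_neq[symmetric])
  then show ?thesis unfolding True by (simp add: ennreal_mult_top)
next
  case False
  then obtain H where H: "H \<ge> 0" "(\<integral>\<^sup>+x. h x \<partial>lborel) = ennreal H"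
    by (metis ennreal_cases infinity_ennreal_def)
  define v where "v = unit_ball_vol (real DIM('a))"
  have v: "v > 0" by (simp add: v_def)
  define E where "E = {z. ennreal l < dyadic_maximal h z}"
  have [measurable]: "E \<in> sets borel" unfolding E_def by measurable
  have "\<exists>\<rho>>0. ennreal l < ball_avg \<rho> h z" if z: "z \<in> E" for z
  proof -
    obtain j :: int where "ennreal l < ball_avg (2 powr j) h z"
      using z unfolding E_def dyadic_maximal_def less_SUP_iff by auto
    then show ?thesis by (intro exI[of _ "2 powr real_of_int j"]) simp
  qed
  then obtain \<rho> where \<rho>: "\<And>z. z \<in> E \<Longrightarrow> \<rho> z > 0" "\<And>z. z \<in> E \<Longrightarrow> ennreal l < ball_avg (\<rho> z) h z"
    by metis
  have key: "ennreal (l * \<rho> z ^ DIM('a)) \<le> (\<integral>\<^sup>+x\<in>ball z (2 * \<rho> z). h x \<partial>lborel)" if "z \<in> E" for z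
  proof -
    have "ennreal (\<rho> z ^ DIM('a)) * ennreal l \<le> ennreal (\<rho> z ^ DIM('a)) * ball_avg (\<rho> z) h z"
      using \<rho>(2)[OF that] by (intro mult_left_mono) auto
    also have "\<dots> = (\<integral>\<^sup>+x\<in>ball z (2 * \<rho> z). h x \<partial>lborel)"
      using \<rho>(1)[OF that] unfolding ball_avg_def
      by (simp add: mult.assoc[symmetric] powr_minus powr_realpow flip: ennreal_mult)
    finally show ?thesis using \<rho>(1)[OF that] l by (simp add: mult.commute flip: ennreal_mult)
  qed
  \<comment> \<open>The covering lemma needs bounded radii. A large average forces l \<rho>^n \<le>
    H, and \<rho> \<le> \<rho>^n once \<rho> \<ge> 1; this is where finiteness of the integral
    enters.\<close>
  have bd: "0 < 2 * \<rho> z \<and> 2 * \<rho> z \<le> 2 * max 1 (H / l)" if "z \<in> E" for z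
  proof -
    have "ennreal (l * \<rho> z ^ DIM('a)) \<le> ennreal H"
      unfolding H(2)[symmetric]
      by (rule order_trans[OF key[OF that]]) (intro nn_integral_mono, auto simp: indicator_def)
    then have "\<rho> z ^ DIM('a) \<le> H / l" using H l by (simp add: field_simps)
    moreover have "\<rho> z \<le> \<rho> z ^ DIM('a)" if "\<rho> z \<ge> 1"
      using that self_le_power[of "\<rho> z" "DIM('a)"] by simp
    ultimately show ?thesis using \<rho>(1)[OF that] by (cases "\<rho> z \<ge> 1") auto
  qed
  obtain C where C: "countable C" "C \<subseteq> E"
     "pairwise (\<lambda>i j. disjnt (ball i (2 * \<rho> i)) (ball j (2 * \<rho> j))) C"
     "(\<Union>i\<in>E. ball i (2 * \<rho> i)) \<subseteq> (\<Union>i\<in>C. ball i (5 * (2 * \<rho> i)))"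
    by (rule Vitali_covering_lemma_balls[where K = E and r = "\<lambda>z. 2 * \<rho> z" and a = "\<lambda>z. z", OF order_refl bd]) auto
  \<comment> \<open>Covering and disjointness are both expressed as integrals over
    \<open>count_space C\<close>, so that the measure estimate is Fubini over a countable index
    set.\<close>
  have cov: "indicator E x \<le> (\<integral>\<^sup>+i. indicator (ball i (10 * \<rho> i)) x \<partial>count_space C)" for x :: 'a
  proof (cases "x \<in> E")
    case True
    then have "x \<in> (\<Union>i\<in>E. ball i (2 * \<rho> i))" using \<rho>(1) by force
    then have "x \<in> (\<Union>i\<in>C. ball i (5 * (2 * \<rho> i)))" using C(4) by (rule subsetD[rotated])
    then obtain i where i: "i \<in> C" "x \<in> ball i (10 * \<rho> i)" by auto
    have "1 = (\<integral>\<^sup>+k. indicator {i} k \<partial>count_space C)"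
      using i by (simp add: nn_integral_indicator)
    also have "\<dots> \<le> (\<integral>\<^sup>+k. indicator (ball k (10 * \<rho> k)) x \<partial>count_space C)"
      using i by (intro nn_integral_mono) (auto simp: indicator_def)
    finally show ?thesis using True by simp
  qed auto
  have dis: "(\<integral>\<^sup>+i. indicator (ball i (2 * \<rho> i)) x \<partial>count_space C) \<le> 1" for x :: 'a
  proof (cases "\<exists>i\<in>C. x \<in> ball i (2 * \<rho> i)")
    case True
    then obtain i where i: "i \<in> C" "x \<in> ball i (2 * \<rho> i)" by auto
    have "(\<integral>\<^sup>+k. indicator (ball k (2 * \<rho> k)) x \<partial>count_space C) \<le> (\<integral>\<^sup>+k. indicator {i} k \<partial>count_space C)"
    proof (intro nn_integral_mono)
      fix k assume k: "k \<in> space (count_space C)"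
      have "k = i" if x: "x \<in> ball k (2 * \<rho> k)"
      proof (rule ccontr)
        assume "k \<noteq> i"
        then have "disjnt (ball k (2 * \<rho> k)) (ball i (2 * \<rho> i))"
          using C(3) i k by (auto simp: pairwise_def)
        then show False using i x unfolding disjnt_iff by blast
      qed
      then show "indicator (ball k (2 * \<rho> k)) x \<le> (indicator {i} k :: ennreal)"
        by (auto simp: indicator_def)
    qed
    also have "\<dots> = 1" using i by (simp add: nn_integral_indicator)
    finally show ?thesis .
  next
    case False
    then have "(\<integral>\<^sup>+i. indicator (ball i (2 * \<rho> i)) x \<partial>count_space C) = (\<integral>\<^sup>+i. 0 \<partial>count_space C)"
      by (intro nn_integral_cong) (auto simp: indicator_def)
    then show ?thesis by simp
  qed
  have "ennreal l * emeasure lborel E = ennreal l * (\<integral>\<^sup>+x. indicator E x \<partial>lborel)"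
    by simp
  also have "\<dots> \<le> ennreal l * (\<integral>\<^sup>+x. \<integral>\<^sup>+i. indicator (ball i (10 * \<rho> i)) x \<partial>count_space C \<partial>lborel)"
    by (intro mult_left_mono nn_integral_mono cov) auto
  also have "(\<integral>\<^sup>+x. \<integral>\<^sup>+i. indicator (ball i (10 * \<rho> i)) x \<partial>count_space C \<partial>lborel)
      = (\<integral>\<^sup>+i. emeasure lborel (ball i (10 * \<rho> i)) \<partial>count_space C)"
    by (subst nn_integral_count_space_nn_integral[OF C(1)]) auto
  also have "ennreal l * \<dots> = (\<integral>\<^sup>+i. ennreal l * emeasure lborel (ball i (10 * \<rho> i)) \<partial>count_space C)"
    by (simp add: nn_integral_cmult)
  also have "\<dots> \<le> (\<integral>\<^sup>+i. ennreal (v * 10 ^ DIM('a)) * (\<integral>\<^sup>+x\<in>ball i (2 * \<rho> i). h x \<partial>lborel) \<partial>count_space C)"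
  proof (intro nn_integral_mono)
    fix i assume "i \<in> space (count_space C)"
    then have i: "i \<in> E" using C by auto
    have "ennreal l * emeasure lborel (ball i (10 * \<rho> i)) = ennreal (v * 10 ^ DIM('a)) * ennreal (l * \<rho> i ^ DIM('a))"
      using \<rho>(1)[OF i] l v by (simp add: emeasure_ball v_def power_mult_distrib mult_ac flip: ennreal_mult)
    also have "\<dots> \<le> ennreal (v * 10 ^ DIM('a)) * (\<integral>\<^sup>+x\<in>ball i (2 * \<rho> i). h x \<partial>lborel)"
      by (intro mult_left_mono key i) auto
    finally show "ennreal l * emeasure lborel (ball i (10 * \<rho> i))
        \<le> ennreal (v * 10 ^ DIM('a)) * (\<integral>\<^sup>+x\<in>ball i (2 * \<rho> i). h x \<partial>lborel)" .
  qed
  also have "\<dots> = ennreal (v * 10 ^ DIM('a)) * (\<integral>\<^sup>+x. \<integral>\<^sup>+i. h x * indicator (ball i (2 * \<rho> i)) x \<partial>count_space C \<partial>lborel)"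
    by (subst nn_integral_count_space_nn_integral[OF C(1)]) (auto simp: nn_integral_cmult)
  also have "\<dots> \<le> ennreal (v * 10 ^ DIM('a)) * (\<integral>\<^sup>+x. h x * 1 \<partial>lborel)"
    by (intro mult_left_mono nn_integral_mono) (auto simp: nn_integral_cmult simp del: mult_1_right intro!: mult_left_mono dis)
  finally show ?thesis by (simp add: E_def v_def)
qed

text \<open>A discrete layer-cake bound: for finite x > 0 the single level with 2^k < x \<le>
  2^(k+1) already dominates x^\<theta>. It reduces the strong type estimate to measures of dyadic
  level sets.\<close>

lemma epow_le_nn_integral_int:
  assumes th: "0 < \<theta>"
  shows "epow x \<theta> \<le> (\<integral>\<^sup>+j. ennreal (2 powr (\<theta> * (real_of_int j + 1))) * indicator {y. ennreal (2 powr j) < y} x \<partial>count_space UNIV)"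
    (is "_ \<le> ?S x")
proof -
  have fin: "epow (ennreal r) \<theta> \<le> ?S (ennreal r)" if r: "r > 0" for r
  proof -
    \<comment> \<open>The ceiling minus one, not the floor, because the level sets are defined by a
      strict inequality.\<close>
    define k where "k = \<lceil>log 2 r\<rceil> - 1"
    have "k < log 2 r" "log 2 r \<le> k + 1" unfolding k_def by linarith+
    then have k: "2 powr k < r" "r \<le> 2 powr (k + 1)"
      using r by (auto simp: less_log_iff log_le_iff)
    have "epow (ennreal r) \<theta> \<le> ennreal ((2 powr (real_of_int k + 1)) powr \<theta>)"
      using r k th by (auto simp: epow_ennreal intro!: ennreal_leI powr_mono2)
    also have "\<dots> = ennreal (2 powr (\<theta> * (real_of_int k + 1))) * indicator {y. ennreal (2 powr k) < y} (ennreal r)"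
      using k r by (simp add: powr_powr mult.commute ennreal_less_iff)
    also have "\<dots> \<le> ?S (ennreal r)"
      by (rule nn_integral_count_space_int_ge)
    finally show ?thesis .
  qed
  show ?thesis
  proof (cases x)
    case (real r)
    then show ?thesis using fin[of r] by (cases "r = 0") auto
  next
    case top
    \<comment> \<open>The sum is monotone in its argument, so its value at \<open>top\<close>
      dominates every finite power m^\<theta>.\<close>
    have "?S top = top"
    proof (rule ccontr)
      assume "?S top \<noteq> top"
      then obtain r where r: "r \<ge> 0" "?S top = ennreal r"
        by (rule ennreal_neq_topE)
      define m where "m = (r + 1) powr (1 / \<theta>)"
      have "ennreal (r + 1) = epow (ennreal m) \<theta>"
        using th r by (simp add: m_def epow_ennreal powr_powr)
      also have "\<dots> \<le> ?S (ennreal m)" using r by (intro fin) (simp add: m_def)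
      also have "\<dots> \<le> ?S top"
        by (intro nn_integral_mono mult_left_mono) (auto simp: indicator_def)
      finally show False using r by (simp add: ennreal_le_iff)
    qed
    then show ?thesis using top by simp
  qed
qed

lemma ball_avg_mono: "(\<And>x. h x \<le> g x) \<Longrightarrow> ball_avg \<rho> h z \<le> ball_avg \<rho> g z"
  unfolding ball_avg_def by (intro mult_left_mono nn_integral_mono mult_right_mono) auto

lemma ball_avg_add:
  assumes [measurable]: "h \<in> borel_measurable borel" "g \<in> borel_measurable borel"
  shows "ball_avg \<rho> (\<lambda>x. h x + g x) z = ball_avg \<rho> h z + ball_avg \<rho> g z"
  unfolding ball_avg_def by (simp add: distrib_right distrib_left nn_integral_add)

lemma ball_avg_const:
  fixes z :: "'a::euclidean_space"
  assumes "0 < \<rho>" "0 \<le> k"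
  shows "ball_avg \<rho> (\<lambda>_. ennreal k) z = ennreal (k * (unit_ball_vol (DIM('a)) * 2 ^ DIM('a)))"
  using assms unfolding ball_avg_def
  by (simp add: nn_integral_cmult_indicator emeasure_ball powr_minus powr_realpow
      power_mult_distrib field_simps flip: ennreal_mult)

text \<open>Marcinkiewicz interpolation between weak type (1,1) and the trivial bound for bounded
  functions. At level l the part of h below c l has maximal function at most l / 2, because c = 1 /
  (2 v) with v the value of \<open>ball_avg\<close> on the constant 1; only the part above c l meets
  the weak estimate.\<close>

lemma dyadic_maximal_strong_type:
  fixes \<theta> :: real
  assumes th: "1 < \<theta>"
  shows "\<exists>C\<ge>0. \<forall>h::'a::euclidean_space \<Rightarrow> ennreal. h \<in> borel_measurable borel \<longrightarrow>
    (\<integral>\<^sup>+x. epow (dyadic_maximal h x) \<theta> \<partial>lborel) \<le> ennreal C * (\<integral>\<^sup>+x. epow (h x) \<theta> \<partial>lborel)"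
proof -
  define v where "v = unit_ball_vol (real DIM('a)) * 2 ^ DIM('a)"
  have v: "v > 0" by (simp add: v_def)
  define c where "c = 1 / (2 * v)"
  have c: "c > 0" using v by (simp add: c_def)
  define K where "K = unit_ball_vol (DIM('a)) * 10 ^ DIM('a)"
  have K: "K > 0" by (simp add: K_def)
  obtain C0 where C0: "C0 \<ge> 0" and geo: "\<And>l. l > 0 \<Longrightarrow>
      (\<integral>\<^sup>+j. ennreal (min ((2 powr real_of_int j / l) powr (\<theta> - 1))
            ((2 powr real_of_int j / l) powr (- 1))) \<partial>count_space UNIV) \<le> ennreal C0"
    using nn_integral_int_two_sided_geometric[of "\<theta> - 1" 1] th by auto
  \<comment> \<open>The summand 1 keeps \<open>C\<close> positive, so that the right side is
    infinite wherever h is.\<close>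
  define C where "C = 2 * K * 2 powr \<theta> * (1 / c) powr (\<theta> - 1) * C0 + 1"
  have C: "C > 0" unfolding C_def using K C0 by (intro add_nonneg_pos mult_nonneg_nonneg) auto
  show ?thesis
  proof (intro exI[of _ C] conjI allI impI)
    show "0 \<le> C" using C by simp
    fix h :: "'a \<Rightarrow> ennreal" assume h[measurable]: "h \<in> borel_measurable borel"
    define hl where "hl l x = h x * indicator {x. ennreal (c * l) < h x} x" for l x
    have [measurable]: "hl l \<in> borel_measurable borel" for l
      unfolding hl_def[abs_def] by measurable
    have hle: "h x \<le> hl l x + ennreal (c * l)" if "l > 0" for l x
      by (auto simp: hl_def indicator_def)
    have Mle: "dyadic_maximal h z \<le> dyadic_maximal (hl l) z + ennreal (l / 2)" if l: "l > 0" for l z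
      unfolding dyadic_maximal_def[of h]
    proof (rule SUP_least)
      fix j :: int
      have "ball_avg (2 powr j) h z \<le> ball_avg (2 powr j) (\<lambda>x. hl l x + ennreal (c * l)) z"
        by (intro ball_avg_mono hle l)
      also have "\<dots> = ball_avg (2 powr j) (hl l) z + ennreal (c * l * v)"
        using c l by (subst ball_avg_add) (auto simp: ball_avg_const v_def)
      also have "\<dots> \<le> dyadic_maximal (hl l) z + ennreal (l / 2)"
        using v by (intro add_mono dyadic_maximal_ge) (auto simp: c_def)
      finally show "ball_avg (2 powr j) h z \<le> dyadic_maximal (hl l) z + ennreal (l / 2)" .
    qed
    have weak: "emeasure lborel {z. ennreal l < dyadic_maximal h z} \<le> ennreal (2 * K / l) * (\<integral>\<^sup>+x. hl l x \<partial>lborel)"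
      if l: "l > 0" for l
    proof -
      have sub: "{z. ennreal l < dyadic_maximal h z} \<subseteq> {z. ennreal (l / 2) < dyadic_maximal (hl l) z}"
      proof safe
        fix z assume *: "ennreal l < dyadic_maximal h z"
        show "ennreal (l / 2) < dyadic_maximal (hl l) z"
        proof (rule ccontr)
          assume "\<not> ?thesis"
          then have "dyadic_maximal (hl l) z + ennreal (l / 2) \<le> ennreal (l / 2) + ennreal (l / 2)"
            by (intro add_right_mono) simp
          also have "\<dots> = ennreal l" using l by (simp flip: ennreal_plus)
          finally show False using Mle[OF l, of z] * by (meson leD order_trans)
        qed
      qed
      have "emeasure lborel {z. ennreal l < dyadic_maximal h z}
          \<le> emeasure lborel {z. ennreal (l / 2) < dyadic_maximal (hl l) z}"
        by (intro emeasure_mono sub) measurable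
      also have "\<dots> = ennreal (2 / l) * (ennreal (l / 2) * emeasure lborel {z. ennreal (l / 2) < dyadic_maximal (hl l) z})"
        using l by (simp add: mult.assoc[symmetric] flip: ennreal_mult)
      also have "\<dots> \<le> ennreal (2 / l) * (ennreal K * (\<integral>\<^sup>+x. hl l x \<partial>lborel))"
        unfolding K_def using l by (intro mult_left_mono dyadic_maximal_weak_type) auto
      also have "\<dots> = ennreal (2 * K / l) * (\<integral>\<^sup>+x. hl l x \<partial>lborel)"
        using l K by (simp add: mult.assoc[symmetric] flip: ennreal_mult)
      finally show ?thesis .
    qed
    have pt: "(\<integral>\<^sup>+j. ennreal (2 powr (\<theta> * (real_of_int j + 1)) * (2 * K / 2 powr j)) * hl (2 powr j) x \<partial>count_space UNIV)
        \<le> ennreal C * epow (h x) \<theta>" for x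
    proof -
      consider "h x = 0" | "h x = top" | y where "h x = ennreal y" "y > 0"
        by (metis ennreal_cases ennreal_0 infinity_ennreal_def order_le_less)
      then show ?thesis
      proof cases
        case 1 then show ?thesis by (simp add: hl_def)
      next
        case 2 then show ?thesis using C by (simp add: ennreal_mult_top)
      next
        case (3 y)
        \<comment> \<open>Level 2^j sees the value y only if c 2^j < y, that is 2^j < l. There the
          minimum in the geometric sum is its increasing branch of exponent \<theta> - 1 > 0, so the
          decay chosen above l is immaterial.\<close>
        define l where "l = y / c"
        have l: "l > 0" using 3 c by (simp add: l_def)
        have tm: "ennreal (2 powr (\<theta> * (real_of_int j + 1)) * (2 * K / 2 powr j)) * hl (2 powr j) x
            \<le> ennreal (y * (2 * K) * 2 powr \<theta> * l powr (\<theta> - 1)) *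
              ennreal (min ((2 powr real_of_int j / l) powr (\<theta> - 1)) ((2 powr real_of_int j / l) powr (- 1)))"
          for j :: int
        proof (cases "2 powr j < l")
          case False
          then have "hl (2 powr j) x = 0"
            using 3 c by (auto simp: hl_def indicator_def l_def field_simps ennreal_less_iff)
          then show ?thesis by simp
        next
          case True
          define w where "w = 2 powr real_of_int j / l"
          have w: "0 < w" "w < 1" using True l by (auto simp: w_def)
          have "w powr (\<theta> - 1) \<le> 1" using w th by (intro powr_le1) auto
          moreover have "1 \<le> w powr (- 1)" using w by (simp add: powr_minus_divide)
          ultimately have m: "min (w powr (\<theta> - 1)) (w powr (- 1)) = w powr (\<theta> - 1)" by simp
          have e1: "l powr (\<theta> - 1) * w powr (\<theta> - 1) = 2 powr (j * (\<theta> - 1))"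
            using w l by (simp add: w_def powr_mult[symmetric] powr_powr)
          have e2: "2 powr (\<theta> * (real_of_int j + 1)) * (2 * K / 2 powr j) = 2 * K * 2 powr \<theta> * 2 powr (j * (\<theta> - 1))"
            by (simp add: powr_add powr_diff algebra_simps)
          have "ennreal (2 powr (\<theta> * (real_of_int j + 1)) * (2 * K / 2 powr j)) * hl (2 powr j) x
              \<le> ennreal (2 powr (\<theta> * (real_of_int j + 1)) * (2 * K / 2 powr j)) * ennreal y"
            using 3 by (intro mult_left_mono) (auto simp: hl_def indicator_def)
          also have "\<dots> = ennreal (y * (2 * K) * 2 powr \<theta> * (l powr (\<theta> - 1) * w powr (\<theta> - 1)))"
            unfolding e1 e2 using 3 K by (simp add: mult_ac flip: ennreal_mult)
          also have "\<dots> = ennreal (y * (2 * K) * 2 powr \<theta> * l powr (\<theta> - 1)) * ennreal (w powr (\<theta> - 1))"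
            using 3 K by (simp add: mult_ac flip: ennreal_mult)
          finally show ?thesis using m by (simp add: w_def)
        qed
        have "(\<integral>\<^sup>+j. ennreal (2 powr (\<theta> * (real_of_int j + 1)) * (2 * K / 2 powr j)) * hl (2 powr j) x \<partial>count_space UNIV)
          \<le> (\<integral>\<^sup>+j. ennreal (y * (2 * K) * 2 powr \<theta> * l powr (\<theta> - 1)) *
              ennreal (min ((2 powr real_of_int j / l) powr (\<theta> - 1)) ((2 powr real_of_int j / l) powr (- 1))) \<partial>count_space UNIV)"
          by (intro nn_integral_mono tm)
        also have "\<dots> \<le> ennreal (y * (2 * K) * 2 powr \<theta> * l powr (\<theta> - 1)) * ennreal C0"
          by (subst nn_integral_cmult) (simp, rule mult_left_mono[OF geo[OF l]], simp)
        also have "\<dots> = ennreal ((C - 1) * y powr \<theta>)"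
        proof -
          have "y powr \<theta> = y * y powr (\<theta> - 1)"
            using 3 by (simp add: powr_diff)
          moreover have "l powr (\<theta> - 1) = (1 / c) powr (\<theta> - 1) * y powr (\<theta> - 1)"
            using 3 c by (simp add: l_def powr_mult[symmetric])
          ultimately show ?thesis using 3 K C0
            by (simp add: C_def mult_ac flip: ennreal_mult)
        qed
        also have "\<dots> \<le> ennreal (C * y powr \<theta>)"
          by (intro ennreal_leI mult_right_mono) auto
        also have "\<dots> = ennreal C * epow (h x) \<theta>"
          using 3 C by (simp add: epow_ennreal ennreal_mult)
        finally show ?thesis .
      qed
    qed
    have "(\<integral>\<^sup>+x. epow (dyadic_maximal h x) \<theta> \<partial>lborel)
       \<le> (\<integral>\<^sup>+x. (\<integral>\<^sup>+j. ennreal (2 powr (\<theta> * (real_of_int j + 1))) * indicator {y. ennreal (2 powr j) < y} (dyadic_maximal h x) \<partial>count_space UNIV) \<partial>lborel)"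
      using th by (intro nn_integral_mono epow_le_nn_integral_int) auto
    also have "\<dots> = (\<integral>\<^sup>+j. (\<integral>\<^sup>+x. ennreal (2 powr (\<theta> * (real_of_int j + 1))) * indicator {y. ennreal (2 powr j) < y} (dyadic_maximal h x) \<partial>lborel) \<partial>count_space UNIV)"
      by (rule nn_integral_count_space_nn_integral) auto
    also have "\<dots> \<le> (\<integral>\<^sup>+j. (\<integral>\<^sup>+x. ennreal (2 powr (\<theta> * (real_of_int j + 1)) * (2 * K / 2 powr j)) * hl (2 powr j) x \<partial>lborel) \<partial>count_space UNIV)"
    proof (rule nn_integral_mono)
      fix j :: int
      have "(\<integral>\<^sup>+x. ennreal (2 powr (\<theta> * (real_of_int j + 1))) * indicator {y. ennreal (2 powr j) < y} (dyadic_maximal h x) \<partial>lborel)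
        = (\<integral>\<^sup>+x. ennreal (2 powr (\<theta> * (real_of_int j + 1))) * indicator {z. ennreal (2 powr j) < dyadic_maximal h z} x \<partial>lborel)"
        by (intro nn_integral_cong) (auto simp: indicator_def)
      also have "\<dots> = ennreal (2 powr (\<theta> * (real_of_int j + 1))) * emeasure lborel {z. ennreal (2 powr j) < dyadic_maximal h z}"
        by (rule nn_integral_cmult_indicator) measurable
      also have "\<dots> \<le> ennreal (2 powr (\<theta> * (real_of_int j + 1))) * (ennreal (2 * K / 2 powr j) * (\<integral>\<^sup>+x. hl (2 powr j) x \<partial>lborel))"
        by (intro mult_left_mono weak) auto
      also have "\<dots> = (\<integral>\<^sup>+x. ennreal (2 powr (\<theta> * (real_of_int j + 1)) * (2 * K / 2 powr j)) * hl (2 powr j) x \<partial>lborel)"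
        using K by (subst nn_integral_cmult) (simp_all add: mult.assoc[symmetric] ennreal_mult[symmetric])
      finally show "(\<integral>\<^sup>+x. ennreal (2 powr (\<theta> * (real_of_int j + 1))) * indicator {y. ennreal (2 powr j) < y} (dyadic_maximal h x) \<partial>lborel)
          \<le> (\<integral>\<^sup>+x. ennreal (2 powr (\<theta> * (real_of_int j + 1)) * (2 * K / 2 powr j)) * hl (2 powr j) x \<partial>lborel)" .
    qed
    also have "\<dots> = (\<integral>\<^sup>+x. (\<integral>\<^sup>+j. ennreal (2 powr (\<theta> * (real_of_int j + 1)) * (2 * K / 2 powr j)) * hl (2 powr j) x \<partial>count_space UNIV) \<partial>lborel)"
      by (rule nn_integral_count_space_nn_integral[symmetric]) auto
    also have "\<dots> \<le> (\<integral>\<^sup>+x. ennreal C * epow (h x) \<theta> \<partial>lborel)"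
      by (intro nn_integral_mono pt)
    also have "\<dots> = ennreal C * (\<integral>\<^sup>+x. epow (h x) \<theta> \<partial>lborel)"
      by (rule nn_integral_cmult) measurable
    finally show "(\<integral>\<^sup>+x. epow (dyadic_maximal h x) \<theta> \<partial>lborel) \<le> ennreal C * (\<integral>\<^sup>+x. epow (h x) \<theta> \<partial>lborel)" .
  qed
qed

section \<open>The bilinear average on a single scale\<close>

lemma nn_integral_lborel_affine:
  fixes h :: "'a::euclidean_space \<Rightarrow> ennreal"
  assumes [measurable]: "h \<in> borel_measurable borel" and c: "c \<noteq> 0"
  shows "(\<integral>\<^sup>+x. h x \<partial>lborel) = ennreal (\<bar>c\<bar> ^ DIM('a)) * (\<integral>\<^sup>+x. h (w + c *\<^sub>R x) \<partial>lborel)"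
  by (subst lborel_affine[OF c, of w])
     (simp add: nn_integral_density nn_integral_distr nn_integral_cmult)

text \<open>With v = x + y the other argument is 2 x - v. For fixed v the map from x to 2 x - v has
  Jacobian 2^n, so the inner integral is at most that of F; the gain 2^(-n) is dropped.\<close>

lemma nn_integral_bilinear_shear_le:
  fixes F G :: "'a::euclidean_space \<Rightarrow> ennreal"
  assumes [measurable]: "F \<in> borel_measurable borel" "G \<in> borel_measurable borel"
  shows "(\<integral>\<^sup>+x. (\<integral>\<^sup>+y. F (x - y) * G (x + y) \<partial>lborel) \<partial>lborel)
     \<le> (\<integral>\<^sup>+x. F x \<partial>lborel) * (\<integral>\<^sup>+x. G x \<partial>lborel)"
proof -
  have "(\<integral>\<^sup>+x. (\<integral>\<^sup>+y. F (x - y) * G (x + y) \<partial>lborel) \<partial>lborel)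
      = (\<integral>\<^sup>+x. (\<integral>\<^sup>+v. F (2 *\<^sub>R x - v) * G v \<partial>lborel) \<partial>lborel)"
  proof (rule nn_integral_cong)
    fix x :: 'a
    show "(\<integral>\<^sup>+y. F (x - y) * G (x + y) \<partial>lborel) = (\<integral>\<^sup>+v. F (2 *\<^sub>R x - v) * G v \<partial>lborel)"
      by (subst nn_integral_lborel_affine[where c = 1 and w = "- x"])
         (simp_all add: scaleR_2 algebra_simps)
  qed
  also have "\<dots> = (\<integral>\<^sup>+v. (\<integral>\<^sup>+x. F (2 *\<^sub>R x - v) * G v \<partial>lborel) \<partial>lborel)"
    by (rule lborel_pair.Fubini') measurable
  also have "\<dots> = (\<integral>\<^sup>+v. (\<integral>\<^sup>+x. F (2 *\<^sub>R x - v) \<partial>lborel) * G v \<partial>lborel)"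
    by (simp add: nn_integral_multc)
  also have "\<dots> \<le> (\<integral>\<^sup>+v. (\<integral>\<^sup>+x. F x \<partial>lborel) * G v \<partial>lborel)"
  proof (rule nn_integral_mono, rule mult_right_mono)
    fix v :: 'a
    have "1 * (\<integral>\<^sup>+x. F (2 *\<^sub>R x - v) \<partial>lborel) \<le> ennreal (\<bar>2\<bar> ^ DIM('a)) * (\<integral>\<^sup>+x. F (- v + 2 *\<^sub>R x) \<partial>lborel)"
      by (intro mult_mono) simp_all
    also have "\<dots> = (\<integral>\<^sup>+x. F x \<partial>lborel)"
      by (rule nn_integral_lborel_affine[symmetric]) auto
    finally show "(\<integral>\<^sup>+x. F (2 *\<^sub>R x - v) \<partial>lborel) \<le> (\<integral>\<^sup>+x. F x \<partial>lborel)" by simp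
  qed simp
  also have "\<dots> = (\<integral>\<^sup>+x. F x \<partial>lborel) * (\<integral>\<^sup>+x. G x \<partial>lborel)"
    by (rule nn_integral_cmult) measurable
  finally show ?thesis .
qed

definition BT_ball :: "real \<Rightarrow> ('a::euclidean_space \<Rightarrow> ennreal) \<Rightarrow> ('a \<Rightarrow> ennreal) \<Rightarrow> 'a \<Rightarrow> ennreal" where
  "BT_ball \<rho> f g x = (\<integral>\<^sup>+y\<in>ball 0 \<rho>. f (x - y) * g (x + y) \<partial>lborel)"

lemma measurable_BT_ball [measurable]:
  assumes [measurable]: "f \<in> borel_measurable borel" "g \<in> borel_measurable borel"
  shows "BT_ball \<rho> f g \<in> borel_measurable borel"
proof -
  have "(\<lambda>x. \<integral>\<^sup>+y. f (x - y) * g (x + y) * indicator (ball 0 \<rho>) y \<partial>lborel) \<in> borel_measurable lborel"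
    by measurable
  then show ?thesis by (simp add: BT_ball_def[abs_def])
qed

text \<open>For x in the ball of radius \<rho> about z and |y| < \<rho>, both x - y and x + y lie in
  the double ball, so f and g may be cut off there before shearing.\<close>

lemma nn_integral_BT_ball_le:
  fixes f g :: "'a::euclidean_space \<Rightarrow> ennreal"
  assumes [measurable]: "f \<in> borel_measurable borel" "g \<in> borel_measurable borel"
  shows "(\<integral>\<^sup>+x\<in>ball z \<rho>. BT_ball \<rho> f g x \<partial>lborel)
     \<le> (\<integral>\<^sup>+x\<in>ball z (2 * \<rho>). f x \<partial>lborel) * (\<integral>\<^sup>+x\<in>ball z (2 * \<rho>). g x \<partial>lborel)"
proof -
  define F G where "F x = f x * indicator (ball z (2 * \<rho>)) x"
    and "G x = g x * indicator (ball z (2 * \<rho>)) x" for x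
  have [measurable]: "F \<in> borel_measurable borel" "G \<in> borel_measurable borel"
    unfolding F_def[abs_def] G_def[abs_def] by auto
  have "(\<integral>\<^sup>+x\<in>ball z \<rho>. BT_ball \<rho> f g x \<partial>lborel)
     \<le> (\<integral>\<^sup>+x. (\<integral>\<^sup>+y. F (x - y) * G (x + y) \<partial>lborel) \<partial>lborel)"
  proof (rule nn_integral_mono)
    fix x :: 'a
    show "BT_ball \<rho> f g x * indicator (ball z \<rho>) x \<le> (\<integral>\<^sup>+y. F (x - y) * G (x + y) \<partial>lborel)"
    proof (cases "x \<in> ball z \<rho>")
      case True
      have "BT_ball \<rho> f g x \<le> (\<integral>\<^sup>+y. F (x - y) * G (x + y) \<partial>lborel)"
        unfolding BT_ball_def
      proof (rule nn_integral_mono)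
        fix y :: 'a
        show "f (x - y) * g (x + y) * indicator (ball 0 \<rho>) y \<le> F (x - y) * G (x + y)"
        proof (cases "norm y < \<rho>")
          case y: True
          have "dist z (x - y) \<le> dist z x + dist x (x - y)" by (rule dist_triangle)
          moreover have "dist z (x + y) \<le> dist z x + dist x (x + y)" by (rule dist_triangle)
          ultimately show ?thesis using True y by (simp add: F_def G_def dist_norm)
        qed auto
      qed
      then show ?thesis using True by simp
    qed auto
  qed
  also have "\<dots> \<le> (\<integral>\<^sup>+x. F x \<partial>lborel) * (\<integral>\<^sup>+x. G x \<partial>lborel)"
    by (rule nn_integral_bilinear_shear_le) measurable
  finally show ?thesis by (simp add: F_def G_def)
qed

text \<open>By Fubini, each x lies in the balls about a set of centres z of measure v \<rho>^n. This
  localises a global integral to scale \<rho> without choosing a covering, and leaves a function of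
  z to which maximal functions apply.\<close>

lemma nn_integral_eq_ball_average:
  fixes h :: "'a::euclidean_space \<Rightarrow> ennreal"
  assumes [measurable]: "h \<in> borel_measurable borel" and \<rho>: "0 < \<rho>"
  shows "(\<integral>\<^sup>+z. (\<integral>\<^sup>+x\<in>ball z \<rho>. h x \<partial>lborel) \<partial>lborel)
     = ennreal (unit_ball_vol (DIM('a)) * \<rho> ^ DIM('a)) * (\<integral>\<^sup>+x. h x \<partial>lborel)"
proof -
  have [measurable]: "h \<in> borel_measurable lborel" by simp
  have "(\<integral>\<^sup>+z. (\<integral>\<^sup>+x\<in>ball z \<rho>. h x \<partial>lborel) \<partial>lborel) = (\<integral>\<^sup>+x. (\<integral>\<^sup>+z. h x * indicator (ball z \<rho>) x \<partial>lborel) \<partial>lborel)"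
    using measurable_indicator_ball[of \<rho>]
    by (intro lborel_pair.Fubini') (simp add: case_prod_beta')
  also have "\<dots> = (\<integral>\<^sup>+x. h x * ennreal (unit_ball_vol (DIM('a)) * \<rho> ^ DIM('a)) \<partial>lborel)"
  proof (rule nn_integral_cong)
    fix x :: 'a
    have "(\<integral>\<^sup>+z. h x * indicator (ball z \<rho>) x \<partial>lborel) = (\<integral>\<^sup>+z. h x * indicator (ball x \<rho>) z \<partial>lborel)"
      by (intro nn_integral_cong) (simp add: indicator_def dist_commute)
    then show "(\<integral>\<^sup>+z. h x * indicator (ball z \<rho>) x \<partial>lborel) = h x * ennreal (unit_ball_vol (DIM('a)) * \<rho> ^ DIM('a))"
      using \<rho> by (simp add: nn_integral_cmult_indicator emeasure_ball)
  qed
  also have "\<dots> = ennreal (unit_ball_vol (DIM('a)) * \<rho> ^ DIM('a)) * (\<integral>\<^sup>+x. h x \<partial>lborel)"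
    by (simp add: nn_integral_multc mult.commute)
  finally show ?thesis .
qed

lemma epow_ennreal_mult_collect:
  assumes "0 \<le> u" "0 \<le> w"
  shows "epow (ennreal u * m) r * epow (ennreal w) s = ennreal (u powr r * w powr s) * epow m r"
  using assms by (simp add: epow_mult epow_ennreal ennreal_mult mult_ac)

lemma AE_lborel_neq_0: "AE x in (lborel :: 'a::euclidean_space measure). x \<noteq> 0"
  by (rule AE_lborel_singleton)

text \<open>Hoelder for the product of f |x|^\<gamma> and |x|^(-\<gamma>) with exponents a and a'.
  The second factor becomes |x|^(-\<kappa>) with \<kappa> = \<gamma> a', so the bound on \<gamma> is
  exactly its local integrability.\<close>

lemma nn_integral_ball_le_weighted_avg:
  fixes a \<gamma> :: real
  assumes a: "1 < a" and g: "\<gamma> < DIM('a) * (1 - 1 / a)"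
  shows "\<exists>C\<ge>0. \<forall>(f::'a::euclidean_space \<Rightarrow> ennreal) z \<rho>. f \<in> borel_measurable borel \<longrightarrow> 0 < \<rho> \<longrightarrow>
    (\<integral>\<^sup>+x\<in>ball z (2 * \<rho>). f x \<partial>lborel)
      \<le> ennreal (C * (\<rho> powr DIM('a) * max (norm z) \<rho> powr (- \<gamma>)))
         * epow (ball_avg \<rho> (\<lambda>x. epow (f x * ennreal (norm x powr \<gamma>)) a) z) (1 / a)"
proof -
  define \<theta> where "\<theta> = 1 - 1 / a"
  have th: "0 < \<theta>" "\<theta> < 1" using a by (auto simp: \<theta>_def)
  define \<kappa> where "\<kappa> = \<gamma> / \<theta>"
  have "\<kappa> < DIM('a)" using g th by (simp add: \<kappa>_def \<theta>_def[symmetric] field_simps)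
  then obtain C where C: "C \<ge> 0" and W: "\<And>(z::'a) \<rho>. 0 < \<rho> \<Longrightarrow>
     (\<integral>\<^sup>+x\<in>ball z (2 * \<rho>). ennreal (norm x powr (- \<kappa>)) \<partial>lborel)
       \<le> ennreal (C * \<rho> ^ DIM('a) * max (norm z) \<rho> powr (- \<kappa>))"
    using nn_integral_norm_powr_ball_center[of \<kappa>] by blast
  show ?thesis
  proof (intro exI[of _ "C powr \<theta>"] conjI allI impI)
    fix f :: "'a \<Rightarrow> ennreal" and z :: 'a and \<rho> :: real
    assume [measurable]: "f \<in> borel_measurable borel" and \<rho>: "0 < \<rho>"
    define X where "X = max (norm z) \<rho>"
    have X: "X > 0" using \<rho> by (simp add: X_def)
    define h where "h x = epow (f x * ennreal (norm x powr \<gamma>)) a" for x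
    have [measurable]: "h \<in> borel_measurable borel" unfolding h_def[abs_def] by measurable
    have "(\<integral>\<^sup>+x\<in>ball z (2 * \<rho>). f x \<partial>lborel)
       = (\<integral>\<^sup>+x. epow (h x * indicator (ball z (2 * \<rho>)) x) (1 / a)
           * epow (ennreal (norm x powr (- \<kappa>)) * indicator (ball z (2 * \<rho>)) x) (1 - 1 / a) \<partial>lborel)"
    proof (intro nn_integral_cong_AE)
      \<comment> \<open>The two weights cancel except at the origin, where both are 0.\<close>
      show "AE x in lborel. f x * indicator (ball z (2 * \<rho>)) x = epow (h x * indicator (ball z (2 * \<rho>)) x) (1 / a)
           * epow (ennreal (norm x powr (- \<kappa>)) * indicator (ball z (2 * \<rho>)) x) (1 - 1 / a)"
        using AE_lborel_neq_0
      proof eventually_elim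
        case (elim x)
        have "ennreal (norm x powr \<gamma>) * epow (ennreal (norm x powr (- \<kappa>))) \<theta> = 1"
          using elim th by (simp add: epow_ennreal powr_powr \<kappa>_def powr_add[symmetric] flip: ennreal_mult)
        then show ?case using a
          by (cases "x \<in> ball z (2 * \<rho>)") (simp_all add: h_def \<theta>_def[symmetric] mult.assoc)
      qed
    qed
    also have "\<dots> \<le> epow (\<integral>\<^sup>+x. h x * indicator (ball z (2 * \<rho>)) x \<partial>lborel) (1 / a)
        * epow (\<integral>\<^sup>+x. ennreal (norm x powr (- \<kappa>)) * indicator (ball z (2 * \<rho>)) x \<partial>lborel) (1 - 1 / a)"
      using a by (intro nn_integral_holder) auto
    also have "\<dots> \<le> epow (\<integral>\<^sup>+x. h x * indicator (ball z (2 * \<rho>)) x \<partial>lborel) (1 / a)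
        * epow (ennreal (C * \<rho> ^ DIM('a) * X powr (- \<kappa>))) \<theta>"
      unfolding \<theta>_def[symmetric] X_def using th by (intro mult_left_mono epow_mono W \<rho>) auto
    also have "(\<integral>\<^sup>+x. h x * indicator (ball z (2 * \<rho>)) x \<partial>lborel) = ennreal (\<rho> powr DIM('a)) * ball_avg \<rho> h z"
      using \<rho> unfolding ball_avg_def
      by (simp add: mult.assoc[symmetric] powr_add[symmetric] flip: ennreal_mult)
    also have "epow (ennreal (\<rho> powr DIM('a)) * ball_avg \<rho> h z) (1 / a) * epow (ennreal (C * \<rho> ^ DIM('a) * X powr (- \<kappa>))) \<theta>
       = ennreal ((\<rho> powr DIM('a)) powr (1 / a) * (C * \<rho> ^ DIM('a) * X powr (- \<kappa>)) powr \<theta>) * epow (ball_avg \<rho> h z) (1 / a)"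
      using C \<rho> by (intro epow_ennreal_mult_collect) auto
    also have "(\<rho> powr DIM('a)) powr (1 / a) * (C * \<rho> ^ DIM('a) * X powr (- \<kappa>)) powr \<theta>
        = C powr \<theta> * (\<rho> powr (DIM('a) * (1 / a)) * \<rho> powr (DIM('a) * \<theta>) * X powr (- \<gamma>))"
      using C \<rho> X th by (simp add: powr_mult powr_powr powr_realpow[symmetric] \<kappa>_def)
    also have "\<rho> powr (DIM('a) * (1 / a)) * \<rho> powr (DIM('a) * \<theta>) = \<rho> powr DIM('a)"
      by (simp add: powr_add[symmetric] right_diff_distrib \<theta>_def)
    finally show "(\<integral>\<^sup>+x\<in>ball z (2 * \<rho>). f x \<partial>lborel)
      \<le> ennreal (C powr \<theta> * (\<rho> powr DIM('a) * max (norm z) \<rho> powr (- \<gamma>)))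
         * epow (ball_avg \<rho> (\<lambda>x. epow (f x * ennreal (norm x powr \<gamma>)) a) z) (1 / a)"
      by (simp add: X_def h_def[abs_def])
  qed simp
qed

text \<open>The global integral is an average of integrals over balls of radius \<rho>. On each of
  them Hoelder with exponents t and 1 - t separates \<open>BT_ball\<close>, whose integral
  factorises, from the weight. The integrand in z is kept, not estimated, so that scales can later
  be summed at each fixed z.\<close>

lemma single_scale_bound:
  fixes a1 a2 \<beta> \<gamma>1 \<gamma>2 t :: real
  assumes a1: "1 < a1" and g1: "\<gamma>1 < DIM('a) * (1 - 1 / a1)"
    and a2: "1 < a2" and g2: "\<gamma>2 < DIM('a) * (1 - 1 / a2)"
    and t: "0 < t" "t < 1" and b: "\<beta> < DIM('a) * (1 / t - 1)"
    and d: "0 \<le> \<beta> + \<gamma>1 + \<gamma>2"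
  shows "\<exists>C\<ge>0. \<forall>(f::'a::euclidean_space \<Rightarrow> ennreal) g \<rho>.
    f \<in> borel_measurable borel \<longrightarrow> g \<in> borel_measurable borel \<longrightarrow> 0 < \<rho> \<longrightarrow>
    (\<integral>\<^sup>+x. epow (BT_ball \<rho> f g x * ennreal (norm x powr (- \<beta>))) t \<partial>lborel)
      \<le> ennreal C * (\<integral>\<^sup>+z. epow (ennreal (\<rho> powr (DIM('a) - (\<beta> + \<gamma>1 + \<gamma>2)))
          * (epow (ball_avg \<rho> (\<lambda>x. epow (f x * ennreal (norm x powr \<gamma>1)) a1) z) (1 / a1)
           * epow (ball_avg \<rho> (\<lambda>x. epow (g x * ennreal (norm x powr \<gamma>2)) a2) z) (1 / a2))) t \<partial>lborel)"
proof -
  define n where "n = real DIM('a)"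
  define \<delta> where "\<delta> = \<beta> + \<gamma>1 + \<gamma>2"
  obtain C1 where C1: "C1 \<ge> 0" and I1: "\<And>(f::'a \<Rightarrow> ennreal) z \<rho>. f \<in> borel_measurable borel \<Longrightarrow> 0 < \<rho> \<Longrightarrow>
    (\<integral>\<^sup>+x\<in>ball z (2 * \<rho>). f x \<partial>lborel)
      \<le> ennreal (C1 * (\<rho> powr n * max (norm z) \<rho> powr (- \<gamma>1)))
         * epow (ball_avg \<rho> (\<lambda>x. epow (f x * ennreal (norm x powr \<gamma>1)) a1) z) (1 / a1)"
    using nn_integral_ball_le_weighted_avg[OF a1 g1] unfolding n_def by blast
  obtain C2 where C2: "C2 \<ge> 0" and I2: "\<And>(f::'a \<Rightarrow> ennreal) z \<rho>. f \<in> borel_measurable borel \<Longrightarrow> 0 < \<rho> \<Longrightarrow>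
    (\<integral>\<^sup>+x\<in>ball z (2 * \<rho>). f x \<partial>lborel)
      \<le> ennreal (C2 * (\<rho> powr n * max (norm z) \<rho> powr (- \<gamma>2)))
         * epow (ball_avg \<rho> (\<lambda>x. epow (f x * ennreal (norm x powr \<gamma>2)) a2) z) (1 / a2)"
    using nn_integral_ball_le_weighted_avg[OF a2 g2] unfolding n_def by blast
  \<comment> \<open>Chosen so that |x|^(-\<beta> t) is the power 1 - t of |x|^(-\<kappa>); then
    \<kappa> < n is the assumption on \<beta>.\<close>
  define \<kappa> where "\<kappa> = \<beta> * t / (1 - t)"
  have "\<kappa> < DIM('a)" using b t by (simp add: \<kappa>_def field_simps)
  then obtain Cb where Cb: "Cb \<ge> 0" and W: "\<And>(z::'a) \<rho>. 0 < \<rho> \<Longrightarrow>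
     (\<integral>\<^sup>+x\<in>ball z (2 * \<rho>). ennreal (norm x powr (- \<kappa>)) \<partial>lborel)
       \<le> ennreal (Cb * \<rho> ^ DIM('a) * max (norm z) \<rho> powr (- \<kappa>))"
    using nn_integral_norm_powr_ball_center[of \<kappa>] by blast
  define K where "K = (C1 * C2) powr t * Cb powr (1 - t)"
  define v where "v = unit_ball_vol n"
  have v: "v > 0" by (simp add: v_def n_def)
  have K: "K \<ge> 0" by (simp add: K_def)
  show ?thesis
  proof (intro exI[of _ "K / v"] conjI allI impI)
    show "0 \<le> K / v" using v K by simp
    fix f g :: "'a \<Rightarrow> ennreal" and \<rho> :: real
    assume [measurable]: "f \<in> borel_measurable borel" "g \<in> borel_measurable borel" and \<rho>: "0 < \<rho>"
    define m1 where "m1 z = epow (ball_avg \<rho> (\<lambda>x. epow (f x * ennreal (norm x powr \<gamma>1)) a1) z) (1 / a1)" for z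
    define m2 where "m2 z = epow (ball_avg \<rho> (\<lambda>x. epow (g x * ennreal (norm x powr \<gamma>2)) a2) z) (1 / a2)" for z
    have [measurable]: "m1 \<in> borel_measurable borel" "m2 \<in> borel_measurable borel"
      unfolding m1_def[abs_def] m2_def[abs_def] by measurable
    define \<phi> where "\<phi> x = epow (BT_ball \<rho> f g x * ennreal (norm x powr (- \<beta>))) t" for x
    have [measurable]: "\<phi> \<in> borel_measurable borel" unfolding \<phi>_def[abs_def] by measurable
    have J: "(\<integral>\<^sup>+x\<in>ball z \<rho>. \<phi> x \<partial>lborel)
       \<le> ennreal (K * \<rho> powr n) * epow (ennreal (\<rho> powr (n - \<delta>)) * (m1 z * m2 z)) t" for z :: 'a
    proof -
      define X where "X = max (norm z) \<rho>"
      have X: "X > 0" "\<rho> \<le> X" using \<rho> by (auto simp: X_def)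
      have "(\<integral>\<^sup>+x\<in>ball z \<rho>. \<phi> x \<partial>lborel)
        = (\<integral>\<^sup>+x. epow (BT_ball \<rho> f g x * indicator (ball z \<rho>) x) t
            * epow (ennreal (norm x powr (- \<kappa>)) * indicator (ball z \<rho>) x) (1 - t) \<partial>lborel)"
      proof (intro nn_integral_cong)
        fix x :: 'a
        have "epow (ennreal (norm x powr (- \<beta>))) t = epow (ennreal (norm x powr (- \<kappa>))) (1 - t)"
          using t by (simp add: epow_ennreal powr_powr \<kappa>_def)
        then show "\<phi> x * indicator (ball z \<rho>) x = epow (BT_ball \<rho> f g x * indicator (ball z \<rho>) x) t
            * epow (ennreal (norm x powr (- \<kappa>)) * indicator (ball z \<rho>) x) (1 - t)"
          by (cases "x \<in> ball z \<rho>") (simp_all add: \<phi>_def epow_mult)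
      qed
      also have "\<dots> \<le> epow (\<integral>\<^sup>+x\<in>ball z \<rho>. BT_ball \<rho> f g x \<partial>lborel) t
          * epow (\<integral>\<^sup>+x\<in>ball z \<rho>. ennreal (norm x powr (- \<kappa>)) \<partial>lborel) (1 - t)"
        using t by (intro nn_integral_holder) auto
      also have "\<dots> \<le> epow ((ennreal (C1 * (\<rho> powr n * X powr (- \<gamma>1))) * m1 z)
            * (ennreal (C2 * (\<rho> powr n * X powr (- \<gamma>2))) * m2 z)) t
          * epow (ennreal (Cb * \<rho> ^ DIM('a) * X powr (- \<kappa>))) (1 - t)"
      proof (intro mult_mono epow_mono)
        have "(\<integral>\<^sup>+x\<in>ball z \<rho>. BT_ball \<rho> f g x \<partial>lborel)
           \<le> (\<integral>\<^sup>+x\<in>ball z (2 * \<rho>). f x \<partial>lborel) * (\<integral>\<^sup>+x\<in>ball z (2 * \<rho>). g x \<partial>lborel)"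
          by (rule nn_integral_BT_ball_le) auto
        also have "\<dots> \<le> (ennreal (C1 * (\<rho> powr n * X powr (- \<gamma>1))) * m1 z)
            * (ennreal (C2 * (\<rho> powr n * X powr (- \<gamma>2))) * m2 z)"
          unfolding m1_def m2_def X_def by (intro mult_mono I1 I2 \<rho>) auto
        finally show "(\<integral>\<^sup>+x\<in>ball z \<rho>. BT_ball \<rho> f g x \<partial>lborel) \<le> (ennreal (C1 * (\<rho> powr n * X powr (- \<gamma>1))) * m1 z)
            * (ennreal (C2 * (\<rho> powr n * X powr (- \<gamma>2))) * m2 z)" .
        have "(\<integral>\<^sup>+x\<in>ball z \<rho>. ennreal (norm x powr (- \<kappa>)) \<partial>lborel)
          \<le> (\<integral>\<^sup>+x\<in>ball z (2 * \<rho>). ennreal (norm x powr (- \<kappa>)) \<partial>lborel)"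
          by (rule nn_integral_mono) (use \<rho> in \<open>auto simp: indicator_def\<close>)
        also have "\<dots> \<le> ennreal (Cb * \<rho> ^ DIM('a) * X powr (- \<kappa>))"
          unfolding X_def by (rule W[OF \<rho>])
        finally show "(\<integral>\<^sup>+x\<in>ball z \<rho>. ennreal (norm x powr (- \<kappa>)) \<partial>lborel) \<le> ennreal (Cb * \<rho> ^ DIM('a) * X powr (- \<kappa>))" .
      qed (use t in auto)
      also have "(ennreal (C1 * (\<rho> powr n * X powr (- \<gamma>1))) * m1 z)
            * (ennreal (C2 * (\<rho> powr n * X powr (- \<gamma>2))) * m2 z)
         = ennreal ((C1 * (\<rho> powr n * X powr (- \<gamma>1))) * (C2 * (\<rho> powr n * X powr (- \<gamma>2)))) * (m1 z * m2 z)"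
        using C1 C2 by (simp add: ennreal_mult mult_ac)
      also have "epow (ennreal ((C1 * (\<rho> powr n * X powr (- \<gamma>1))) * (C2 * (\<rho> powr n * X powr (- \<gamma>2)))) * (m1 z * m2 z)) t
          * epow (ennreal (Cb * \<rho> ^ DIM('a) * X powr (- \<kappa>))) (1 - t)
         = ennreal (((C1 * (\<rho> powr n * X powr (- \<gamma>1))) * (C2 * (\<rho> powr n * X powr (- \<gamma>2)))) powr t
             * (Cb * \<rho> ^ DIM('a) * X powr (- \<kappa>)) powr (1 - t)) * epow (m1 z * m2 z) t"
        using C1 C2 Cb \<rho> by (intro epow_ennreal_mult_collect) auto
      also have "\<dots> \<le> ennreal (K * \<rho> powr n * (\<rho> powr (n - \<delta>)) powr t) * epow (m1 z * m2 z) t"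
      proof (intro mult_right_mono ennreal_leI)
        have p1: "((C1 * (\<rho> powr n * X powr (- \<gamma>1))) * (C2 * (\<rho> powr n * X powr (- \<gamma>2)))) powr t
            = (C1 * C2) powr t * (\<rho> powr (2 * n * t) * X powr (- (\<gamma>1 + \<gamma>2) * t))"
        proof -
          have eq: "(C1 * (\<rho> powr n * X powr (- \<gamma>1))) * (C2 * (\<rho> powr n * X powr (- \<gamma>2)))
            = (C1 * C2) * (\<rho> powr (2 * n) * X powr (- (\<gamma>1 + \<gamma>2)))"
          proof -
            have "\<rho> powr (2 * n) = \<rho> powr n * \<rho> powr n"
              by (simp add: powr_add[symmetric])
            moreover have "X powr (- (\<gamma>1 + \<gamma>2)) = X powr (- \<gamma>1) * X powr (- \<gamma>2)"
              by (simp add: powr_add[symmetric])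
            ultimately show ?thesis by (simp only: mult_ac)
          qed
          show ?thesis unfolding eq using C1 C2 by (simp add: powr_mult powr_powr)
        qed
        have p2: "(Cb * \<rho> ^ DIM('a) * X powr (- \<kappa>)) powr (1 - t)
            = Cb powr (1 - t) * (\<rho> powr (n * (1 - t)) * X powr (- \<beta> * t))"
        proof -
          have e: "- (\<kappa> * (1 - t)) = - \<beta> * t" using t by (simp add: \<kappa>_def)
          show ?thesis using Cb \<rho> X by (simp add: powr_mult powr_powr powr_realpow[symmetric] n_def e)
        qed
        \<comment> \<open>The three weights together leave X^(-\<delta> t) with X \<ge> \<rho>;
          nonnegativity of \<delta> is what permits replacing X by \<rho>.\<close>
        have p3: "X powr (- \<delta> * t) \<le> \<rho> powr (- \<delta> * t)"
          using X \<rho> d t by (intro powr_mono2' mult_nonpos_nonneg) (auto simp: \<delta>_def)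
        have "((C1 * (\<rho> powr n * X powr (- \<gamma>1))) * (C2 * (\<rho> powr n * X powr (- \<gamma>2)))) powr t
             * (Cb * \<rho> ^ DIM('a) * X powr (- \<kappa>)) powr (1 - t)
          = K * ((\<rho> powr (2 * n * t) * \<rho> powr (n * (1 - t))) * (X powr (- (\<gamma>1 + \<gamma>2) * t) * X powr (- \<beta> * t)))"
          unfolding p1 p2 K_def by (simp add: mult_ac)
        also have "\<dots> = K * (\<rho> powr (n * (1 + t)) * X powr (- \<delta> * t))"
          unfolding powr_add[symmetric] \<delta>_def by (simp add: algebra_simps)
        also have "\<dots> \<le> K * (\<rho> powr (n * (1 + t)) * \<rho> powr (- \<delta> * t))"
          using K by (intro mult_left_mono p3) auto
        also have "\<dots> = K * \<rho> powr n * (\<rho> powr (n - \<delta>)) powr t"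
          unfolding powr_powr by (simp add: mult.assoc powr_add[symmetric] algebra_simps)
        finally show "((C1 * (\<rho> powr n * X powr (- \<gamma>1))) * (C2 * (\<rho> powr n * X powr (- \<gamma>2)))) powr t
             * (Cb * \<rho> ^ DIM('a) * X powr (- \<kappa>)) powr (1 - t) \<le> K * \<rho> powr n * (\<rho> powr (n - \<delta>)) powr t" .
      qed simp
      also have "\<dots> = ennreal (K * \<rho> powr n) * epow (ennreal (\<rho> powr (n - \<delta>)) * (m1 z * m2 z)) t"
        using K by (simp add: epow_mult epow_ennreal ennreal_mult mult_ac)
      finally show ?thesis .
    qed
    have vr: "0 < v * \<rho> ^ DIM('a)" using v \<rho> by simp
    have "(\<integral>\<^sup>+x. \<phi> x \<partial>lborel) = ennreal (1 / (v * \<rho> ^ DIM('a))) * (ennreal (v * \<rho> ^ DIM('a)) * (\<integral>\<^sup>+x. \<phi> x \<partial>lborel))"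
      using v \<rho> by (simp add: mult.assoc[symmetric] flip: ennreal_mult)
    also have "\<dots> = ennreal (1 / (v * \<rho> ^ DIM('a))) * (\<integral>\<^sup>+z. (\<integral>\<^sup>+x\<in>ball z \<rho>. \<phi> x \<partial>lborel) \<partial>lborel)"
      using \<rho> unfolding v_def n_def by (subst nn_integral_eq_ball_average) auto
    also have "\<dots> \<le> ennreal (1 / (v * \<rho> ^ DIM('a))) * (\<integral>\<^sup>+z. ennreal (K * \<rho> powr n) * epow (ennreal (\<rho> powr (n - \<delta>)) * (m1 z * m2 z)) t \<partial>lborel)"
      by (rule mult_left_mono, rule nn_integral_mono, rule J) simp
    also have "\<dots> = ennreal (1 / (v * \<rho> ^ DIM('a))) * (ennreal (K * \<rho> powr n) * (\<integral>\<^sup>+z. epow (ennreal (\<rho> powr (n - \<delta>)) * (m1 z * m2 z)) t \<partial>lborel))"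
      by (subst nn_integral_cmult) auto
    also have "\<dots> = ennreal (1 / (v * \<rho> ^ DIM('a)) * (K * \<rho> powr n)) * (\<integral>\<^sup>+z. epow (ennreal (\<rho> powr (n - \<delta>)) * (m1 z * m2 z)) t \<partial>lborel)"
      using vr K by (subst ennreal_mult) (auto simp: mult.assoc)
    \<comment> \<open>The surplus \<rho>^n from the local estimate cancels the volume of the
      averaging ball, so the constant does not depend on the scale.\<close>
    also have "1 / (v * \<rho> ^ DIM('a)) * (K * \<rho> powr n) = K / v"
      using \<rho> by (simp add: n_def powr_realpow)
    finally show "(\<integral>\<^sup>+x. epow (BT_ball \<rho> f g x * ennreal (norm x powr (- \<beta>))) t \<partial>lborel)
      \<le> ennreal (K / v) * (\<integral>\<^sup>+z. epow (ennreal (\<rho> powr (DIM('a) - (\<beta> + \<gamma>1 + \<gamma>2)))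
          * (epow (ball_avg \<rho> (\<lambda>x. epow (f x * ennreal (norm x powr \<gamma>1)) a1) z) (1 / a1)
           * epow (ball_avg \<rho> (\<lambda>x. epow (g x * ennreal (norm x powr \<gamma>2)) a2) z) (1 / a2))) t \<partial>lborel)"
      unfolding \<phi>_def m1_def m2_def n_def \<delta>_def .
  qed
qed

text \<open>The splitting of Hedberg's inequality: the two bounds balance at the scale \<open>l\<close> with
  \<open>l powr (\<epsilon> + \<mu>) = N / A\<close>.\<close>

lemma hedberg_sum:
  fixes \<epsilon> \<mu> t :: real
  assumes e: "0 < \<epsilon>" and m: "0 < \<mu>" and t: "0 < t"
  shows "\<exists>C\<ge>0. \<forall>(x::int \<Rightarrow> ennreal) A N.
    (\<forall>j. x j \<le> ennreal (2 powr (j * \<epsilon>)) * A) \<longrightarrow> (\<forall>j. x j \<le> ennreal (2 powr (- real_of_int j * \<mu>)) * N) \<longrightarrow>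
    (\<integral>\<^sup>+j. epow (x j) t \<partial>count_space UNIV)
      \<le> ennreal C * (epow A (t * \<mu> / (\<epsilon> + \<mu>)) * epow N (t * \<epsilon> / (\<epsilon> + \<mu>)))"
proof -
  obtain C0 where C0: "C0 \<ge> 0" and geo: "\<And>l. l > 0 \<Longrightarrow>
      (\<integral>\<^sup>+j. ennreal (min ((2 powr real_of_int j / l) powr (\<epsilon> * t))
            ((2 powr real_of_int j / l) powr (- (\<mu> * t)))) \<partial>count_space UNIV) \<le> ennreal C0"
    using nn_integral_int_two_sided_geometric[of "\<epsilon> * t" "\<mu> * t"] assms by auto
  \<comment> \<open>Positive, so that the right side is infinite when one of \<open>A\<close>,
    \<open>N\<close> is infinite and the other nonzero.\<close>
  define C where "C = C0 + 1"
  have C: "C > 0" using C0 by (simp add: C_def)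
  show ?thesis
  proof (intro exI[of _ C] conjI allI impI)
    show "0 \<le> C" using C by simp
    fix x :: "int \<Rightarrow> ennreal" and A N
    assume xA: "\<forall>j. x j \<le> ennreal (2 powr (j * \<epsilon>)) * A" and xN: "\<forall>j. x j \<le> ennreal (2 powr (- real_of_int j * \<mu>)) * N"
    consider "A = 0 \<or> N = 0" | "A \<noteq> 0" "N \<noteq> 0" "A = top \<or> N = top"
      | "A \<noteq> 0" "N \<noteq> 0" "A \<noteq> top" "N \<noteq> top" by blast
    then show "(\<integral>\<^sup>+j. epow (x j) t \<partial>count_space UNIV)
      \<le> ennreal C * (epow A (t * \<mu> / (\<epsilon> + \<mu>)) * epow N (t * \<epsilon> / (\<epsilon> + \<mu>)))"
    proof cases
      case 1
      then have "x j = 0" for j using xA[rule_format, of j] xN[rule_format, of j] by auto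
      then show ?thesis by simp
    next
      case 2
      then have "ennreal C * (epow A (t * \<mu> / (\<epsilon> + \<mu>)) * epow N (t * \<epsilon> / (\<epsilon> + \<mu>))) = top"
        using C by (auto simp: ennreal_mult_eq_top_iff)
      then show ?thesis by simp
    next
      case 3
      obtain A' N' where A: "A = ennreal A'" "A' > 0" and N: "N = ennreal N'" "N' > 0"
        using 3 by (metis ennreal_neq_topE ennreal_0 order_le_less)
      define l where "l = (N' / A') powr (1 / (\<epsilon> + \<mu>))"
      have l: "l > 0" using A N by (simp add: l_def)
      \<comment> \<open>The common value A l^\<epsilon> = N l^(-\<mu>) of the two bounds. In terms
        of 2^j / l both become \<open>D\<close> times a pure power, and the geometric sum is uniform
        in \<open>l\<close>.\<close>
      define D where "D = A' * l powr \<epsilon>"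
      have D: "D > 0" using A l by (simp add: D_def)
      have lsum: "l powr \<epsilon> * l powr \<mu> = N' / A'"
        unfolding powr_add[symmetric] using A N e m by (simp add: l_def powr_powr)
      have D2: "D = N' * l powr (- \<mu>)"
        using lsum l A by (simp add: D_def powr_minus field_simps)
      have D3: "D powr t = A' powr (t * \<mu> / (\<epsilon> + \<mu>)) * N' powr (t * \<epsilon> / (\<epsilon> + \<mu>))"
      proof -
        have "D powr t = A' powr t * (N' / A') powr (t * \<epsilon> / (\<epsilon> + \<mu>))"
          using A l by (simp add: D_def powr_mult powr_powr l_def mult_ac)
        also have "\<dots> = A' powr (t - t * \<epsilon> / (\<epsilon> + \<mu>)) * N' powr (t * \<epsilon> / (\<epsilon> + \<mu>))"
          using A N by (simp add: powr_divide powr_diff)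
        also have "t - t * \<epsilon> / (\<epsilon> + \<mu>) = t * \<mu> / (\<epsilon> + \<mu>)"
          using e m by (simp add: field_simps)
        finally show ?thesis .
      qed
      have pt: "epow (x j) t \<le> ennreal (D powr t) * ennreal (min ((2 powr real_of_int j / l) powr (\<epsilon> * t))
            ((2 powr real_of_int j / l) powr (- (\<mu> * t))))" for j
      proof -
        define w where "w = 2 powr real_of_int j / l"
        have w: "w > 0" using l by (simp add: w_def)
        have "x j \<le> ennreal (D * w powr \<epsilon>)"
        proof -
          have "2 powr (j * \<epsilon>) * A' = D * w powr \<epsilon>"
            using l by (simp add: D_def w_def powr_divide powr_powr)
          then show ?thesis using xA[rule_format, of j] A by (simp flip: ennreal_mult)
        qed
        then have 1: "epow (x j) t \<le> ennreal (D powr t * w powr (\<epsilon> * t))"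
          using epow_mono[of t "x j"] t D w by (fastforce simp: epow_ennreal powr_mult powr_powr)
        have "x j \<le> ennreal (D * w powr (- \<mu>))"
        proof -
          have "2 powr (- real_of_int j * \<mu>) * N' = D * w powr (- \<mu>)"
            using l by (simp add: D2 w_def powr_divide powr_powr)
          then show ?thesis using xN[rule_format, of j] N by (simp flip: ennreal_mult)
        qed
        then have 2: "epow (x j) t \<le> ennreal (D powr t * w powr (- (\<mu> * t)))"
          using epow_mono[of t "x j"] t D w by (fastforce simp: epow_ennreal powr_mult powr_powr)
        show ?thesis using 1 2 unfolding w_def[symmetric] by (simp add: min_def ennreal_mult[symmetric])
      qed
      have "(\<integral>\<^sup>+j. epow (x j) t \<partial>count_space UNIV)
        \<le> (\<integral>\<^sup>+j. ennreal (D powr t) * ennreal (min ((2 powr real_of_int j / l) powr (\<epsilon> * t))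
            ((2 powr real_of_int j / l) powr (- (\<mu> * t)))) \<partial>count_space UNIV)"
        by (intro nn_integral_mono pt)
      also have "\<dots> \<le> ennreal (D powr t) * ennreal C"
        by (subst nn_integral_cmult)
           (simp, rule mult_left_mono[OF order_trans[OF geo[OF l]]], simp_all add: C_def ennreal_leI)
      also have "\<dots> = ennreal C * (epow A (t * \<mu> / (\<epsilon> + \<mu>)) * epow N (t * \<epsilon> / (\<epsilon> + \<mu>)))"
        using A N unfolding D3 by (simp add: epow_ennreal mult_ac flip: ennreal_mult)
      finally show ?thesis .
    qed
  qed
qed

section \<open>The weighted bound on Lebesgue spaces\<close>

definition BT_kernel :: "real \<Rightarrow> ('a::euclidean_space \<Rightarrow> ennreal) \<Rightarrow> ('a \<Rightarrow> ennreal) \<Rightarrow> 'a \<Rightarrow> ennreal" where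
  "BT_kernel \<alpha> f g x = (\<integral>\<^sup>+y. f (x - y) * g (x + y) * ennreal (norm y powr (- \<alpha>)) \<partial>lborel)"

lemma measurable_BT_kernel [measurable]:
  assumes [measurable]: "f \<in> borel_measurable borel" "g \<in> borel_measurable borel"
  shows "BT_kernel \<alpha> f g \<in> borel_measurable borel"
proof -
  have "(\<lambda>x. \<integral>\<^sup>+y. f (x - y) * g (x + y) * ennreal (norm y powr (- \<alpha>)) \<partial>lborel) \<in> borel_measurable lborel"
    by measurable
  then show ?thesis by (simp add: BT_kernel_def[abs_def])
qed

text \<open>Every y \<noteq> 0 has a scale with |y| < 2^k \<le> 2 |y|, and that one term already
  dominates the kernel. Full balls may therefore replace annuli, which is the form that the shear
  estimate needs. The absolute value of \<alpha> in the constant makes it independent of the sign of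
  \<alpha>.\<close>

lemma BT_kernel_le_sum_BT_ball:
  fixes f g :: "'a::euclidean_space \<Rightarrow> ennreal"
  assumes [measurable]: "f \<in> borel_measurable borel" "g \<in> borel_measurable borel"
  shows "BT_kernel \<alpha> f g x \<le> (\<integral>\<^sup>+j. ennreal (2 powr \<bar>\<alpha>\<bar> * 2 powr (- real_of_int j * \<alpha>)) * BT_ball (2 powr j) f g x \<partial>count_space UNIV)"
proof -
  define c where "c j = ennreal (2 powr \<bar>\<alpha>\<bar> * 2 powr (- real_of_int j * \<alpha>))" for j
  have "BT_kernel \<alpha> f g x \<le> (\<integral>\<^sup>+y. (\<integral>\<^sup>+j. c j * (f (x - y) * g (x + y) * indicator (ball 0 (2 powr real_of_int j)) y) \<partial>count_space UNIV) \<partial>lborel)"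
    unfolding BT_kernel_def
  proof (rule nn_integral_mono)
    fix y :: 'a
    show "f (x - y) * g (x + y) * ennreal (norm y powr (- \<alpha>))
      \<le> (\<integral>\<^sup>+j. c j * (f (x - y) * g (x + y) * indicator (ball 0 (2 powr real_of_int j)) y) \<partial>count_space UNIV)"
    proof (cases "y = 0")
      case False
      define k where "k = \<lfloor>log 2 (norm y)\<rfloor> + 1"
      have k: "norm y < 2 powr k" "2 powr k \<le> 2 * norm y"
        using two_powr_floor_log[of "norm y"] False by (auto simp: k_def powr_add)
      have "norm y powr (- \<alpha>) \<le> 2 powr \<bar>\<alpha>\<bar> * (2 powr k) powr (- \<alpha>)"
        using powr_le_comparable[of "norm y" "2 powr k" 2 "- \<alpha>"] k False by simp
      then have "ennreal (norm y powr (- \<alpha>)) \<le> c k"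
        unfolding c_def by (intro ennreal_leI) (simp add: powr_powr)
      then have "f (x - y) * g (x + y) * ennreal (norm y powr (- \<alpha>))
        \<le> c k * (f (x - y) * g (x + y) * indicator (ball 0 (2 powr real_of_int k)) y)"
        using k by (simp add: mult.commute[of "c k"] mult_left_mono)
      also have "\<dots> \<le> (\<integral>\<^sup>+j. c j * (f (x - y) * g (x + y) * indicator (ball 0 (2 powr real_of_int j)) y) \<partial>count_space UNIV)"
        by (rule nn_integral_count_space_int_ge)
      finally show ?thesis .
    qed simp
  qed
  also have "\<dots> = (\<integral>\<^sup>+j. (\<integral>\<^sup>+y. c j * (f (x - y) * g (x + y) * indicator (ball 0 (2 powr real_of_int j)) y) \<partial>lborel) \<partial>count_space UNIV)"
    by (rule nn_integral_count_space_nn_integral) auto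
  also have "\<dots> = (\<integral>\<^sup>+j. c j * BT_ball (2 powr j) f g x \<partial>count_space UNIV)"
    by (rule nn_integral_cong) (simp add: BT_ball_def nn_integral_cmult)
  finally show ?thesis by (simp add: c_def)
qed

text \<open>Hoelder against the indicator of the ball: the average of order a is at most a constant
  times \<rho>^(-n/q) times the global L^q norm. This supplies the bound that decays at large scales
  in Hedberg's splitting.\<close>

lemma ball_avg_powr_le:
  fixes F :: "'a::euclidean_space \<Rightarrow> ennreal"
  assumes [measurable]: "F \<in> borel_measurable borel" and a: "1 < a" "a < q" and \<rho>: "0 < \<rho>"
  shows "epow (ball_avg \<rho> (\<lambda>x. epow (F x) a) z) (1 / a)
    \<le> ennreal ((unit_ball_vol (DIM('a)) * 2 ^ DIM('a)) powr (1 / a - 1 / q) * \<rho> powr (- real DIM('a) / q))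
       * epow (\<integral>\<^sup>+x. epow (F x) q \<partial>lborel) (1 / q)"
proof -
  define n where "n = real DIM('a)"
  define V where "V = unit_ball_vol n * 2 ^ DIM('a)"
  have V: "V > 0" by (simp add: V_def n_def)
  have th: "0 < a / q" "a / q < 1" using a by auto
  have "(\<integral>\<^sup>+x\<in>ball z (2 * \<rho>). epow (F x) a \<partial>lborel)
      = (\<integral>\<^sup>+x. epow (epow (F x) q) (a / q) * epow (indicator (ball z (2 * \<rho>)) x) (1 - a / q) \<partial>lborel)"
    by (intro nn_integral_cong) (use a in \<open>auto simp: indicator_def\<close>)
  also have "\<dots> \<le> epow (\<integral>\<^sup>+x. epow (F x) q \<partial>lborel) (a / q) * epow (\<integral>\<^sup>+x. indicator (ball z (2 * \<rho>)) x \<partial>lborel) (1 - a / q)"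
    by (intro nn_integral_holder th) auto
  also have "(\<integral>\<^sup>+x. indicator (ball z (2 * \<rho>)) x \<partial>lborel) = ennreal (V * \<rho> powr n)"
    using \<rho> by (simp add: emeasure_ball V_def n_def power_mult_distrib powr_realpow mult_ac)
  finally have "epow (ball_avg \<rho> (\<lambda>x. epow (F x) a) z) (1 / a)
     \<le> epow (ennreal (\<rho> powr (- n)) * (epow (\<integral>\<^sup>+x. epow (F x) q \<partial>lborel) (a / q) * epow (ennreal (V * \<rho> powr n)) (1 - a / q))) (1 / a)"
    unfolding ball_avg_def n_def using a by (intro epow_mono mult_left_mono) auto
  also have "\<dots> = ennreal ((\<rho> powr (- n)) powr (1 / a) * (V * \<rho> powr n) powr ((1 - a / q) * (1 / a)))
      * epow (\<integral>\<^sup>+x. epow (F x) q \<partial>lborel) (a / q * (1 / a))"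
  proof -
    have "epow (ennreal u * (S * epow (ennreal w) s)) r = ennreal (u powr r * w powr (s * r)) * epow S r"
      if "0 \<le> u" "0 \<le> w" for u w s r S
      using that by (simp add: epow_mult epow_ennreal powr_powr ennreal_mult mult_ac)
    then show ?thesis using V by simp
  qed
  also have "a / q * (1 / a) = 1 / q" using a by simp
  also have "(1 - a / q) * (1 / a) = 1 / a - 1 / q" using a by (simp add: field_simps)
  also have "(\<rho> powr (- n)) powr (1 / a) * (V * \<rho> powr n) powr (1 / a - 1 / q)
     = V powr (1 / a - 1 / q) * (\<rho> powr (- n * (1 / a)) * \<rho> powr (n * (1 / a - 1 / q)))"
    using V by (simp add: powr_mult powr_powr)
  also have "\<rho> powr (- n * (1 / a)) * \<rho> powr (n * (1 / a - 1 / q)) = \<rho> powr (- n / q)"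
    unfolding powr_add[symmetric] by (simp add: algebra_simps)
  finally show ?thesis by (simp add: V_def n_def)
qed

text \<open>The condition on \<gamma> is open in 1/q, so 1/a may be taken slightly above 1/q. Then q
  / a > 1, as the maximal theorem requires.\<close>

lemma ex_smaller_exponent:
  fixes q \<gamma> n :: real
  assumes "1 < q" "\<gamma> < n * (1 - 1 / q)" "0 < n"
  shows "\<exists>a. 1 < a \<and> a < q \<and> \<gamma> < n * (1 - 1 / a)"
proof -
  have "1 / q < min 1 (1 - \<gamma> / n)" using assms by (simp add: field_simps)
  then obtain b where b: "1 / q < b" "b < min 1 (1 - \<gamma> / n)" using dense by blast
  have b0: "0 < b" using b assms by (meson less_trans zero_less_divide_iff zero_less_one)
  show ?thesis
    using b b0 assms by (intro exI[of _ "1 / b"]) (auto simp: field_simps)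
qed

lemma BT_kernel_weighted_Lebesgue_bound:
  fixes q1 q2 t \<alpha> \<beta> \<gamma>1 \<gamma>2 \<epsilon> :: real
  assumes q1: "1 < q1" and q2: "1 < q2" and t: "0 < t" "t < 1" and e: "0 < \<epsilon>"
    and teq: "1 / t = 1 / q1 + 1 / q2 - \<epsilon> / DIM('a)"
    and b: "\<beta> < DIM('a) * (1 / t - 1)"
    and g1: "\<gamma>1 < DIM('a) * (1 - 1 / q1)" and g2: "\<gamma>2 < DIM('a) * (1 - 1 / q2)"
    and d: "0 \<le> \<beta> + \<gamma>1 + \<gamma>2" and al: "\<alpha> = DIM('a) - (\<beta> + \<gamma>1 + \<gamma>2) - \<epsilon>"
  shows "\<exists>C\<ge>0. \<forall>(f::'a::euclidean_space \<Rightarrow> ennreal) g.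
    f \<in> borel_measurable borel \<longrightarrow> g \<in> borel_measurable borel \<longrightarrow>
    (\<integral>\<^sup>+x. epow (BT_kernel \<alpha> f g x * ennreal (norm x powr (- \<beta>))) t \<partial>lborel)
      \<le> ennreal C * (epow (\<integral>\<^sup>+x. epow (f x * ennreal (norm x powr \<gamma>1)) q1 \<partial>lborel) (t / q1)
         * epow (\<integral>\<^sup>+x. epow (g x * ennreal (norm x powr \<gamma>2)) q2 \<partial>lborel) (t / q2))"
proof -
  define n where "n = real DIM('a)"
  have n: "n > 0" by (simp add: n_def)
  define \<delta> where "\<delta> = \<beta> + \<gamma>1 + \<gamma>2"
  obtain a1 where a1: "1 < a1" "a1 < q1" "\<gamma>1 < DIM('a) * (1 - 1 / a1)"
    using ex_smaller_exponent[OF q1 g1] by auto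
  obtain a2 where a2: "1 < a2" "a2 < q2" "\<gamma>2 < DIM('a) * (1 - 1 / a2)"
    using ex_smaller_exponent[OF q2 g2] by auto
  obtain Cs where Cs: "Cs \<ge> 0" and single: "\<And>(f::'a \<Rightarrow> ennreal) g \<rho>.
    f \<in> borel_measurable borel \<Longrightarrow> g \<in> borel_measurable borel \<Longrightarrow> 0 < \<rho> \<Longrightarrow>
    (\<integral>\<^sup>+x. epow (BT_ball \<rho> f g x * ennreal (norm x powr (- \<beta>))) t \<partial>lborel)
      \<le> ennreal Cs * (\<integral>\<^sup>+z. epow (ennreal (\<rho> powr (n - \<delta>))
          * (epow (ball_avg \<rho> (\<lambda>x. epow (f x * ennreal (norm x powr \<gamma>1)) a1) z) (1 / a1)
           * epow (ball_avg \<rho> (\<lambda>x. epow (g x * ennreal (norm x powr \<gamma>2)) a2) z) (1 / a2))) t \<partial>lborel)"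
    using single_scale_bound[OF a1(1,3) a2(1,3) t b d] unfolding n_def \<delta>_def by blast
  \<comment> \<open>The averages of F and G decay together like 2^(-j n/q), and the scale factor is
    2^(j \<epsilon>); the net decay exponent is n/q - \<epsilon> = n/t.\<close>
  define \<mu> where "\<mu> = n / t"
  have mu: "\<mu> > 0" using n t by (simp add: \<mu>_def)
  define q where "q = 1 / (1 / q1 + 1 / q2)"
  have rq: "1 / q = 1 / q1 + 1 / q2" by (simp add: q_def)
  have q: "q > 0" using q1 q2 by (simp add: q_def add_pos_pos)
  have eps: "\<epsilon> = n / q - n / t"
    using teq n unfolding rq[symmetric] n_def[symmetric] by (simp add: field_simps)
  have emu: "\<epsilon> + \<mu> = n / q" by (simp add: eps \<mu>_def)
  \<comment> \<open>Hedberg's exponents become q on the maximal functions and t - q on the norms.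
    The power q is the one that Hoelder can integrate, because q/q1 + q/q2 = 1.\<close>
  have ex1: "t * \<mu> / (\<epsilon> + \<mu>) = q" unfolding emu using n t q by (simp add: \<mu>_def)
  have ex2: "t * \<epsilon> / (\<epsilon> + \<mu>) = t - q" unfolding emu unfolding eps using n t q by (simp add: field_simps)
  obtain Ch where Ch: "Ch \<ge> 0" and hed: "\<And>(x::int \<Rightarrow> ennreal) A N.
    (\<And>j. x j \<le> ennreal (2 powr (j * \<epsilon>)) * A) \<Longrightarrow> (\<And>j. x j \<le> ennreal (2 powr (- real_of_int j * \<mu>)) * N) \<Longrightarrow>
    (\<integral>\<^sup>+j. epow (x j) t \<partial>count_space UNIV) \<le> ennreal Ch * (epow A q * epow N (t - q))"
    using hedberg_sum[OF e mu t(1)] unfolding ex1 ex2 by blast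
  obtain M1 where M1: "M1 \<ge> 0" and max1: "\<And>h::'a \<Rightarrow> ennreal. h \<in> borel_measurable borel \<Longrightarrow>
    (\<integral>\<^sup>+x. epow (dyadic_maximal h x) (q1 / a1) \<partial>lborel) \<le> ennreal M1 * (\<integral>\<^sup>+x. epow (h x) (q1 / a1) \<partial>lborel)"
    using dyadic_maximal_strong_type[of "q1 / a1"] a1 by auto
  obtain M2 where M2: "M2 \<ge> 0" and max2: "\<And>h::'a \<Rightarrow> ennreal. h \<in> borel_measurable borel \<Longrightarrow>
    (\<integral>\<^sup>+x. epow (dyadic_maximal h x) (q2 / a2) \<partial>lborel) \<le> ennreal M2 * (\<integral>\<^sup>+x. epow (h x) (q2 / a2) \<partial>lborel)"
    using dyadic_maximal_strong_type[of "q2 / a2"] a2 by auto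
  define c1 where "c1 = (unit_ball_vol (DIM('a)) * 2 ^ DIM('a)) powr (1 / a1 - 1 / q1)"
  define c2 where "c2 = (unit_ball_vol (DIM('a)) * 2 ^ DIM('a)) powr (1 / a2 - 1 / q2)"
  have c: "c1 \<ge> 0" "c2 \<ge> 0" by (simp_all add: c1_def c2_def)
  define K where "K = (2 powr \<bar>\<alpha>\<bar>) powr t"
  define C where "C = K * Cs * (Ch * ((c1 * c2) powr (t - q) * (M1 powr (q / q1) * M2 powr (q / q2))))"
  have C: "C \<ge> 0" using c Cs Ch by (simp add: C_def K_def)
  show ?thesis
  proof (intro exI[of _ C] conjI allI impI C)
    fix f g :: "'a \<Rightarrow> ennreal"
    assume [measurable]: "f \<in> borel_measurable borel" "g \<in> borel_measurable borel"
    define w where "w x = ennreal (norm x powr (- \<beta>))" for x :: 'a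
    have [measurable]: "w \<in> borel_measurable borel" unfolding w_def[abs_def] by measurable
    define F where "F x = f x * ennreal (norm x powr \<gamma>1)" for x
    define G where "G x = g x * ennreal (norm x powr \<gamma>2)" for x
    have [measurable]: "F \<in> borel_measurable borel" "G \<in> borel_measurable borel"
      unfolding F_def[abs_def] G_def[abs_def] by measurable
    define F' where "F' x = epow (F x) a1" for x
    define G' where "G' x = epow (G x) a2" for x
    have [measurable]: "F' \<in> borel_measurable borel" "G' \<in> borel_measurable borel"
      unfolding F'_def[abs_def] G'_def[abs_def] by measurable
    define S1 S2 where "S1 = (\<integral>\<^sup>+x. epow (F x) q1 \<partial>lborel)" and "S2 = (\<integral>\<^sup>+x. epow (G x) q2 \<partial>lborel)"
    define m where "m j z = epow (ball_avg (2 powr real_of_int j) F' z) (1 / a1) * epow (ball_avg (2 powr real_of_int j) G' z) (1 / a2)" for j z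
    have [measurable]: "m j \<in> borel_measurable borel" for j
      unfolding m_def[abs_def] by measurable
    define A where "A z = epow (dyadic_maximal F' z) (1 / a1) * epow (dyadic_maximal G' z) (1 / a2)" for z
    have [measurable]: "A \<in> borel_measurable borel"
      unfolding A_def[abs_def] by measurable
    define N where "N = ennreal (c1 * c2) * (epow S1 (1 / q1) * epow S2 (1 / q2))"
    have mA: "m j z \<le> A z" for j z
      unfolding m_def A_def using a1 a2 by (intro mult_mono epow_mono dyadic_maximal_ge) auto
    have mN: "m j z \<le> ennreal (2 powr (- real_of_int j * (n / q))) * N" for j z
    proof -
      have "m j z \<le> (ennreal (c1 * (2 powr j) powr (- n / q1)) * epow S1 (1 / q1))
          * (ennreal (c2 * (2 powr j) powr (- n / q2)) * epow S2 (1 / q2))"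
        unfolding m_def F'_def G'_def S1_def S2_def c1_def c2_def n_def
        using a1 a2 by (intro mult_mono ball_avg_powr_le) auto
      also have "\<dots> = ennreal ((2 powr j) powr (- n / q1) * (2 powr j) powr (- n / q2)) * N"
        using c by (simp add: N_def ennreal_mult mult_ac)
      also have "(2 powr j) powr (- n / q1) * (2 powr j) powr (- n / q2) = 2 powr (- real_of_int j * (n * (1 / q)))"
        unfolding rq powr_powr powr_add[symmetric] by (simp add: algebra_simps)
      also have "n * (1 / q) = n / q" by simp
      finally show ?thesis .
    qed
    have sumj: "(\<integral>\<^sup>+j. epow (ennreal (2 powr (real_of_int j * \<epsilon>)) * m j z) t \<partial>count_space UNIV)
        \<le> ennreal Ch * (epow (A z) q * epow N (t - q))" for z
    proof (rule hed)
      show "ennreal (2 powr (real_of_int j * \<epsilon>)) * m j z \<le> ennreal (2 powr (j * \<epsilon>)) * A z" for j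
        by (intro mult_left_mono mA) auto
      show "ennreal (2 powr (real_of_int j * \<epsilon>)) * m j z \<le> ennreal (2 powr (- real_of_int j * \<mu>)) * N" for j
      proof -
        have "ennreal (2 powr (real_of_int j * \<epsilon>)) * m j z
            \<le> ennreal (2 powr (real_of_int j * \<epsilon>)) * (ennreal (2 powr (- real_of_int j * (n / q))) * N)"
          by (intro mult_left_mono mN) auto
        also have "\<dots> = ennreal (2 powr (real_of_int j * \<epsilon>) * 2 powr (- real_of_int j * (n / q))) * N"
          by (simp add: ennreal_mult mult.assoc)
        also have "2 powr (real_of_int j * \<epsilon>) * 2 powr (- real_of_int j * (n / q)) = 2 powr (- real_of_int j * \<mu>)"
          unfolding powr_add[symmetric] emu[symmetric] by (simp add: algebra_simps)
        finally show ?thesis .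
      qed
    qed
    have intA: "(\<integral>\<^sup>+z. epow (A z) q \<partial>lborel) \<le> ennreal (M1 powr (q / q1) * M2 powr (q / q2)) * (epow S1 (q / q1) * epow S2 (q / q2))"
    proof -
      have r1: "q / q1 > 0" "q / q2 > 0" using q q1 q2 by auto
      have r2: "1 - q / q1 = q / q2"
      proof -
        have "q * (1 / q) = q * (1 / q1 + 1 / q2)" by (simp only: rq)
        then show ?thesis using q by (simp add: distrib_left)
      qed
      have "(\<integral>\<^sup>+z. epow (A z) q \<partial>lborel)
        = (\<integral>\<^sup>+z. epow (epow (dyadic_maximal F' z) (q1 / a1)) (q / q1) * epow (epow (dyadic_maximal G' z) (q2 / a2)) (1 - q / q1) \<partial>lborel)"
        unfolding r2 using q1 q2 by (intro nn_integral_cong) (simp add: A_def epow_mult)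
      also have "\<dots> \<le> epow (\<integral>\<^sup>+z. epow (dyadic_maximal F' z) (q1 / a1) \<partial>lborel) (q / q1)
           * epow (\<integral>\<^sup>+z. epow (dyadic_maximal G' z) (q2 / a2) \<partial>lborel) (1 - q / q1)"
        using r1 r2 by (intro nn_integral_holder) auto
      also have "\<dots> \<le> epow (ennreal M1 * (\<integral>\<^sup>+x. epow (F' x) (q1 / a1) \<partial>lborel)) (q / q1)
           * epow (ennreal M2 * (\<integral>\<^sup>+x. epow (G' x) (q2 / a2) \<partial>lborel)) (q / q2)"
        unfolding r2 using r1 by (intro mult_mono epow_mono max1 max2) auto
      also have "(\<integral>\<^sup>+x. epow (F' x) (q1 / a1) \<partial>lborel) = S1"
        unfolding S1_def F'_def using a1 by simp
      also have "(\<integral>\<^sup>+x. epow (G' x) (q2 / a2) \<partial>lborel) = S2"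
        unfolding S2_def G'_def using a2 by simp
      also have "epow (ennreal M1 * S1) (q / q1) * epow (ennreal M2 * S2) (q / q2)
          = ennreal (M1 powr (q / q1) * M2 powr (q / q2)) * (epow S1 (q / q1) * epow S2 (q / q2))"
        using M1 M2 by (simp add: epow_mult epow_ennreal ennreal_mult mult_ac)
      finally show ?thesis .
    qed
    have "(\<integral>\<^sup>+x. epow (BT_kernel \<alpha> f g x * w x) t \<partial>lborel)
      \<le> (\<integral>\<^sup>+x. (\<integral>\<^sup>+j. ennreal (K * 2 powr (- real_of_int j * \<alpha> * t)) * epow (BT_ball (2 powr j) f g x * w x) t \<partial>count_space UNIV) \<partial>lborel)"
    proof (rule nn_integral_mono)
      fix x :: 'a
      have "epow (BT_kernel \<alpha> f g x * w x) t
        \<le> epow ((\<integral>\<^sup>+j. ennreal (2 powr \<bar>\<alpha>\<bar> * 2 powr (- real_of_int j * \<alpha>)) * BT_ball (2 powr j) f g x \<partial>count_space UNIV) * w x) t"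
        using t by (intro epow_mono mult_right_mono BT_kernel_le_sum_BT_ball) auto
      also have "(\<integral>\<^sup>+j. ennreal (2 powr \<bar>\<alpha>\<bar> * 2 powr (- real_of_int j * \<alpha>)) * BT_ball (2 powr j) f g x \<partial>count_space UNIV) * w x
        = (\<integral>\<^sup>+j. ennreal (2 powr \<bar>\<alpha>\<bar> * 2 powr (- real_of_int j * \<alpha>)) * BT_ball (2 powr j) f g x * w x \<partial>count_space UNIV)"
        by (rule nn_integral_multc[symmetric]) simp
      also have "epow \<dots> t \<le> (\<integral>\<^sup>+j. epow (ennreal (2 powr \<bar>\<alpha>\<bar> * 2 powr (- real_of_int j * \<alpha>)) * BT_ball (2 powr j) f g x * w x) t \<partial>count_space UNIV)"
        using t by (intro epow_nn_integral_int_le) auto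
      also have "\<dots> = (\<integral>\<^sup>+j. ennreal (K * 2 powr (- real_of_int j * \<alpha> * t)) * epow (BT_ball (2 powr j) f g x * w x) t \<partial>count_space UNIV)"
        by (intro nn_integral_cong) (simp add: K_def epow_mult epow_ennreal powr_mult powr_powr mult.assoc)
      finally show "epow (BT_kernel \<alpha> f g x * w x) t
        \<le> (\<integral>\<^sup>+j. ennreal (K * 2 powr (- real_of_int j * \<alpha> * t)) * epow (BT_ball (2 powr j) f g x * w x) t \<partial>count_space UNIV)" .
    qed
    also have "\<dots> = (\<integral>\<^sup>+j. (\<integral>\<^sup>+x. ennreal (K * 2 powr (- real_of_int j * \<alpha> * t)) * epow (BT_ball (2 powr j) f g x * w x) t \<partial>lborel) \<partial>count_space UNIV)"
      by (rule nn_integral_count_space_nn_integral) auto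
    also have "\<dots> \<le> (\<integral>\<^sup>+j. (\<integral>\<^sup>+z. ennreal (K * Cs) * epow (ennreal (2 powr (real_of_int j * \<epsilon>)) * m j z) t \<partial>lborel) \<partial>count_space UNIV)"
    proof (rule nn_integral_mono)
      fix j :: int
      have K: "K \<ge> 0" by (simp add: K_def)
      have "(\<integral>\<^sup>+x. ennreal (K * 2 powr (- real_of_int j * \<alpha> * t)) * epow (BT_ball (2 powr j) f g x * w x) t \<partial>lborel)
        = ennreal (K * 2 powr (- real_of_int j * \<alpha> * t)) * (\<integral>\<^sup>+x. epow (BT_ball (2 powr j) f g x * w x) t \<partial>lborel)"
        by (rule nn_integral_cmult) measurable
      also have "\<dots> \<le> ennreal (K * 2 powr (- real_of_int j * \<alpha> * t)) * (ennreal Cs * (\<integral>\<^sup>+z. epow (ennreal ((2 powr j) powr (n - \<delta>)) * m j z) t \<partial>lborel))"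
        unfolding w_def m_def F'_def G'_def F_def G_def
        by (intro mult_left_mono single) auto
      also have "\<dots> = (\<integral>\<^sup>+z. ennreal (K * 2 powr (- real_of_int j * \<alpha> * t)) * (ennreal Cs * epow (ennreal ((2 powr j) powr (n - \<delta>)) * m j z) t) \<partial>lborel)"
        by (simp add: nn_integral_cmult)
      also have "\<dots> = (\<integral>\<^sup>+z. ennreal (K * Cs) * epow (ennreal (2 powr (real_of_int j * \<epsilon>)) * m j z) t \<partial>lborel)"
      proof (rule nn_integral_cong)
        fix z :: 'a
        \<comment> \<open>The kernel contributes 2^(-j \<alpha>) and the single-scale bound 2^(j (n
          - \<delta>)); by the relation for \<alpha> the product is 2^(j \<epsilon>).\<close>
        have "2 powr (- real_of_int j * \<alpha> * t) * ((2 powr j) powr (n - \<delta>)) powr t = (2 powr (real_of_int j * \<epsilon>)) powr t"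
          unfolding powr_powr powr_add[symmetric] al by (simp add: n_def \<delta>_def algebra_simps)
        then have "ennreal ((2 powr (real_of_int j * \<epsilon>)) powr t) = ennreal (2 powr (- real_of_int j * \<alpha> * t)) * ennreal (((2 powr j) powr (n - \<delta>)) powr t)"
          by (simp flip: ennreal_mult)
        then show "ennreal (K * 2 powr (- real_of_int j * \<alpha> * t)) * (ennreal Cs * epow (ennreal ((2 powr j) powr (n - \<delta>)) * m j z) t)
            = ennreal (K * Cs) * epow (ennreal (2 powr (real_of_int j * \<epsilon>)) * m j z) t"
          unfolding epow_mult using K Cs by (simp add: epow_ennreal ennreal_mult mult_ac)
      qed
      finally show "(\<integral>\<^sup>+x. ennreal (K * 2 powr (- real_of_int j * \<alpha> * t)) * epow (BT_ball (2 powr j) f g x * w x) t \<partial>lborel)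
         \<le> (\<integral>\<^sup>+z. ennreal (K * Cs) * epow (ennreal (2 powr (real_of_int j * \<epsilon>)) * m j z) t \<partial>lborel)" .
    qed
    also have "\<dots> = (\<integral>\<^sup>+z. (\<integral>\<^sup>+j. ennreal (K * Cs) * epow (ennreal (2 powr (real_of_int j * \<epsilon>)) * m j z) t \<partial>count_space UNIV) \<partial>lborel)"
      by (rule nn_integral_count_space_nn_integral[symmetric]) auto
    also have "\<dots> \<le> (\<integral>\<^sup>+z. ennreal (K * Cs) * (ennreal Ch * (epow (A z) q * epow N (t - q))) \<partial>lborel)"
      by (rule nn_integral_mono, subst nn_integral_cmult, simp, rule mult_left_mono[OF sumj], simp)
    also have "\<dots> = ennreal (K * Cs) * (ennreal Ch * ((\<integral>\<^sup>+z. epow (A z) q \<partial>lborel) * epow N (t - q)))"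
      by (simp add: nn_integral_cmult nn_integral_multc)
    also have "\<dots> \<le> ennreal (K * Cs) * (ennreal Ch * ((ennreal (M1 powr (q / q1) * M2 powr (q / q2)) * (epow S1 (q / q1) * epow S2 (q / q2))) * epow N (t - q)))"
      by (intro mult_left_mono mult_right_mono intA) auto
    also have "\<dots> = ennreal C * ((epow S1 (q / q1) * epow S1 ((t - q) / q1)) * (epow S2 (q / q2) * epow S2 ((t - q) / q2)))"
    proof -
      have "epow N (t - q) = ennreal ((c1 * c2) powr (t - q)) * (epow S1 ((t - q) / q1) * epow S2 ((t - q) / q2))"
        using c unfolding N_def epow_mult epow_epow by (simp add: epow_ennreal)
      then show ?thesis using c Cs Ch by (simp add: C_def K_def ennreal_mult mult_ac)
    qed
    also have "epow S1 (q / q1) * epow S1 ((t - q) / q1) = epow S1 (t / q1)"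
      unfolding epow_add_right[symmetric] by (simp add: add_divide_distrib[symmetric])
    also have "epow S2 (q / q2) * epow S2 ((t - q) / q2) = epow S2 (t / q2)"
      unfolding epow_add_right[symmetric] by (simp add: add_divide_distrib[symmetric])
    finally show "(\<integral>\<^sup>+x. epow (BT_kernel \<alpha> f g x * ennreal (norm x powr (- \<beta>))) t \<partial>lborel)
      \<le> ennreal C * (epow (\<integral>\<^sup>+x. epow (f x * ennreal (norm x powr \<gamma>1)) q1 \<partial>lborel) (t / q1)
         * epow (\<integral>\<^sup>+x. epow (g x * ennreal (norm x powr \<gamma>2)) q2 \<partial>lborel) (t / q2))"
      unfolding w_def S1_def S2_def F_def G_def .
  qed
qed

section \<open>Dyadic cubes and Morrey norms\<close>

definition dcube :: "int \<Rightarrow> ('a::euclidean_space \<Rightarrow> int) \<Rightarrow> 'a set" where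
  "dcube k m = {x. \<forall>i\<in>Basis. 2 powr k * real_of_int (m i) \<le> x \<bullet> i
                          \<and> x \<bullet> i < 2 powr k * (real_of_int (m i) + 1)}"

lemma dyadic_cubes_eq: "dyadic_cubes = {dcube k m | k m. True}"
  by (auto simp: dyadic_cubes_def dcube_def)

lemma dcube_borel [measurable]: "dcube k m \<in> sets borel"
proof -
  have "dcube k m = (\<Inter>i\<in>Basis. {x :: 'a. 2 powr k * real_of_int (m i) \<le> x \<bullet> i} \<inter> {x. x \<bullet> i < 2 powr k * (real_of_int (m i) + 1)})"
    by (auto simp: dcube_def)
  also have "\<dots> \<in> sets borel"
    by (intro sets.finite_INT sets.Int borel_closed borel_open closed_Collect_le open_Collect_less continuous_intros) auto
  finally show ?thesis .
qed

definition dcorner :: "int \<Rightarrow> ('a::euclidean_space \<Rightarrow> int) \<Rightarrow> 'a" where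
  "dcorner k m = (\<Sum>i\<in>Basis. (2 powr k * real_of_int (m i)) *\<^sub>R i)"

lemma dcorner_inner [simp]: "i \<in> Basis \<Longrightarrow> dcorner k m \<bullet> i = 2 powr k * real_of_int (m i)"
  by (simp add: dcorner_def inner_sum_left_Basis)

text \<open>The half-open cube is squeezed between an open and a closed box of equal volume.\<close>

lemma emeasure_dcube: "emeasure lborel (dcube k m :: 'a::euclidean_space set) = ennreal ((2 powr k) powr DIM('a))"
proof -
  define u where "u = dcorner k m"
  define v :: 'a where "v = u + (\<Sum>i\<in>Basis. (2 powr k) *\<^sub>R i)"
  have v: "v \<bullet> i = u \<bullet> i + 2 powr k" if "i \<in> Basis" for i
    using that by (simp add: v_def inner_add_left inner_sum_left_Basis)
  have le: "u \<bullet> i \<le> v \<bullet> i" if "i \<in> Basis" for i using that by (simp add: v)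
  have "(\<Prod>i\<in>Basis. (v - u) \<bullet> i) = (2 powr k) powr DIM('a)"
    by (simp add: inner_diff_left v powr_realpow)
  then have e: "emeasure lborel (box u v) = ennreal ((2 powr k) powr DIM('a))"
    "emeasure lborel (cbox u v) = ennreal ((2 powr k) powr DIM('a))"
    using le by (simp_all add: emeasure_lborel_box emeasure_lborel_cbox)
  have "box u v \<subseteq> dcube k m" "dcube k m \<subseteq> cbox u v"
    by (auto simp: dcube_def box_def cbox_def v u_def distrib_left order_less_imp_le)
  then have "emeasure lborel (box u v) \<le> emeasure lborel (dcube k m)"
    "emeasure lborel (dcube k m) \<le> emeasure lborel (cbox u v)"
    by (auto intro!: emeasure_mono)
  then show ?thesis using e by auto
qed

lemma measure_dcube: "measure lebesgue (dcube k m :: 'a::euclidean_space set) = (2 powr k) powr DIM('a)"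
  by (subst measure_completion) (simp_all add: measure_def emeasure_dcube)

lemma dist_dcorner_le:
  fixes x :: "'a::euclidean_space"
  assumes "x \<in> dcube k m"
  shows "dist (dcorner k m) x \<le> DIM('a) * 2 powr k"
proof -
  have "norm (x - dcorner k m) \<le> (\<Sum>b\<in>Basis. \<bar>(x - dcorner k m) \<bullet> b\<bar>)" by (rule norm_le_l1)
  also have "\<dots> \<le> (\<Sum>b\<in>(Basis::'a set). 2 powr k)"
    using assms by (intro sum_mono) (auto simp: dcube_def inner_diff_left distrib_left abs_le_iff)
  finally show ?thesis by (simp add: dist_norm norm_minus_commute)
qed

lemma nn_integral_lebesgue: "(\<integral>\<^sup>+x. h x \<partial>lebesgue) = (\<integral>\<^sup>+x. h x \<partial>lborel)"
  by (rule nn_integral_completion)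

definition morrey_term :: "real \<Rightarrow> real \<Rightarrow> ('a::euclidean_space \<Rightarrow> ennreal) \<Rightarrow> int \<Rightarrow> ('a \<Rightarrow> int) \<Rightarrow> ennreal" where
  "morrey_term p q h k m = ennreal (((2 powr k) powr DIM('a)) powr (1 / p)) *
      epow (ennreal (1 / (2 powr k) powr DIM('a)) * (\<integral>\<^sup>+x\<in>dcube k m. epow (h x) q \<partial>lborel)) (1 / q)"

lemma morrey_eq_SUP: "morrey p q h = (SUP (k, m) \<in> UNIV. morrey_term p q h k m)"
proof -
  have eq: "(dyadic_cubes :: 'a set set) = (\<lambda>(k, m). dcube k m) ` UNIV"
    by (auto simp: dyadic_cubes_eq)
  show ?thesis unfolding morrey_def eq image_image
    by (simp add: morrey_term_def measure_dcube nn_integral_lebesgue case_prod_beta')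
qed

lemma morrey_term_le: "morrey_term p q h k m \<le> morrey p q h"
  unfolding morrey_eq_SUP by (rule SUP_upper2[of "(k, m)"]) auto

lemma morrey_le:
  assumes "\<And>k m. morrey_term p q h k m \<le> B"
  shows "morrey p q h \<le> B"
  unfolding morrey_eq_SUP by (rule SUP_least) (auto simp: assms)

lemma morrey_cong_AE:
  assumes "AE x in lborel. h x = h' x"
  shows "morrey p q h = morrey p q h'"
proof -
  have "(\<integral>\<^sup>+x\<in>dcube k m. epow (h x) q \<partial>lborel) = (\<integral>\<^sup>+x\<in>dcube k m. epow (h' x) q \<partial>lborel)" for k m
    using assms by (intro nn_integral_cong_AE) auto
  then show ?thesis by (simp add: morrey_eq_SUP morrey_term_def)
qed

text \<open>The Morrey term of the cube, solved for its integral: the powers of the side length in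
  the normalisation cancel against the prefactor.\<close>

lemma dcube_integral_le_morrey:
  fixes h :: "'a::euclidean_space \<Rightarrow> ennreal"
  assumes q: "0 < q"
  shows "(\<integral>\<^sup>+x\<in>dcube k m. epow (h x) q \<partial>lborel)
     \<le> epow (ennreal ((2 powr k) powr (DIM('a) / q - DIM('a) / p)) * morrey p q h) q"
proof -
  define n where "n = real DIM('a)"
  define l where "l = 2 powr real_of_int k"
  have l: "l > 0" by (simp add: l_def)
  define I where "I = (\<integral>\<^sup>+x\<in>dcube k m. epow (h x) q \<partial>lborel)"
  have "I = epow (ennreal (l powr (n / q - n / p)) * morrey_term p q h k m) q"
  proof -
    have "ennreal (l powr (n / q - n / p)) * morrey_term p q h k m
      = ennreal (l powr (n / q - n / p) * (l powr n) powr (1 / p) * (1 / l powr n) powr (1 / q)) * epow I (1 / q)"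
      using l by (simp add: morrey_term_def I_def l_def n_def epow_mult epow_ennreal ennreal_mult mult.assoc)
    also have "l powr (n / q - n / p) * (l powr n) powr (1 / p) * (1 / l powr n) powr (1 / q) = 1"
      using l by (simp add: powr_diff powr_powr powr_divide)
    finally show ?thesis using q by simp
  qed
  also have "\<dots> \<le> epow (ennreal (l powr (n / q - n / p)) * morrey p q h) q"
    using q by (intro epow_mono mult_left_mono morrey_term_le) auto
  finally show ?thesis by (simp add: I_def l_def n_def)
qed

text \<open>Scale and translation invariance: the index of a cube meeting the ball differs from that
  of the centre's cube by less than R + 1 in each coordinate, the extra 1 coming from the two
  floors. The number of cubes depends only on R and n.\<close>

lemma ball_covered_by_dcubes:
  fixes R :: real
  assumes R: "0 \<le> R"
  shows "\<exists>N::nat. \<forall>(c::'a::euclidean_space) (k::int). \<exists>S. finite S \<and> card S \<le> N \<and> ball c (R * 2 powr k) \<subseteq> (\<Union>m\<in>S. dcube k m)"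
proof -
  define r where "r = \<lceil>R\<rceil> + 1"
  have r: "R + 1 \<le> r" "r \<ge> 0" using R unfolding r_def by linarith+
  show ?thesis
  proof (intro exI[of _ "nat (2 * r + 1) ^ DIM('a)"] allI)
    fix c :: 'a and k :: int
    define l where "l = 2 powr real_of_int k"
    have l: "l > 0" by (simp add: l_def)
    define ci where "ci i = \<lfloor>(c \<bullet> i) / l\<rfloor>" for i
    define S where "S = (Basis :: 'a set) \<rightarrow>\<^sub>E {- r..r}"
    define T where "T = (\<lambda>m i. ci i + m i) ` S"
    have "finite S" unfolding S_def by (intro finite_PiE) auto
    moreover have "card S = nat (2 * r + 1) ^ DIM('a)"
      unfolding S_def by (subst card_PiE) auto
    ultimately have T: "finite T" "card T \<le> nat (2 * r + 1) ^ DIM('a)"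
      unfolding T_def using card_image_le[of S "\<lambda>m i. ci i + m i"] by auto
    have "ball c (R * 2 powr k) \<subseteq> (\<Union>m\<in>T. dcube k m)"
    proof
      fix x assume x: "x \<in> ball c (R * 2 powr k)"
      define xi where "xi i = \<lfloor>(x \<bullet> i) / l\<rfloor>" for i
      \<comment> \<open>Index functions are arbitrary off \<open>Basis\<close>; restricting the
        offset places it in the finite set of extensional functions, and \<open>dcube\<close> only
        reads values on \<open>Basis\<close>.\<close>
      define m where "m = restrict (\<lambda>i. xi i - ci i) Basis"
      have "m i \<in> {- r..r}" if i: "i \<in> Basis" for i
      proof -
        have "\<bar>(x - c) \<bullet> i\<bar> \<le> norm (x - c)" by (rule Basis_le_norm[OF i])
        also have "\<dots> < R * l" using x by (simp add: dist_norm norm_minus_commute l_def)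
        finally have "\<bar>(x \<bullet> i) / l - (c \<bullet> i) / l\<bar> < R"
          using l by (simp add: inner_diff_left diff_divide_distrib[symmetric] field_simps)
        then have "\<bar>real_of_int (xi i) - real_of_int (ci i)\<bar> < R + 1"
          unfolding xi_def ci_def by linarith
        then have "\<bar>real_of_int (xi i - ci i)\<bar> < r" using r by simp
        then have "\<bar>xi i - ci i\<bar> < r" by linarith
        then show ?thesis using i by (auto simp: m_def)
      qed
      then have "m \<in> S" by (auto simp: S_def m_def)
      moreover have "x \<in> dcube k (\<lambda>i. ci i + m i)"
        unfolding dcube_def
      proof (intro CollectI ballI)
        fix i :: 'a assume i: "i \<in> Basis"
        have e: "ci i + m i = xi i" using i by (simp add: m_def)
        have "xi i \<le> (x \<bullet> i) / l" "(x \<bullet> i) / l < xi i + 1" unfolding xi_def by linarith+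
        then show "2 powr k * real_of_int (ci i + m i) \<le> x \<bullet> i \<and> x \<bullet> i < 2 powr k * (real_of_int (ci i + m i) + 1)"
          using l unfolding e l_def by (simp add: field_simps)
      qed
      ultimately show "x \<in> (\<Union>m\<in>T. dcube k m)" by (auto simp: T_def)
    qed
    then show "\<exists>S. finite S \<and> card S \<le> nat (2 * r + 1) ^ DIM('a) \<and> ball c (R * 2 powr k) \<subseteq> (\<Union>m\<in>S. dcube k m)"
      using T by blast
  qed
qed

text \<open>Balls, not cubes, arise from the shells around Q. For fixed R a ball of radius R 2^k
  meets boundedly many cubes of its own scale, so the Morrey norm controls it with the same power of
  2^k.\<close>

lemma ball_integral_le_morrey:
  fixes p q R :: real
  assumes q: "0 < q" and R: "0 \<le> R"
  shows "\<exists>C\<ge>0. \<forall>(h::'a::euclidean_space \<Rightarrow> ennreal) c (k::int). h \<in> borel_measurable borel \<longrightarrow>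
    epow (\<integral>\<^sup>+x\<in>ball c (R * 2 powr k). epow (h x) q \<partial>lborel) (1 / q)
      \<le> ennreal (C * (2 powr k) powr (DIM('a) / q - DIM('a) / p)) * morrey p q h"
proof -
  obtain N :: nat where N: "\<And>(c::'a) (k::int). \<exists>S. finite S \<and> card S \<le> N \<and> ball c (R * 2 powr k) \<subseteq> (\<Union>m\<in>S. dcube k m)"
    using ball_covered_by_dcubes[OF R] by metis
  show ?thesis
  proof (intro exI[of _ "real N powr (1 / q)"] conjI allI impI)
    fix h :: "'a \<Rightarrow> ennreal" and c :: 'a and k :: int
    assume [measurable]: "h \<in> borel_measurable borel"
    obtain S where S: "finite S" "card S \<le> N" "ball c (R * 2 powr k) \<subseteq> (\<Union>m\<in>S. dcube k m)"
      using N by blast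
    define D where "D = ennreal ((2 powr k) powr (DIM('a) / q - DIM('a) / p)) * morrey p q h"
    have "(\<integral>\<^sup>+x\<in>ball c (R * 2 powr k). epow (h x) q \<partial>lborel)
       \<le> (\<integral>\<^sup>+x. (\<Sum>m\<in>S. epow (h x) q * indicator (dcube k m) x) \<partial>lborel)"
    proof (rule nn_integral_mono)
      fix x
      show "epow (h x) q * indicator (ball c (R * 2 powr k)) x \<le> (\<Sum>m\<in>S. epow (h x) q * indicator (dcube k m) x)"
      proof (cases "x \<in> ball c (R * 2 powr k)")
        case True
        then obtain m where m: "m \<in> S" "x \<in> dcube k m" using S by auto
        then show ?thesis
          using S member_le_sum[of m S "\<lambda>m. epow (h x) q * indicator (dcube k m) x"] True by simp
      qed simp
    qed
    also have "\<dots> = (\<Sum>m\<in>S. \<integral>\<^sup>+x\<in>dcube k m. epow (h x) q \<partial>lborel)"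
      by (rule nn_integral_sum) auto
    also have "\<dots> \<le> (\<Sum>m\<in>S. epow D q)"
      unfolding D_def by (intro sum_mono dcube_integral_le_morrey q)
    also have "\<dots> \<le> ennreal (real N) * epow D q"
      using S by (simp add: ennreal_of_nat_eq_real_of_nat mult_right_mono)
    finally have "epow (\<integral>\<^sup>+x\<in>ball c (R * 2 powr k). epow (h x) q \<partial>lborel) (1 / q)
        \<le> epow (ennreal (real N) * epow D q) (1 / q)"
      using q by (intro epow_mono) auto
    also have "\<dots> = ennreal (real N powr (1 / q)) * D"
      using q by (simp add: epow_mult epow_ennreal)
    finally show "epow (\<integral>\<^sup>+x\<in>ball c (R * 2 powr k). epow (h x) q \<partial>lborel) (1 / q)
      \<le> ennreal (real N powr (1 / q) * (2 powr k) powr (DIM('a) / q - DIM('a) / p)) * morrey p q h"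
      by (simp add: D_def ennreal_mult mult.assoc)
  qed simp
qed

section \<open>Independence of the operator from null sets\<close>

lemma AE_lborel_affine:
  fixes w :: "'a::euclidean_space"
  assumes P: "AE x in lborel. P x" and c: "c \<noteq> 0"
  shows "AE y in lborel. P (w + c *\<^sub>R y)"
proof -
  obtain N where N: "{x. \<not> P x} \<subseteq> N" "N \<in> null_sets lborel"
    using P unfolding eventually_ae_filter by auto
  have [measurable]: "N \<in> sets borel" using N by auto
  have "0 = (\<integral>\<^sup>+x. indicator N x \<partial>lborel)" using N by auto
  also have "\<dots> = ennreal (\<bar>c\<bar> ^ DIM('a)) * (\<integral>\<^sup>+y. indicator N (w + c *\<^sub>R y) \<partial>lborel)"
    by (rule nn_integral_lborel_affine[OF _ c]) measurable
  finally have "(\<integral>\<^sup>+y. indicator N (w + c *\<^sub>R y) \<partial>lborel) = 0" using c by simp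
  then have "AE y in lborel. indicator N (w + c *\<^sub>R y) = (0::ennreal)"
    by (subst (asm) nn_integral_0_iff_AE) auto
  then show ?thesis
    by (rule AE_mp) (rule AE_I2, use N(1) in \<open>auto simp: indicator_def split: if_splits\<close>)
qed

text \<open>The equality holds at every x, not just almost everywhere: for fixed x the maps from y
  to x - y and to x + y pull null sets back to null sets. This makes Borel representatives of f and
  g harmless.\<close>

lemma BT_eq_BT_kernel:
  fixes f g :: "'a::euclidean_space \<Rightarrow> real"
  assumes nn: "\<And>x. 0 \<le> f x" "\<And>x. 0 \<le> g x"
    and f: "AE x in lborel. ennreal (f x) = f' x" and g: "AE x in lborel. ennreal (g x) = g' x"
  shows "BT \<alpha> f g x = BT_kernel \<alpha> f' g' x"
  unfolding BT_def BT_kernel_def nn_integral_lebesgue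
proof (rule nn_integral_cong_AE)
  have "AE y in lborel. ennreal (f (x + (- 1) *\<^sub>R y)) = f' (x + (- 1) *\<^sub>R y)"
    "AE y in lborel. ennreal (g (x + 1 *\<^sub>R y)) = g' (x + 1 *\<^sub>R y)"
    by (rule AE_lborel_affine[OF f] AE_lborel_affine[OF g], simp)+
  then show "AE y in lborel. ennreal (f (x - y) * g (x + y) / norm y powr \<alpha>) = f' (x - y) * g' (x + y) * ennreal (norm y powr - \<alpha>)"
  proof eventually_elim
    case (elim y)
    then show ?case
      using nn by (simp add: divide_inverse powr_minus ennreal_mult flip: elim)
  qed
qed

section \<open>The weighted bound on Morrey spaces\<close>

text \<open>Three losses are combined: the Lebesgue bound with target exponent \<tau>, Hoelder on
  the cube from \<tau> down to t at the price of |Q|^(1 - t/\<tau>), and the Morrey growth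
  \<open>lam\<close> of the norms over the ball. The scale k' of the ball is independent of the
  scale k of the cube because it will run through all k + j.\<close>

lemma BT_kernel_local_bound:
  fixes q1 q2 p1 p2 t \<tau> \<alpha> \<beta> \<gamma>1 \<gamma>2 \<epsilon> R :: real
  defines "lam \<equiv> (DIM('a) / q1 - DIM('a) / p1) + (DIM('a) / q2 - DIM('a) / p2)"
  assumes q1: "1 < q1" and q2: "1 < q2" and \<tau>: "0 < \<tau>" "\<tau> < 1" and e: "0 < \<epsilon>"
    and teq: "1 / \<tau> = 1 / q1 + 1 / q2 - \<epsilon> / DIM('a)"
    and b: "\<beta> < DIM('a) * (1 / \<tau> - 1)"
    and g1: "\<gamma>1 < DIM('a) * (1 - 1 / q1)" and g2: "\<gamma>2 < DIM('a) * (1 - 1 / q2)"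
    and d: "0 \<le> \<beta> + \<gamma>1 + \<gamma>2" and al: "\<alpha> = DIM('a) - (\<beta> + \<gamma>1 + \<gamma>2) - \<epsilon>"
    and t: "0 < t" "t \<le> \<tau>" and R: "0 \<le> R"
  shows "\<exists>C\<ge>0. \<forall>(f::'a::euclidean_space \<Rightarrow> ennreal) g c (k::int) m (k'::int).
    f \<in> borel_measurable borel \<longrightarrow> g \<in> borel_measurable borel \<longrightarrow>
    (\<integral>\<^sup>+x\<in>dcube k m. epow (BT_kernel \<alpha> (\<lambda>x. f x * indicator (ball c (R * 2 powr k')) x)
        (\<lambda>x. g x * indicator (ball c (R * 2 powr k')) x) x * ennreal (norm x powr (- \<beta>))) t \<partial>lborel)
      \<le> ennreal (C * ((2 powr k) powr DIM('a)) powr (1 - t / \<tau>) * ((2 powr k') powr lam) powr t)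
       * epow (morrey p1 q1 (\<lambda>x. f x * ennreal (norm x powr \<gamma>1)) * morrey p2 q2 (\<lambda>x. g x * ennreal (norm x powr \<gamma>2))) t"
proof -
  obtain CA where CA: "CA \<ge> 0" and partA: "\<And>(f::'a \<Rightarrow> ennreal) g.
    f \<in> borel_measurable borel \<Longrightarrow> g \<in> borel_measurable borel \<Longrightarrow>
    (\<integral>\<^sup>+x. epow (BT_kernel \<alpha> f g x * ennreal (norm x powr (- \<beta>))) \<tau> \<partial>lborel)
      \<le> ennreal CA * (epow (\<integral>\<^sup>+x. epow (f x * ennreal (norm x powr \<gamma>1)) q1 \<partial>lborel) (\<tau> / q1)
         * epow (\<integral>\<^sup>+x. epow (g x * ennreal (norm x powr \<gamma>2)) q2 \<partial>lborel) (\<tau> / q2))"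
    using BT_kernel_weighted_Lebesgue_bound[OF q1 q2 \<tau> e teq b g1 g2 d al] by blast
  obtain C1 where C1: "C1 \<ge> 0" and ball1: "\<And>(h::'a \<Rightarrow> ennreal) c (k::int). h \<in> borel_measurable borel \<Longrightarrow>
    epow (\<integral>\<^sup>+x\<in>ball c (R * 2 powr k). epow (h x) q1 \<partial>lborel) (1 / q1)
      \<le> ennreal (C1 * (2 powr k) powr (DIM('a) / q1 - DIM('a) / p1)) * morrey p1 q1 h"
    using ball_integral_le_morrey[of q1 R p1] q1 R by auto
  obtain C2 where C2: "C2 \<ge> 0" and ball2: "\<And>(h::'a \<Rightarrow> ennreal) c (k::int). h \<in> borel_measurable borel \<Longrightarrow>
    epow (\<integral>\<^sup>+x\<in>ball c (R * 2 powr k). epow (h x) q2 \<partial>lborel) (1 / q2)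
      \<le> ennreal (C2 * (2 powr k) powr (DIM('a) / q2 - DIM('a) / p2)) * morrey p2 q2 h"
    using ball_integral_le_morrey[of q2 R p2] q2 R by auto
  define C where "C = CA powr (t / \<tau>) * (C1 * C2) powr t"
  show ?thesis
  proof (intro exI[of _ C] conjI allI impI)
    show "0 \<le> C" by (simp add: C_def)
    fix f g :: "'a \<Rightarrow> ennreal" and c :: 'a and k k' :: int and m :: "'a \<Rightarrow> int"
    assume [measurable]: "f \<in> borel_measurable borel" "g \<in> borel_measurable borel"
    define B where "B = ball c (R * 2 powr k')"
    define F where "F x = f x * ennreal (norm x powr \<gamma>1)" for x
    define G where "G x = g x * ennreal (norm x powr \<gamma>2)" for x
    have [measurable]: "F \<in> borel_measurable borel" "G \<in> borel_measurable borel"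
      unfolding F_def[abs_def] G_def[abs_def] by measurable
    have [measurable]: "(\<lambda>x. f x * indicator B x) \<in> borel_measurable borel" "(\<lambda>x. g x * indicator B x) \<in> borel_measurable borel"
      unfolding B_def by measurable
    define u where "u x = BT_kernel \<alpha> (\<lambda>x. f x * indicator B x) (\<lambda>x. g x * indicator B x) x * ennreal (norm x powr (- \<beta>))" for x
    have [measurable]: "u \<in> borel_measurable borel" unfolding u_def[abs_def] by measurable
    define S1 S2 where "S1 = (\<integral>\<^sup>+x\<in>B. epow (F x) q1 \<partial>lborel)" and "S2 = (\<integral>\<^sup>+x\<in>B. epow (G x) q2 \<partial>lborel)"
    define M1 M2 where "M1 = morrey p1 q1 F" and "M2 = morrey p2 q2 G"
    define V where "V = (2 powr real_of_int k) powr DIM('a)"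
    have V: "V > 0" by (simp add: V_def)
    define L where "L = 2 powr real_of_int k'"
    have L: "L > 0" by (simp add: L_def)
    have I: "(\<integral>\<^sup>+x. epow (u x) \<tau> \<partial>lborel) \<le> ennreal CA * (epow S1 (\<tau> / q1) * epow S2 (\<tau> / q2))"
    proof -
      have e1: "(\<integral>\<^sup>+x. epow ((f x * indicator B x) * ennreal (norm x powr \<gamma>1)) q1 \<partial>lborel) = S1"
        unfolding S1_def by (intro nn_integral_cong) (auto simp: indicator_def F_def)
      have e2: "(\<integral>\<^sup>+x. epow ((g x * indicator B x) * ennreal (norm x powr \<gamma>2)) q2 \<partial>lborel) = S2"
        unfolding S2_def by (intro nn_integral_cong) (auto simp: indicator_def G_def)
      show ?thesis
        using partA[of "\<lambda>x. f x * indicator B x" "\<lambda>x. g x * indicator B x"] unfolding e1 e2 u_def by simp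
    qed
    \<comment> \<open>Hoelder needs an exponent strictly below 1, so t = \<tau>, the case used for
      the near part, is treated apart.\<close>
    have H: "(\<integral>\<^sup>+x\<in>dcube k m. epow (u x) t \<partial>lborel) \<le> epow (\<integral>\<^sup>+x. epow (u x) \<tau> \<partial>lborel) (t / \<tau>) * ennreal (V powr (1 - t / \<tau>))"
    proof (cases "t = \<tau>")
      case True
      have "(\<integral>\<^sup>+x\<in>dcube k m. epow (u x) t \<partial>lborel) \<le> (\<integral>\<^sup>+x. epow (u x) \<tau> \<partial>lborel)"
        by (rule nn_integral_mono) (auto simp: indicator_def True)
      then show ?thesis using True \<tau> V by simp
    next
      case False
      then have th: "0 < t / \<tau>" "t / \<tau> < 1" using t \<tau> by auto
      have "(\<integral>\<^sup>+x\<in>dcube k m. epow (u x) t \<partial>lborel)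
        = (\<integral>\<^sup>+x. epow (epow (u x) \<tau>) (t / \<tau>) * epow (indicator (dcube k m) x) (1 - t / \<tau>) \<partial>lborel)"
        using \<tau> by (intro nn_integral_cong) (auto simp: indicator_def)
      also have "\<dots> \<le> epow (\<integral>\<^sup>+x. epow (u x) \<tau> \<partial>lborel) (t / \<tau>) * epow (\<integral>\<^sup>+x. indicator (dcube k m) x \<partial>lborel) (1 - t / \<tau>)"
        using th by (intro nn_integral_holder) auto
      also have "epow (\<integral>\<^sup>+x. indicator (dcube k m) x \<partial>lborel) (1 - t / \<tau>) = ennreal (V powr (1 - t / \<tau>))"
        by (simp add: emeasure_dcube V_def epow_ennreal)
      finally show ?thesis .
    qed
    have "(\<integral>\<^sup>+x\<in>dcube k m. epow (u x) t \<partial>lborel)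
      \<le> epow (ennreal CA * (epow S1 (\<tau> / q1) * epow S2 (\<tau> / q2))) (t / \<tau>) * ennreal (V powr (1 - t / \<tau>))"
      using t \<tau> by (intro order_trans[OF H] mult_right_mono epow_mono I) auto
    also have "epow (ennreal CA * (epow S1 (\<tau> / q1) * epow S2 (\<tau> / q2))) (t / \<tau>)
      = ennreal (CA powr (t / \<tau>)) * epow (epow S1 (1 / q1) * epow S2 (1 / q2)) t"
      using CA \<tau> by (simp add: epow_mult epow_ennreal mult.commute)
    also have "\<dots> * ennreal (V powr (1 - t / \<tau>)) \<le> ennreal (CA powr (t / \<tau>)) *
        epow ((ennreal (C1 * L powr (DIM('a) / q1 - DIM('a) / p1)) * M1) * (ennreal (C2 * L powr (DIM('a) / q2 - DIM('a) / p2)) * M2)) t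
        * ennreal (V powr (1 - t / \<tau>))"
      unfolding S1_def S2_def B_def L_def M1_def M2_def
      using t by (intro mult_right_mono mult_left_mono epow_mono mult_mono ball1 ball2) auto
    also have "(ennreal (C1 * L powr (DIM('a) / q1 - DIM('a) / p1)) * M1) * (ennreal (C2 * L powr (DIM('a) / q2 - DIM('a) / p2)) * M2)
       = ennreal (C1 * C2 * L powr lam) * (M1 * M2)"
      using C1 C2 by (simp add: lam_def powr_add ennreal_mult mult_ac)
    also have "ennreal (CA powr (t / \<tau>)) * epow (ennreal (C1 * C2 * L powr lam) * (M1 * M2)) t * ennreal (V powr (1 - t / \<tau>))
       = ennreal (C * V powr (1 - t / \<tau>) * (L powr lam) powr t) * epow (M1 * M2) t"
    proof -
      have "epow (ennreal (C1 * C2 * L powr lam) * (M1 * M2)) t = ennreal ((C1 * C2) powr t * (L powr lam) powr t) * epow (M1 * M2) t"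
        using C1 C2 by (subst epow_mult) (simp add: epow_ennreal powr_mult)
      then show ?thesis by (simp add: C_def ennreal_mult mult_ac)
    qed
    finally show "(\<integral>\<^sup>+x\<in>dcube k m. epow (BT_kernel \<alpha> (\<lambda>x. f x * indicator (ball c (R * 2 powr k')) x)
        (\<lambda>x. g x * indicator (ball c (R * 2 powr k')) x) x * ennreal (norm x powr (- \<beta>))) t \<partial>lborel)
      \<le> ennreal (C * ((2 powr k) powr DIM('a)) powr (1 - t / \<tau>) * ((2 powr k') powr lam) powr t)
       * epow (morrey p1 q1 (\<lambda>x. f x * ennreal (norm x powr \<gamma>1)) * morrey p2 q2 (\<lambda>x. g x * ennreal (norm x powr \<gamma>2))) t"
      unfolding u_def B_def V_def L_def M1_def M2_def F_def G_def .
  qed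
qed

text \<open>On the shell with |y| \<ge> 2^(j-1) l the surplus factor |y|^(\<alpha>' - \<alpha>) is
  at most its value at the inner radius, since \<alpha>' \<le> \<alpha>. Both arguments x - y and x
  + y stay within n l + 2^j l of the corner, hence the radius (n + 1) 2^j l. The term j = 0 is the
  near part and keeps \<alpha>.\<close>

lemma BT_kernel_le_annuli:
  fixes f g :: "'a::euclidean_space \<Rightarrow> ennreal" and \<alpha> \<alpha>' :: real and k :: int
  assumes [measurable]: "f \<in> borel_measurable borel" "g \<in> borel_measurable borel"
    and al: "\<alpha>' \<le> \<alpha>" and x: "dist c x \<le> DIM('a) * 2 powr k"
  shows "BT_kernel \<alpha> f g x \<le> (\<Sum>j. ennreal (if j = 0 then 1 else (2 powr (real_of_int k + real j - 1)) powr (\<alpha>' - \<alpha>))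
      * BT_kernel (if j = 0 then \<alpha> else \<alpha>')
          (\<lambda>x. f x * indicator (ball c ((real DIM('a) + 1) * 2 powr (k + int j))) x)
          (\<lambda>x. g x * indicator (ball c ((real DIM('a) + 1) * 2 powr (k + int j))) x) x)"
proof -
  define l where "l = 2 powr real_of_int k"
  have l: "l > 0" by (simp add: l_def)
  define cj where "cj j = (if j = 0 then 1 else (2 powr (real_of_int k + real j - 1)) powr (\<alpha>' - \<alpha>))" for j :: nat
  define aj where "aj j = (if j = 0 then \<alpha> else \<alpha>')" for j :: nat
  define B where "B j = ball c ((real DIM('a) + 1) * 2 powr (k + int j))" for j
  have [measurable]: "B j \<in> sets borel" for j by (simp add: B_def)
  define \<phi> where "\<phi> j y = ennreal (cj j) * ((f (x - y) * indicator (B j) (x - y)) * (g (x + y) * indicator (B j) (x + y)) * ennreal (norm y powr (- aj j)))" for j y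
  have [measurable]: "\<phi> j \<in> borel_measurable borel" for j
    unfolding \<phi>_def[abs_def] by measurable
  have inB: "x - y \<in> B j" "x + y \<in> B j" if "norm y < l * 2 ^ j" for y j
  proof -
    have e: "2 powr (k + int j) = l * 2 ^ j" by (simp add: l_def powr_add powr_realpow)
    have "dist c x \<le> DIM('a) * (l * 2 ^ j)"
      using x l by (intro order_trans[OF x]) (auto simp: l_def intro!: mult_left_mono)
    moreover have "dist c (x - y) \<le> dist c x + dist x (x - y)" "dist c (x + y) \<le> dist c x + dist x (x + y)"
      by (rule dist_triangle)+
    ultimately show "x - y \<in> B j" "x + y \<in> B j"
      using that unfolding B_def e by (auto simp: dist_norm distrib_right)
  qed
  have pt: "f (x - y) * g (x + y) * ennreal (norm y powr (- \<alpha>)) \<le> (\<Sum>j. \<phi> j y)" for y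
  proof -
    have "\<exists>j. f (x - y) * g (x + y) * ennreal (norm y powr (- \<alpha>)) \<le> \<phi> j y"
    proof (cases "norm y < l")
      case True
      then show ?thesis using inB[of y 0] by (intro exI[of _ 0]) (simp add: \<phi>_def cj_def aj_def)
    next
      case False
      define i where "i = \<lfloor>log 2 (norm y / l)\<rfloor>"
      have y: "norm y / l \<ge> 1" using False l by simp
      then have i: "i \<ge> 0" by (simp add: i_def)
      \<comment> \<open>The shift by one reserves index 0 for the near part, so shell j has inner
        radius 2^(j-1) l and outer radius 2^j l.\<close>
      define j where "j = Suc (nat i)"
      have "2 powr i \<le> norm y / l" "norm y / l < 2 powr (i + 1)"
        using two_powr_floor_log[of "norm y / l"] y unfolding i_def by auto
      then have "2 powr (real j - 1) \<le> norm y / l" "norm y / l < 2 powr real j"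
        using i by (simp_all add: j_def add.commute)
      then have j: "l * 2 powr (real j - 1) \<le> norm y" "norm y < l * 2 ^ j"
        using l by (simp_all add: field_simps powr_realpow)
      have e: "2 powr (real_of_int k + real j - 1) = l * 2 powr (real j - 1)"
        by (simp add: l_def powr_add[symmetric] algebra_simps)
      have "norm y powr (\<alpha>' - \<alpha>) \<le> (l * 2 powr (real j - 1)) powr (\<alpha>' - \<alpha>)"
        using j l al by (intro powr_mono2') auto
      then have "norm y powr (\<alpha>' - \<alpha>) * norm y powr (- \<alpha>') \<le> cj j * norm y powr (- \<alpha>')"
        unfolding cj_def e by (intro mult_right_mono) (simp_all add: j_def)
      then have "norm y powr (- \<alpha>) \<le> cj j * norm y powr (- aj j)"
        by (simp add: aj_def j_def powr_add[symmetric])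
      then have "ennreal (norm y powr (- \<alpha>)) \<le> ennreal (cj j) * ennreal (norm y powr (- aj j))"
        by (simp add: cj_def ennreal_mult[symmetric] ennreal_leI)
      then have "f (x - y) * g (x + y) * ennreal (norm y powr (- \<alpha>)) \<le> f (x - y) * g (x + y) * (ennreal (cj j) * ennreal (norm y powr (- aj j)))"
        by (rule mult_left_mono) simp
      also have "\<dots> = \<phi> j y" using inB[OF j(2)] by (simp add: \<phi>_def mult_ac)
      finally show ?thesis by blast
    qed
    then obtain j where "f (x - y) * g (x + y) * ennreal (norm y powr (- \<alpha>)) \<le> \<phi> j y" by blast
    then show ?thesis by (rule order_trans) (rule ennreal_le_suminf)
  qed
  have "BT_kernel \<alpha> f g x \<le> (\<integral>\<^sup>+y. (\<Sum>j. \<phi> j y) \<partial>lborel)"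
    unfolding BT_kernel_def by (intro nn_integral_mono pt)
  also have "\<dots> = (\<Sum>j. \<integral>\<^sup>+y. \<phi> j y \<partial>lborel)"
    by (rule nn_integral_suminf) measurable
  also have "\<dots> = (\<Sum>j. ennreal (cj j) * BT_kernel (aj j) (\<lambda>x. f x * indicator (B j) x) (\<lambda>x. g x * indicator (B j) x) x)"
  proof (rule suminf_cong)
    fix j
    show "(\<integral>\<^sup>+y. \<phi> j y \<partial>lborel) = ennreal (cj j) * BT_kernel (aj j) (\<lambda>x. f x * indicator (B j) x) (\<lambda>x. g x * indicator (B j) x) x"
      unfolding \<phi>_def BT_kernel_def by (rule nn_integral_cmult) measurable
  qed
  finally show ?thesis unfolding cj_def aj_def B_def .
qed

text \<open>Each shell is estimated on the cube by the local bound, with \<alpha> for the near part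
  and \<alpha>' for the others. Subadditivity of the t-th power permits adding the shells, and the
  resulting geometric series is independent of the cube.\<close>

lemma BT_kernel_morrey_bound:
  fixes p1 p2 q1 q2 s t \<alpha> \<beta> \<gamma>1 \<gamma>2 \<epsilon> :: real
  assumes q1: "1 < q1" "q1 \<le> p1" and q2: "1 < q2" "q2 \<le> p2" and t: "0 < t" "t \<le> s" and s: "s < 1" and e: "0 < \<epsilon>"
    and seq: "1 / s = 1 / p1 + 1 / p2 - \<epsilon> / DIM('a)"
    and teq: "1 / t = 1 / q1 + 1 / q2 - \<epsilon> / DIM('a)"
    and b: "\<beta> < DIM('a) * (1 / s - 1)"
    and g1: "\<gamma>1 < DIM('a) * (1 - 1 / q1)" and g2: "\<gamma>2 < DIM('a) * (1 - 1 / q2)"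
    and d: "0 \<le> \<beta> + \<gamma>1 + \<gamma>2" and al: "\<alpha> = DIM('a) - (\<beta> + \<gamma>1 + \<gamma>2) - \<epsilon>"
  shows "\<exists>C\<ge>0. \<forall>(f::'a::euclidean_space \<Rightarrow> ennreal) g.
    f \<in> borel_measurable borel \<longrightarrow> g \<in> borel_measurable borel \<longrightarrow>
    morrey s t (\<lambda>x. BT_kernel \<alpha> f g x * ennreal (norm x powr (- \<beta>)))
      \<le> ennreal C * (morrey p1 q1 (\<lambda>x. f x * ennreal (norm x powr \<gamma>1)) * morrey p2 q2 (\<lambda>x. g x * ennreal (norm x powr \<gamma>2)))"
proof -
  define n where "n = real DIM('a)"
  have n: "n > 0" by (simp add: n_def)
  have s0: "s > 0" using t by simp
  define lam where "lam = (n / q1 - n / p1) + (n / q2 - n / p2)"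
  have "n / p1 \<le> n / q1" "n / p2 \<le> n / q2" using q1 q2 n by (auto intro!: divide_left_mono)
  then have lam0: "lam \<ge> 0" by (simp add: lam_def)
  have ns: "n / s = n / p1 + n / p2 - \<epsilon>"
    using arg_cong[OF seq, of "\<lambda>x. n * x"] n by (simp add: n_def algebra_simps)
  have nt: "n / t = n / q1 + n / q2 - \<epsilon>"
    using arg_cong[OF teq, of "\<lambda>x. n * x"] n by (simp add: n_def algebra_simps)
  have lst: "n / s - n / t = - lam" by (simp add: ns nt lam_def)
  have bs: "\<beta> < n / s - n" using b by (simp add: n_def algebra_simps)
  have sn: "n < n / s" using s s0 n by (simp add: field_simps)
  \<comment> \<open>Because n/s = n/q1 + n/q2 - \<epsilon> - lam, this says n/s > n + max \<beta> 0,
    which is s < 1 together with the bound on \<beta>. It opens the window for \<epsilon>': the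
    lower end makes the shells summable, the upper end keeps \<tau> < 1 and \<beta> < n (1/\<tau> -
    1).\<close>
  have "\<epsilon> + lam < n / q1 + n / q2 - n - max \<beta> 0"
    using bs sn ns by (simp add: lam_def max_def)
  then obtain \<epsilon>' where e': "\<epsilon> + lam < \<epsilon>'" "\<epsilon>' < n / q1 + n / q2 - n - max \<beta> 0"
    using dense by blast
  \<comment> \<open>The weights are unchanged; \<alpha>' and \<tau> are what the homogeneity
    relations of the Lebesgue bound dictate when \<epsilon> becomes \<epsilon>'.\<close>
  define \<alpha>' where "\<alpha>' = n - (\<beta> + \<gamma>1 + \<gamma>2) - \<epsilon>'"
  define \<tau> where "\<tau> = n / (n / q1 + n / q2 - \<epsilon>')"
  have den: "n / q1 + n / q2 - \<epsilon>' > n" using e' by linarith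
  have \<tau>: "0 < \<tau>" "\<tau> < 1" using den n by (auto simp: \<tau>_def)
  have ntau: "n / \<tau> = n / q1 + n / q2 - \<epsilon>'" using n den by (simp add: \<tau>_def)
  have tau: "1 / \<tau> = 1 / q1 + 1 / q2 - \<epsilon>' / n"
    using arg_cong[OF ntau, of "\<lambda>x. x / n"] n by (simp add: diff_divide_distrib add_divide_distrib)
  have "n / \<tau> \<le> n / t" using e' lam0 by (simp add: ntau nt)
  then have ttau: "t \<le> \<tau>" using n t \<tau> by (simp add: divide_le_cancel frac_le_eq field_simps)
  have btau: "\<beta> < n * (1 / \<tau> - 1)" using e' ntau by (simp add: algebra_simps)
  have bt: "\<beta> < n * (1 / t - 1)" using bs lst lam0 by (simp add: algebra_simps)
  have t1: "t < 1" using t s by simp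
  have R: "0 \<le> n + 1" using n by simp
  \<comment> \<open>The net exponent per shell: kernel gain \<alpha>' - \<alpha> = \<epsilon> -
    \<epsilon>' plus Morrey growth \<open>lam\<close>. It is negative by the lower end of the window
    for \<epsilon>'.\<close>
  define \<sigma> where "\<sigma> = \<alpha>' - \<alpha> + lam"
  have sig: "\<sigma> < 0" using e' al by (simp add: \<sigma>_def \<alpha>'_def n_def)
  have aa: "\<alpha>' \<le> \<alpha>" using sig lam0 by (simp add: \<sigma>_def)
  obtain C0 where C0: "C0 \<ge> 0" and loc0: "\<And>(f::'a \<Rightarrow> ennreal) g c (k::int) m (k'::int).
    f \<in> borel_measurable borel \<Longrightarrow> g \<in> borel_measurable borel \<Longrightarrow>
    (\<integral>\<^sup>+x\<in>dcube k m. epow (BT_kernel \<alpha> (\<lambda>x. f x * indicator (ball c ((n + 1) * 2 powr k')) x)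
        (\<lambda>x. g x * indicator (ball c ((n + 1) * 2 powr k')) x) x * ennreal (norm x powr (- \<beta>))) t \<partial>lborel)
      \<le> ennreal (C0 * ((2 powr k) powr n) powr (1 - t / t) * ((2 powr k') powr lam) powr t)
       * epow (morrey p1 q1 (\<lambda>x. f x * ennreal (norm x powr \<gamma>1)) * morrey p2 q2 (\<lambda>x. g x * ennreal (norm x powr \<gamma>2))) t"
    using BT_kernel_local_bound[OF q1(1) q2(1) t(1) t1 e teq bt[unfolded n_def] g1 g2 d al t(1) order_refl, of "n + 1" p1 p2] R
    unfolding lam_def n_def by blast
  obtain C1 where C1: "C1 \<ge> 0" and loc1: "\<And>(f::'a \<Rightarrow> ennreal) g c (k::int) m (k'::int).
    f \<in> borel_measurable borel \<Longrightarrow> g \<in> borel_measurable borel \<Longrightarrow>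
    (\<integral>\<^sup>+x\<in>dcube k m. epow (BT_kernel \<alpha>' (\<lambda>x. f x * indicator (ball c ((n + 1) * 2 powr k')) x)
        (\<lambda>x. g x * indicator (ball c ((n + 1) * 2 powr k')) x) x * ennreal (norm x powr (- \<beta>))) t \<partial>lborel)
      \<le> ennreal (C1 * ((2 powr k) powr n) powr (1 - t / \<tau>) * ((2 powr k') powr lam) powr t)
       * epow (morrey p1 q1 (\<lambda>x. f x * ennreal (norm x powr \<gamma>1)) * morrey p2 q2 (\<lambda>x. g x * ennreal (norm x powr \<gamma>2))) t"
    using BT_kernel_local_bound[OF q1(1) q2(1) \<tau> _ tau[unfolded n_def] btau[unfolded n_def] g1 g2 d \<alpha>'_def[unfolded n_def] t(1) ttau, of "n + 1" p1 p2] R e e' lam0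
    unfolding lam_def n_def by fastforce
  define r where "r = 2 powr (\<sigma> * t)"
  have r: "0 \<le> r" "r < 1" using sig t by (auto simp: r_def mult_neg_pos powr_less_one)
  \<comment> \<open>One constant for both kinds of terms; the power of 2 pays for the inner radius
    2^(j-1) l in place of 2^j l.\<close>
  define E where "E = C0 + C1 * 2 powr ((\<alpha> - \<alpha>') * t)"
  have E: "E \<ge> 0" using C0 C1 by (simp add: E_def)
  define D where "D = E * (1 / (1 - r))"
  have D: "D \<ge> 0" using E r by (simp add: D_def)
  show ?thesis
  proof (intro exI[of _ "D powr (1 / t)"] conjI allI impI)
    fix f g :: "'a \<Rightarrow> ennreal"
    assume [measurable]: "f \<in> borel_measurable borel" "g \<in> borel_measurable borel"
    define M where "M = morrey p1 q1 (\<lambda>x. f x * ennreal (norm x powr \<gamma>1)) * morrey p2 q2 (\<lambda>x. g x * ennreal (norm x powr \<gamma>2))"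
    define w where "w x = ennreal (norm x powr (- \<beta>))" for x :: 'a
    have [measurable]: "w \<in> borel_measurable borel" unfolding w_def[abs_def] by measurable
    show "morrey s t (\<lambda>x. BT_kernel \<alpha> f g x * ennreal (norm x powr (- \<beta>))) \<le> ennreal (D powr (1 / t)) *
      (morrey p1 q1 (\<lambda>x. f x * ennreal (norm x powr \<gamma>1)) * morrey p2 q2 (\<lambda>x. g x * ennreal (norm x powr \<gamma>2)))"
      unfolding M_def[symmetric] w_def[symmetric]
    proof (rule morrey_le)
      fix k :: int and m :: "'a \<Rightarrow> int"
      define l where "l = 2 powr real_of_int k"
      have l: "l > 0" by (simp add: l_def)
      define c where "c = dcorner k m"
      define cj where "cj j = (if j = 0 then 1 else (2 powr (real_of_int k + real j - 1)) powr (\<alpha>' - \<alpha>))" for j :: nat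
      have cj: "cj j > 0" for j by (simp add: cj_def)
      define T where "T j = BT_kernel (if j = 0 then \<alpha> else \<alpha>')
          (\<lambda>x. f x * indicator (ball c ((n + 1) * 2 powr (k + int j))) x)
          (\<lambda>x. g x * indicator (ball c ((n + 1) * 2 powr (k + int j))) x)" for j :: nat
      have [measurable]: "T j \<in> borel_measurable borel" for j
        unfolding T_def by measurable
      have split: "BT_kernel \<alpha> f g x \<le> (\<Sum>j. ennreal (cj j) * T j x)" if "x \<in> dcube k m" for x
        unfolding cj_def T_def n_def c_def
        by (rule BT_kernel_le_annuli[OF _ _ aa dist_dcorner_le[OF that]]) measurable
      have tm: "(\<integral>\<^sup>+x. ennreal (cj j powr t) * (epow (T j x * w x) t * indicator (dcube k m) x) \<partial>lborel)
         \<le> ennreal (E * l powr (lam * t) * r ^ j) * epow M t" for j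
      proof -
        have kj: "2 powr (k + int j) = l * 2 powr real j" by (simp add: l_def powr_add)
        have rj: "r ^ j = 2 powr (real j * (\<sigma> * t))"
          unfolding r_def by (simp add: powr_realpow[symmetric] powr_powr mult_ac)
        show ?thesis
        proof (cases "j = 0")
          case True
          have "(\<integral>\<^sup>+x. ennreal (cj j powr t) * (epow (T j x * w x) t * indicator (dcube k m) x) \<partial>lborel)
            \<le> ennreal (C0 * ((2 powr k) powr n) powr (1 - t / t) * ((2 powr (k + int j)) powr lam) powr t) * epow M t"
            using loc0[where f = f and g = g and k = k and m = m and c = c and k' = "k + int j"] True unfolding M_def by (simp add: cj_def T_def w_def)
          also have "C0 * ((2 powr k) powr n) powr (1 - t / t) * ((2 powr (k + int j)) powr lam) powr t = C0 * l powr (lam * t)"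
            using t True by (simp add: l_def powr_powr mult.assoc)
          also have "ennreal (C0 * l powr (lam * t)) * epow M t \<le> ennreal (E * l powr (lam * t) * r ^ j) * epow M t"
            using True C1 by (intro mult_right_mono ennreal_leI) (simp_all add: E_def mult_right_mono)
          finally show ?thesis .
        next
          case False
          \<comment> \<open>The loss from lowering \<tau> to t on the cube is l^((\<alpha> -
            \<alpha>') t), exactly the inverse of the power of l in \<open>cj j powr t\<close>. Only
            l^(lam t) r^j survives.\<close>
          have V: "((2 powr k) powr n) powr (1 - t / \<tau>) = l powr ((\<alpha> - \<alpha>') * t)"
          proof -
            have "n * (1 - t / \<tau>) = t * (n / t - n / \<tau>)" using t by (simp add: field_simps)
            also have "\<dots> = (\<alpha> - \<alpha>') * t" by (simp add: nt ntau \<alpha>'_def al n_def[symmetric])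
            finally show ?thesis by (simp add: l_def powr_powr mult.assoc)
          qed
          have c2: "cj j powr t = 2 powr ((\<alpha> - \<alpha>') * t) * (l powr ((\<alpha>' - \<alpha>) * t) * 2 powr (real j * ((\<alpha>' - \<alpha>) * t)))"
            using False unfolding cj_def l_def powr_powr
            by (simp add: powr_powr powr_add[symmetric] algebra_simps)
          have e2: "((2 powr (k + int j)) powr lam) powr t = l powr (lam * t) * 2 powr (real j * (lam * t))"
            unfolding kj using l by (simp add: powr_mult powr_powr mult.assoc)
          have eq: "cj j powr t * (C1 * ((2 powr k) powr n) powr (1 - t / \<tau>) * ((2 powr (k + int j)) powr lam) powr t)
            = C1 * 2 powr ((\<alpha> - \<alpha>') * t) * l powr (lam * t) * r ^ j"
          proof -
            have a: "l powr ((\<alpha> - \<alpha>') * t) * l powr ((\<alpha>' - \<alpha>) * t) = 1"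
              using l by (simp add: powr_add[symmetric] algebra_simps)
            have b: "2 powr (real j * ((\<alpha>' - \<alpha>) * t)) * 2 powr (real j * (lam * t)) = r ^ j"
              unfolding rj by (simp add: powr_add[symmetric] \<sigma>_def algebra_simps)
            have "cj j powr t * (C1 * ((2 powr k) powr n) powr (1 - t / \<tau>) * ((2 powr (k + int j)) powr lam) powr t)
              = C1 * 2 powr ((\<alpha> - \<alpha>') * t) * l powr (lam * t) * (l powr ((\<alpha> - \<alpha>') * t) * l powr ((\<alpha>' - \<alpha>) * t))
                * (2 powr (real j * ((\<alpha>' - \<alpha>) * t)) * 2 powr (real j * (lam * t)))"
              unfolding V c2 e2 by (simp only: mult_ac)
            then show ?thesis by (simp only: a b mult_1_right)
          qed
          have "(\<integral>\<^sup>+x. ennreal (cj j powr t) * (epow (T j x * w x) t * indicator (dcube k m) x) \<partial>lborel)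
            = ennreal (cj j powr t) * (\<integral>\<^sup>+x\<in>dcube k m. epow (T j x * w x) t \<partial>lborel)"
            by (rule nn_integral_cmult) measurable
          also have "\<dots> \<le> ennreal (cj j powr t) * (ennreal (C1 * ((2 powr k) powr n) powr (1 - t / \<tau>) * ((2 powr (k + int j)) powr lam) powr t) * epow M t)"
            using loc1[where f = f and g = g and k = k and m = m and c = c and k' = "k + int j"] False unfolding M_def
            by (intro mult_left_mono) (simp_all add: T_def w_def)
          also have "\<dots> = ennreal (C1 * 2 powr ((\<alpha> - \<alpha>') * t) * l powr (lam * t) * r ^ j) * epow M t"
            unfolding eq[symmetric] using C1 by (subst ennreal_mult) (simp_all add: mult.assoc)
          also have "\<dots> \<le> ennreal (E * l powr (lam * t) * r ^ j) * epow M t"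
            using C0 r by (intro mult_right_mono ennreal_leI) (simp_all add: E_def mult_right_mono)
          finally show ?thesis .
        qed
      qed
      have X: "(\<integral>\<^sup>+x\<in>dcube k m. epow (BT_kernel \<alpha> f g x * w x) t \<partial>lborel) \<le> ennreal (D * l powr (lam * t)) * epow M t"
      proof -
        have "(\<integral>\<^sup>+x\<in>dcube k m. epow (BT_kernel \<alpha> f g x * w x) t \<partial>lborel)
          \<le> (\<integral>\<^sup>+x. (\<Sum>j. ennreal (cj j powr t) * (epow (T j x * w x) t * indicator (dcube k m) x)) \<partial>lborel)"
        proof (rule nn_integral_mono)
          fix x
          show "epow (BT_kernel \<alpha> f g x * w x) t * indicator (dcube k m) x
            \<le> (\<Sum>j. ennreal (cj j powr t) * (epow (T j x * w x) t * indicator (dcube k m) x))"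
          proof (cases "x \<in> dcube k m")
            case True
            have "epow (BT_kernel \<alpha> f g x * w x) t \<le> epow ((\<Sum>j. ennreal (cj j) * T j x) * w x) t"
              using t by (intro epow_mono mult_right_mono split True) auto
            also have "(\<Sum>j. ennreal (cj j) * T j x) * w x = (\<Sum>j. ennreal (cj j) * T j x * w x)"
              by simp
            also have "epow \<dots> t \<le> (\<Sum>j. epow (ennreal (cj j) * T j x * w x) t)"
              using t t1 by (intro epow_suminf_le) auto
            also have "\<dots> = (\<Sum>j. ennreal (cj j powr t) * epow (T j x * w x) t)"
              using cj by (intro suminf_cong) (simp add: epow_mult epow_ennreal less_imp_le mult.assoc)
            finally show ?thesis using True by simp
          qed simp
        qed
        also have "\<dots> = (\<Sum>j. \<integral>\<^sup>+x. ennreal (cj j powr t) * (epow (T j x * w x) t * indicator (dcube k m) x) \<partial>lborel)"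
          by (rule nn_integral_suminf) measurable
        also have "\<dots> \<le> (\<Sum>j. ennreal (E * l powr (lam * t) * r ^ j) * epow M t)"
          by (intro suminf_le tm) auto
        also have "\<dots> = (\<Sum>j. ennreal (E * l powr (lam * t) * r ^ j)) * epow M t"
          by simp
        also have "(\<Sum>j. ennreal (E * l powr (lam * t) * r ^ j)) = ennreal (\<Sum>j. E * l powr (lam * t) * r ^ j)"
          using E r by (intro suminf_ennreal2 summable_mult summable_geometric) auto
        also have "(\<Sum>j. E * l powr (lam * t) * r ^ j) = D * l powr (lam * t)"
          using r by (subst suminf_mult) (auto simp: summable_geometric suminf_geometric D_def)
        finally show ?thesis .
      qed
      have "morrey_term s t (\<lambda>x. BT_kernel \<alpha> f g x * w x) k m
        \<le> ennreal ((l powr n) powr (1 / s)) * epow (ennreal (1 / l powr n) * (ennreal (D * l powr (lam * t)) * epow M t)) (1 / t)"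
        unfolding morrey_term_def l_def[symmetric] n_def[symmetric]
        using t by (intro mult_left_mono epow_mono X) auto
      also have "\<dots> = ennreal ((l powr n) powr (1 / s) * (1 / l powr n) powr (1 / t) * (D * l powr (lam * t)) powr (1 / t)) * M"
      proof -
        have root: "epow (ennreal u * (ennreal v * epow M t)) (1 / t) = ennreal (u powr (1 / t) * v powr (1 / t)) * M"
          if "0 \<le> u" "0 \<le> v" for u v
          using that t by (simp add: epow_mult epow_ennreal ennreal_mult mult.assoc)
        have nonneg: "0 \<le> 1 / l powr n" "0 \<le> D * l powr (lam * t)"
          using D by simp_all
        show ?thesis
          unfolding root[OF nonneg] by (simp add: mult.assoc[symmetric] ennreal_mult[symmetric])
      qed
      also have "(l powr n) powr (1 / s) * (1 / l powr n) powr (1 / t) * (D * l powr (lam * t)) powr (1 / t)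
        = D powr (1 / t) * l powr (n / s - n / t + lam)"
        using D t by (simp add: powr_mult powr_powr powr_divide powr_add powr_diff)
      \<comment> \<open>The side length disappears because n/s - n/t = - lam: this is the scale
        invariance of the Morrey estimate.\<close>
      also have "\<dots> = D powr (1 / t)" using l by (simp add: lst)
      finally show "morrey_term s t (\<lambda>x. BT_kernel \<alpha> f g x * w x) k m \<le> ennreal (D powr (1 / t)) * M" .
    qed
  qed simp
qed

section \<open>Reduction of the exponents and passage to Borel functions\<close>

theorem theorem6p1:
  fixes \<alpha> \<beta> \<gamma>1 \<gamma>2 p1 p2 q1 q2 s t a :: real and r :: ereal
  assumes "0 < \<alpha>" "\<alpha> < real DIM('a::euclidean_space)"
    and "1 < q1" "q1 \<le> p1"
    and "1 < q2" "q2 \<le> p2"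
    and "0 < t" "t \<le> s" "s < 1"
    and "ereal (real DIM('a) / (real DIM('a) - \<alpha>)) < r"
    and "1 < a" "a < min q1 q2"
    and "1 / s = 1 / p1 + 1 / p2 + real_of_ereal (1 / r) - (real DIM('a) - \<alpha>) / real DIM('a)"
    and "1 / t = 1 / q1 + 1 / q2 + real_of_ereal (1 / r) - (real DIM('a) - \<alpha>) / real DIM('a)"
    and "\<beta> < real DIM('a) * (1 / s - 1)"
    and "\<gamma>1 < real DIM('a) / (q1 / (q1 - 1))"
    and "\<gamma>2 < real DIM('a) / (q2 / (q2 - 1))"
    and "\<alpha> + \<beta> + \<gamma>1 + \<gamma>2 = real DIM('a) + real DIM('a) / t
           - real DIM('a) / q1 - real DIM('a) / q2"
    and "\<beta> + \<gamma>1 + \<gamma>2 \<ge> 0"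
  shows "\<exists>C::real. \<forall>(f::'a \<Rightarrow> real) (g::'a \<Rightarrow> real).
           f \<in> borel_measurable lebesgue \<longrightarrow> g \<in> borel_measurable lebesgue \<longrightarrow>
           (\<forall>x. 0 \<le> f x) \<longrightarrow> (\<forall>x. 0 \<le> g x) \<longrightarrow>
           morrey s t (\<lambda>x. BT \<alpha> f g x * ennreal (norm x powr (- \<beta>)))
             \<le> ennreal C * morrey p1 q1 (\<lambda>x. ennreal (f x * norm x powr \<gamma>1))
                         * morrey p2 q2 (\<lambda>x. ennreal (g x * norm x powr \<gamma>2))"
proof -
  define n where "n = real DIM('a)"
  have n: "n > 0" by (simp add: n_def)
  \<comment> \<open>For infinite r this is 0, so both ranges of r are covered by one real
    parameter.\<close>
  define \<rho> where "\<rho> = real_of_ereal (1 / r)"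
  define \<epsilon> where "\<epsilon> = n - \<alpha> - (\<beta> + \<gamma>1 + \<gamma>2)"
  have an: "0 < n - \<alpha>" using assms by (simp add: n_def)
  have "\<rho> < (n - \<alpha>) / n"
  proof (cases r)
    case (real u)
    then have "n / (n - \<alpha>) < u" using assms by (simp add: n_def)
    moreover from this have "0 < u" using n an by (smt (verit) divide_pos_pos)
    ultimately show ?thesis using n an real by (simp add: \<rho>_def field_simps one_ereal_def)
  next
    case PInf
    then show ?thesis using n an by (simp add: \<rho>_def)
  next
    case MInf
    then show ?thesis using assms by simp
  qed
  then have \<rho>: "n * \<rho> < n - \<alpha>" using n by (simp add: field_simps)
  have tq: "1 / t = 1 / q1 + 1 / q2 + \<rho> - (n - \<alpha>) / n" and sq: "1 / s = 1 / p1 + 1 / p2 + \<rho> - (n - \<alpha>) / n"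
    using assms by (simp_all add: \<rho>_def n_def)
  have "n / t = n / q1 + n / q2 + n * \<rho> - (n - \<alpha>)"
    using arg_cong[OF tq, of "\<lambda>x. n * x"] n by (simp add: right_diff_distrib distrib_left diff_divide_distrib)
  \<comment> \<open>Substituting n/t in the homogeneity condition cancels \<alpha>, n/q1 and n/q2.
    The lower bound on r then reads \<epsilon> > 0.\<close>
  then have "\<beta> + \<gamma>1 + \<gamma>2 = n * \<rho>" using assms by (simp add: n_def)
  then have en: "\<epsilon> / n = (n - \<alpha>) / n - \<rho>" and e: "\<epsilon> > 0"
    using n \<rho> by (simp_all add: \<epsilon>_def diff_divide_distrib)
  have g: "\<gamma>1 < DIM('a) * (1 - 1 / q1)" "\<gamma>2 < DIM('a) * (1 - 1 / q2)"
    using assms by (simp_all add: field_simps)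
  obtain C where C: "C \<ge> 0" and bound: "\<And>(f::'a \<Rightarrow> ennreal) g.
    f \<in> borel_measurable borel \<Longrightarrow> g \<in> borel_measurable borel \<Longrightarrow>
    morrey s t (\<lambda>x. BT_kernel \<alpha> f g x * ennreal (norm x powr (- \<beta>)))
      \<le> ennreal C * (morrey p1 q1 (\<lambda>x. f x * ennreal (norm x powr \<gamma>1)) * morrey p2 q2 (\<lambda>x. g x * ennreal (norm x powr \<gamma>2)))"
  proof -
    have "1 / s = 1 / p1 + 1 / p2 - \<epsilon> / DIM('a)" "1 / t = 1 / q1 + 1 / q2 - \<epsilon> / DIM('a)"
      using tq sq en by (simp_all add: n_def)
    moreover have "\<alpha> = DIM('a) - (\<beta> + \<gamma>1 + \<gamma>2) - \<epsilon>" by (simp add: \<epsilon>_def n_def)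
    ultimately show ?thesis
      using BT_kernel_morrey_bound[OF assms(3-9) e _ _ assms(15) g assms(19)] that by blast
  qed
  show ?thesis
  proof (intro exI[of _ C] allI impI)
    fix f g :: "'a \<Rightarrow> real"
    assume meas: "f \<in> borel_measurable lebesgue" "g \<in> borel_measurable lebesgue"
      and nn: "\<forall>x. 0 \<le> f x" "\<forall>x. 0 \<le> g x"
    \<comment> \<open>Fubini and the affine changes of variables above are used for Borel functions,
      so f and g are replaced by Borel functions that agree with them almost everywhere.\<close>
    have "(\<lambda>x. ennreal (f x)) \<in> borel_measurable lebesgue" "(\<lambda>x. ennreal (g x)) \<in> borel_measurable lebesgue"
      using meas by measurable
    then obtain f' g' where fg: "f' \<in> borel_measurable lborel" "g' \<in> borel_measurable lborel"
      "AE x in lborel. ennreal (f x) = f' x" "AE x in lborel. ennreal (g x) = g' x"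
      using completion_ex_borel_measurable by metis
    have "morrey s t (\<lambda>x. BT \<alpha> f g x * ennreal (norm x powr (- \<beta>)))
      = morrey s t (\<lambda>x. BT_kernel \<alpha> f' g' x * ennreal (norm x powr (- \<beta>)))"
      using nn fg by (simp add: BT_eq_BT_kernel[of f g f' g'])
    also have "\<dots> \<le> ennreal C * (morrey p1 q1 (\<lambda>x. f' x * ennreal (norm x powr \<gamma>1)) * morrey p2 q2 (\<lambda>x. g' x * ennreal (norm x powr \<gamma>2)))"
      using fg by (intro bound) auto
    also have "morrey p1 q1 (\<lambda>x. f' x * ennreal (norm x powr \<gamma>1)) = morrey p1 q1 (\<lambda>x. ennreal (f x * norm x powr \<gamma>1))"
      using fg(3) nn by (intro morrey_cong_AE) (auto simp: ennreal_mult)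
    also have "morrey p2 q2 (\<lambda>x. g' x * ennreal (norm x powr \<gamma>2)) = morrey p2 q2 (\<lambda>x. ennreal (g x * norm x powr \<gamma>2))"
      using fg(4) nn by (intro morrey_cong_AE) (auto simp: ennreal_mult)
    finally show "morrey s t (\<lambda>x. BT \<alpha> f g x * ennreal (norm x powr (- \<beta>)))
             \<le> ennreal C * morrey p1 q1 (\<lambda>x. ennreal (f x * norm x powr \<gamma>1))
                         * morrey p2 q2 (\<lambda>x. ennreal (g x * norm x powr \<gamma>2))"
      by (simp add: mult.assoc)
  qed
qed

end
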